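(* Assume that the $\mathfrak{sl}_2$-connection $\mathrm{d}+A$ has an irregular singularity of Poisson order $1$ with diagonalizable irregular term, i.e. $A_k=0$ for $k>1$, $A_1=\mathrm{diag}(\xi,-\xi)$ with $\xi\neq 0$, and $A_k\in\mathfrak{sl}_2$ arbitrary for $k\leq 0$. Then $\mathcal{SF}_{\mathrm{d}+A}^{01}$ is a simple algebra of dimension $2^4$. Its unique simple module (up to isomorphism), of dimension $2^2$, is $V^{01}=\mathcal{SF}_{\mathrm{d}+A}^{0}$, with $\psi_0^\pm$ acting by left multiplication and $\psi_1^\pm$ acting by the anti-derivation $\xi\frac{\partial}{\partial\psi_0^\mp}$. Correspondingly, there is, up to isomorphism, a unique simple module of $\mathcal{SF}_{\mathrm{d}+A}$ in the category $\mathcal{C}$ of induced modules, namely $\mathrm{Ind}(V^{01})$. As a vector space and as an $\mathcal{SF}_{\mathrm{d}+A}^{\leq 0}$-module, $$\mathrm{Ind}(V^{01})=\mathcal{SF}_{\mathrm{d}+A}^{\leq 0}.$$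
   Context: All algebras are over $\mathbb{C}$. Indices $a,b\in\{+,-\}$; $\mathbb{C}^2$ has basis $e^+,e^-$ and symplectic form $(e^+,e^-)=1=-(e^-,e^+)$, $(e^\pm,e^\pm)=0$. Connection: $\mathrm{d}+A$ with $A(z)=\sum_{k}A_kz^{-k-1}$, $A_k\in\mathfrak{sl}_2(\mathbb{C})$. Put $C_k=\begin{pmatrix}0&-1\\1&0\end{pmatrix}A_k$ (rows and columns indexed by $+,-$ in this order), a symmetric matrix with entries $C_k^{ab}$. Thus $C_1=\begin{pmatrix}0&\xi\\\xi&0\end{pmatrix}$ and $C_k=0$ for $k>1$. $\mathcal{SF}_{\mathrm{d}+A}$ is the unital associative (Clifford) algebra with generators $\psi^\pm_n$, $n\in\mathbb{Z}$, and relations $\{\psi^a_m,\psi^b_n\}=m\,(e^a,e^b)\,\delta_{m+n,0}+C_{m+n}^{ab}$, where $\{x,y\}=xy+yx$. Superscripts $\leq0$, $\geq0$, $0$, $01$ denote the subalgebras generated by the $\psi_n^\pm$ with $n\leq 0$, $n\geq0$, $n=0$, $n\in\{0,1\}$ respectively. The anti-derivation $\partial/\partial\psi_0^\mp$ of the Clifford algebra $\mathcal{SF}^0_{\mathrm{d}+A}$ kills $1$, sends $\psi_0^\mp\mapsto 1$, $\psi_0^\pm\mapsto0$, and satisfies $D(xy)=D(x)y-xD(y)$ for $x\in\{\psi_0^+,\psi_0^-\}$. Given a representation $V$ of $\mathcal{SF}_{\mathrm{d}+A}^{01}$, extend it to $\mathcal{SF}_{\mathrm{d}+A}^{\geq0}$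 by letting $\psi_n^\pm$, $n\geq2$, act by zero, and set $\mathrm{Ind}(V)=\mathcal{SF}_{\mathrm{d}+A}\otimes_{\mathcal{SF}_{\mathrm{d}+A}^{\geq 0}}V$. $\mathcal{C}$ is the full subcategory of $\mathcal{SF}_{\mathrm{d}+A}$-modules in the (essential) image of $\mathrm{Ind}$. *)

theory Defs
  imports "HOL-Analysis.Determinants" "HOL-Algebra.Algebra"
    "HOL-Algebra.Algebraic_Closure_Type" "HOL-Algebra.Free_Abelian_Groups"
begin

section \<open>Modules over noncommutative rings\<close>

text \<open>
  The library's locale for modules demands a commutative base ring. The same axioms are repeated here
  over an arbitrary unital ring, reusing the record type of the library; its fields for the
  multiplication and unit of the module are junk and never looked at.

  The base rings below are complex algebras whose scalars are elements \<open>c \<cdot> 1\<close> of the ring. Hence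
  modules are automatically complex vector spaces, and submodules and module isomorphisms
  are automatically linear.
\<close>

locale lmodule = R?: ring R + M?: abelian_group M
  for R :: "('a, 'c) ring_scheme" (structure) and M :: "('a, 'b, 'd) module_scheme" (structure) +
  assumes smult_closed:
      "\<lbrakk>a \<in> carrier R; x \<in> carrier M\<rbrakk> \<Longrightarrow> a \<odot>\<^bsub>M\<^esub> x \<in> carrier M"
    and smult_l_distr:
      "\<lbrakk>a \<in> carrier R; b \<in> carrier R; x \<in> carrier M\<rbrakk> \<Longrightarrow>
       (a \<oplus> b) \<odot>\<^bsub>M\<^esub> x = a \<odot>\<^bsub>M\<^esub> x \<oplus>\<^bsub>M\<^esub> b \<odot>\<^bsub>M\<^esub> x"
    and smult_r_distr:
      "\<lbrakk>a \<in> carrier R; x \<in> carrier M; y \<in> carrier M\<rbrakk> \<Longrightarrow>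
       a \<odot>\<^bsub>M\<^esub> (x \<oplus>\<^bsub>M\<^esub> y) = a \<odot>\<^bsub>M\<^esub> x \<oplus>\<^bsub>M\<^esub> a \<odot>\<^bsub>M\<^esub> y"
    and smult_assoc:
      "\<lbrakk>a \<in> carrier R; b \<in> carrier R; x \<in> carrier M\<rbrakk> \<Longrightarrow>
       (a \<otimes> b) \<odot>\<^bsub>M\<^esub> x = a \<odot>\<^bsub>M\<^esub> (b \<odot>\<^bsub>M\<^esub> x)"
    and smult_one:
      "x \<in> carrier M \<Longrightarrow> \<one> \<odot>\<^bsub>M\<^esub> x = x"

definition simple_module :: "('a, 'c) ring_scheme \<Rightarrow> ('a, 'b) module \<Rightarrow> bool" where
  "simple_module R M \<longleftrightarrow> lmodule R M \<and> carrier M \<noteq> {\<zero>\<^bsub>M\<^esub>} \<and>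
     (\<forall>H. submodule H R M \<longrightarrow> H = {\<zero>\<^bsub>M\<^esub>} \<or> H = carrier M)"

definition module_iso ::
  "('a, 'c) ring_scheme \<Rightarrow> ('a, 'b) module \<Rightarrow> ('a, 'd) module \<Rightarrow> ('b \<Rightarrow> 'd) set" where
  "module_iso R M N = {f. bij_betw f (carrier M) (carrier N) \<and>
     (\<forall>x\<in>carrier M. \<forall>y\<in>carrier M. f (x \<oplus>\<^bsub>M\<^esub> y) = f x \<oplus>\<^bsub>N\<^esub> f y) \<and>
     (\<forall>r\<in>carrier R. \<forall>x\<in>carrier M. f (r \<odot>\<^bsub>M\<^esub> x) = r \<odot>\<^bsub>N\<^esub> f x)}"

definition isomorphic_modules ::
  "('a, 'c) ring_scheme \<Rightarrow> ('a, 'b) module \<Rightarrow> ('a, 'd) module \<Rightarrow> bool" where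
  "isomorphic_modules R M N \<longleftrightarrow> module_iso R M N \<noteq> {}"

definition regular_module :: "'a ring \<Rightarrow> ('a, 'a) module" where
  "regular_module R = \<lparr>carrier = carrier R, mult = mult R, one = \<one>\<^bsub>R\<^esub>,
     ring.zero = \<zero>\<^bsub>R\<^esub>, add = add R, module.smult = mult R\<rparr>"

text \<open>For a unital algebra, two-sided ring ideals and two-sided algebra ideals coincide.\<close>

definition simple_algebra :: "('a, 'c) ring_scheme \<Rightarrow> bool" where
  "simple_algebra R \<longleftrightarrow> ring R \<and> carrier R \<noteq> {\<zero>\<^bsub>R\<^esub>} \<and>
     (\<forall>I. ideal I R \<longrightarrow> I = {\<zero>\<^bsub>R\<^esub>} \<or> I = carrier R)"


section \<open>Tensor product over a subring\<close>

text \<open>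
  For a subring \<open>S\<close> of \<open>R\<close> and a left \<open>S\<close>-module \<open>V\<close>, the left \<open>R\<close>-module \<open>R \<otimes>\<^sub>S V\<close> is the
  free abelian group on the pairs \<open>(x, v)\<close> modulo biadditivity and \<open>S\<close>-balancedness.
\<close>

abbreviation tensor_free ::
  "('a, 'c) ring_scheme \<Rightarrow> ('a, 'v) module \<Rightarrow> (('a \<times> 'v) \<Rightarrow>\<^sub>0 int) monoid" where
  "tensor_free R V \<equiv> free_Abelian_group (carrier R \<times> carrier V)"

definition tensor_rel ::
  "('a, 'c) ring_scheme \<Rightarrow> 'a set \<Rightarrow> ('a, 'v) module \<Rightarrow> (('a \<times> 'v) \<Rightarrow>\<^sub>0 int) set" where
  "tensor_rel R S V = generate (tensor_free R V)
     ({frag_of (x \<oplus>\<^bsub>R\<^esub> y, v) - frag_of (x, v) - frag_of (y, v) | x y v.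
         x \<in> carrier R \<and> y \<in> carrier R \<and> v \<in> carrier V} \<union>
      {frag_of (x, v \<oplus>\<^bsub>V\<^esub> w) - frag_of (x, v) - frag_of (x, w) | x v w.
         x \<in> carrier R \<and> v \<in> carrier V \<and> w \<in> carrier V} \<union>
      {frag_of (x \<otimes>\<^bsub>R\<^esub> s, v) - frag_of (x, s \<odot>\<^bsub>V\<^esub> v) | x s v.
         x \<in> carrier R \<and> s \<in> S \<and> v \<in> carrier V})"

definition pure_tensor ::
  "('a, 'c) ring_scheme \<Rightarrow> 'a set \<Rightarrow> ('a, 'v) module \<Rightarrow> 'a \<Rightarrow> 'v \<Rightarrow> (('a \<times> 'v) \<Rightarrow>\<^sub>0 int) set" where
  "pure_tensor R S V x v = tensor_rel R S V #>\<^bsub>tensor_free R V\<^esub> frag_of (x, v)"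

definition tensor_module ::
  "('a, 'c) ring_scheme \<Rightarrow> 'a set \<Rightarrow> ('a, 'v) module \<Rightarrow> ('a, (('a \<times> 'v) \<Rightarrow>\<^sub>0 int) set) module" where
  "tensor_module R S V = (let G = tensor_free R V; N = tensor_rel R S V in
     \<lparr>carrier = carrier (G Mod N), mult = undefined, one = undefined,
      ring.zero = \<one>\<^bsub>G Mod N\<^esub>, add = mult (G Mod N),
      module.smult = (\<lambda>r T. \<Union>t\<in>T. N #>\<^bsub>G\<^esub> frag_extend (\<lambda>(x, v). frag_of (r \<otimes>\<^bsub>R\<^esub> x, v)) t)\<rparr>)"


section \<open>The Clifford algebra of a connection\<close>

datatype pm = Pls | Mns

instance pm :: finite
proof
  have "(UNIV :: pm set) = {Pls, Mns}"
    using pm.exhaust by auto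
  then show "finite (UNIV :: pm set)"
    by (metis finite.emptyI finite_insert)
qed

fun opp :: "pm \<Rightarrow> pm" where
  "opp Pls = Mns" | "opp Mns = Pls"

fun symp :: "pm \<Rightarrow> pm \<Rightarrow> complex" where
  "symp Pls Mns = 1" | "symp Mns Pls = -1" | "symp Pls Pls = 0" | "symp Mns Mns = 0"

text \<open>
  A connection \<open>d + A\<close> is given by its coefficients: \<open>A k\<close> is the coefficient of \<open>z\<close> to the
  power \<open>-k - 1\<close>, a matrix with rows and columns indexed by \<^typ>\<open>pm\<close>.
\<close>

type_synonym conn = "int \<Rightarrow> complex^pm^pm"

definition diag_pm :: "complex \<Rightarrow> complex \<Rightarrow> complex^pm^pm" where
  "diag_pm x y = (\<chi> a b. if a = b then (case a of Pls \<Rightarrow> x | Mns \<Rightarrow> y) else 0)"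

definition J_mat :: "complex^pm^pm" where
  "J_mat = (\<chi> a b. if a = b then 0 else if a = Pls then -1 else 1)"

definition C_mat :: "conn \<Rightarrow> conn" where
  "C_mat A k = J_mat ** A k"

text \<open>
  The free algebra on symbols \<open>(a, n)\<close> is the monoid algebra of the words in these symbols.
  The product of \<^type>\<open>poly_mapping\<close> is convolution with respect to addition of keys, so
  concatenation of words has to be written additively.
\<close>

instantiation list :: (type) monoid_add
begin

definition zero_list :: "'a list" where "zero_list = []"

definition plus_list :: "'a list \<Rightarrow> 'a list \<Rightarrow> 'a list" where "plus_list = append"

instance
  by standard (simp_all add: zero_list_def plus_list_def)

end

type_synonym free_elt = "(pm \<times> int) list \<Rightarrow>\<^sub>0 complex"

type_synonym sf_elt = "free_elt set"

abbreviation free_alg :: "free_elt ring" where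
  "free_alg \<equiv> ring_of_type_algebra"

definition gen :: "pm \<Rightarrow> int \<Rightarrow> free_elt" where
  "gen a n = Poly_Mapping.single [(a, n)] 1"

definition const :: "complex \<Rightarrow> free_elt" where
  "const c = Poly_Mapping.single [] c"

definition SF_rel :: "conn \<Rightarrow> free_elt set" where
  "SF_rel A = {gen a m * gen b n + gen b n * gen a m
      - const (of_int m * symp a b * (if m + n = 0 then 1 else 0) + C_mat A (m + n) $ a $ b)
      | a b m n. True}"

definition SF_ideal :: "conn \<Rightarrow> free_elt set" where
  "SF_ideal A = Idl\<^bsub>free_alg\<^esub> (SF_rel A)"

definition SF :: "conn \<Rightarrow> sf_elt ring" where
  "SF A = free_alg Quot SF_ideal A"

definition psi :: "conn \<Rightarrow> pm \<Rightarrow> int \<Rightarrow> sf_elt" where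
  "psi A a n = SF_ideal A +>\<^bsub>free_alg\<^esub> gen a n"

definition scal :: "conn \<Rightarrow> complex \<Rightarrow> sf_elt" where
  "scal A c = SF_ideal A +>\<^bsub>free_alg\<^esub> const c"

text \<open>\<open>SF_sub A N\<close> is the unital complex subalgebra generated by the \<open>\<psi>\<^sub>n\<close> with \<open>n \<in> N\<close>.\<close>

definition SF_sub :: "conn \<Rightarrow> int set \<Rightarrow> sf_elt ring" where
  "SF_sub A N = (SF A)\<lparr>carrier :=
     generate_ring (SF A) (range (scal A) \<union> {psi A a n | a n. n \<in> N})\<rparr>"


section \<open>Induced modules\<close>

definition is_extension ::
  "conn \<Rightarrow> (sf_elt, 'v) module \<Rightarrow> (sf_elt, 'v) module \<Rightarrow> bool" where
  "is_extension A V W \<longleftrightarrow> lmodule (SF_sub A {0..}) W \<and>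
     carrier W = carrier V \<and> add W = add V \<and> \<zero>\<^bsub>W\<^esub> = \<zero>\<^bsub>V\<^esub> \<and>
     (\<forall>x\<in>carrier (SF_sub A {0, 1}). \<forall>v\<in>carrier V. x \<odot>\<^bsub>W\<^esub> v = x \<odot>\<^bsub>V\<^esub> v) \<and>
     (\<forall>n\<ge>2. \<forall>a. \<forall>v\<in>carrier V. psi A a n \<odot>\<^bsub>W\<^esub> v = \<zero>\<^bsub>V\<^esub>)"

text \<open>
  The conditions determine the action on the carrier, so the choice only concerns values outside
  the carriers (and the junk fields of the record).
\<close>

definition extend_rep :: "conn \<Rightarrow> (sf_elt, 'v) module \<Rightarrow> (sf_elt, 'v) module" where
  "extend_rep A V = (SOME W. is_extension A V W)"

definition Ind ::
  "conn \<Rightarrow> (sf_elt, 'v) module \<Rightarrow> (sf_elt, ((sf_elt \<times> 'v) \<Rightarrow>\<^sub>0 int) set) module" where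
  "Ind A V = tensor_module (SF A) (carrier (SF_sub A {0..})) (extend_rep A V)"

definition Ind_tensor ::
  "conn \<Rightarrow> (sf_elt, 'v) module \<Rightarrow> sf_elt \<Rightarrow> 'v \<Rightarrow> ((sf_elt \<times> 'v) \<Rightarrow>\<^sub>0 int) set" where
  "Ind_tensor A V = pure_tensor (SF A) (carrier (SF_sub A {0..})) (extend_rep A V)"

text \<open>
  Membership in the essential image of induction. HOL cannot quantify over types inside a formula,
  so the type \<open>'v\<close> of the elements of the inducing module is an explicit parameter.
\<close>

definition in_C :: "'v itself \<Rightarrow> conn \<Rightarrow> (sf_elt, 'm) module \<Rightarrow> bool" where
  "in_C ty A M \<longleftrightarrow> lmodule (SF A) M \<and>
     (\<exists>V :: (sf_elt, 'v) module. lmodule (SF_sub A {0, 1}) V \<and> isomorphic_modules (SF A) M (Ind A V))"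


section \<open>The module \<open>V\<^sup>0\<^sup>1\<close>\<close>

text \<open>\<open>is_dpsi A b D\<close>: on the algebra generated by the \<open>\<psi>\<^sub>0\<close>, \<open>D\<close> is the anti-derivation
  \<open>\<partial> / \<partial>\<psi>\<^sub>0\<^sup>b\<close>. It is unique there.\<close>

definition is_dpsi :: "conn \<Rightarrow> pm \<Rightarrow> (sf_elt \<Rightarrow> sf_elt) \<Rightarrow> bool" where
  "is_dpsi A b D \<longleftrightarrow> (let R = SF_sub A {0} in
     D \<in> carrier R \<rightarrow> carrier R \<and>
     (\<forall>x\<in>carrier R. \<forall>y\<in>carrier R. D (x \<oplus>\<^bsub>R\<^esub> y) = D x \<oplus>\<^bsub>R\<^esub> D y) \<and>
     (\<forall>c. \<forall>x\<in>carrier R. D (scal A c \<otimes>\<^bsub>R\<^esub> x) = scal A c \<otimes>\<^bsub>R\<^esub> D x) \<and>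
     D \<one>\<^bsub>R\<^esub> = \<zero>\<^bsub>R\<^esub> \<and>
     D (psi A b 0) = \<one>\<^bsub>R\<^esub> \<and>
     D (psi A (opp b) 0) = \<zero>\<^bsub>R\<^esub> \<and>
     (\<forall>a. \<forall>y\<in>carrier R.
        D (psi A a 0 \<otimes>\<^bsub>R\<^esub> y) = (D (psi A a 0) \<otimes>\<^bsub>R\<^esub> y) \<ominus>\<^bsub>R\<^esub> (psi A a 0 \<otimes>\<^bsub>R\<^esub> D y)))"

text \<open>
  The additive structure of \<open>V\<^sup>0\<^sup>1\<close> and its scalar multiplication are those of the algebra
  generated by the \<open>\<psi>\<^sub>0\<close>.
\<close>

definition is_V01 :: "conn \<Rightarrow> complex \<Rightarrow> (sf_elt, sf_elt) module \<Rightarrow> bool" where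
  "is_V01 A \<xi> V \<longleftrightarrow> (let R = SF_sub A {0} in
     lmodule (SF_sub A {0, 1}) V \<and>
     carrier V = carrier R \<and> add V = add R \<and> \<zero>\<^bsub>V\<^esub> = \<zero>\<^bsub>R\<^esub> \<and>
     (\<forall>c. \<forall>y\<in>carrier R. scal A c \<odot>\<^bsub>V\<^esub> y = scal A c \<otimes>\<^bsub>R\<^esub> y) \<and>
     (\<forall>a. \<forall>y\<in>carrier R. psi A a 0 \<odot>\<^bsub>V\<^esub> y = psi A a 0 \<otimes>\<^bsub>R\<^esub> y) \<and>
     (\<forall>a. \<exists>D. is_dpsi A (opp a) D \<and>
        (\<forall>y\<in>carrier R. psi A a 1 \<odot>\<^bsub>V\<^esub> y = scal A \<xi> \<otimes>\<^bsub>R\<^esub> D y)))"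

text \<open>As for extensions, only junk is left to choice.\<close>

definition V01 :: "conn \<Rightarrow> complex \<Rightarrow> (sf_elt, sf_elt) module" where
  "V01 A \<xi> = (SOME V. is_V01 A \<xi> V)"

end

(*
  Order the generators by mode number. Straightening words gives an action of the free algebra on
  the span of the strictly increasing words which respects the Clifford relations, so these words
  form a basis of SF. The words with some letter of positive mode span the left ideal generated by
  the positive modes; the quotient by it is the Fock space, the span of the words of nonpositive
  letters. On words whose letters are not below psi^b_m, the operator psi^(opp b)_(1-m) acts as
  xi times the derivative with respect to psi^b_m, because C_1 is invertible and C_k = 0 for k > 1.
  Hence every nonzero vector of the Fock space can be sent to the vacuum, so that every simple
  module containing a nonzero vector killed by the positive modes is the Fock space. This applies
  to the modes 0, 1 and to all modes alike.
*)

theory Submission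
  imports Defs
begin

section \<open>Linear algebra in the free algebra\<close>

text \<open>Since \<open>SF\<close> is a quotient by an ideal and \<open>Ind\<close> a quotient of a
  free abelian group, nonvanishing is the delicate point in both. In \<open>SF\<close> it is settled
  by \<open>nf\<close>, whose kernel is the ideal of relations; in the induced module it is settled
  by a balanced map into the free algebra built from \<open>phi\<close>. Positive letters stand last
  for the following reason. Straightening contracts a letter u with s only if u does not precede s;
  if s has positive mode, the two modes then add up to at least 2 and the contraction vanishes. So
  words with a positive letter are stable under left multiplication. In an induced module the
  vectors 1 tensor v are killed only by the modes from 2 on. The two modes of index 1 square to zero
  and anticommute with all positive modes, so applying them where they do not vanish leads to a
  vector killed by all positive modes. \<open>V01\<close> and \<open>extend_rep\<close> are choices
  and are accessible only through their defining properties; \<open>fock {0, 1}\<close> and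
  \<open>extension V\<close> witness that these properties can be met.\<close>

type_synonym letter = "pm \<times> int"

definition mon :: "letter list \<Rightarrow> free_elt" where
  "mon w = Poly_Mapping.single w 1"

lemma gen_eq_mon: "gen a n = mon [(a, n)]"
  by (simp add: gen_def mon_def)

lemma mon_Nil [simp]: "mon [] = 1"
  unfolding mon_def by (metis single_one zero_list_def)

lemma mon_append: "mon (u @ v) = mon u * mon v"
  by (simp add: mon_def mult_single plus_list_def)

lemma mon_Cons: "mon (u # v) = mon [u] * mon v"
  using mon_append[of "[u]" v] by simp

lemma const_add: "const (c + d) = const c + const d"
  by (simp add: const_def single_add)

lemma const_mult: "const (c * d) = const c * const d"
  by (simp add: const_def mult_single plus_list_def)

lemma const_0 [simp]: "const 0 = 0"
  by (simp add: const_def)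

lemma const_1 [simp]: "const 1 = 1"
  using mon_Nil by (simp add: const_def mon_def)

lemma const_uminus: "const (- c) = - const c"
  by (simp add: const_def single_uminus)

lemma const_minus1 [simp]: "const (- 1) = - 1"
  by (simp add: const_uminus)

lemma const_times_mon: "const c * mon w = Poly_Mapping.single w c"
  by (simp add: const_def mon_def mult_single plus_list_def)

lemma keys_mon [simp]: "Poly_Mapping.keys (mon w) = {w}"
  by (simp add: mon_def)

lemma lookup_const_times: "Poly_Mapping.lookup (const c * x) w = c * Poly_Mapping.lookup x w"
proof -
  have "const c * x = Poly_Mapping.map ((*) c) x"
    by (simp add: const_def mult_map_scale_conv_mult zero_list_def)
  then show ?thesis
    by (simp add: map.rep_eq when_def)
qed

lemma mon_expansion: "x = (\<Sum>w\<in>Poly_Mapping.keys x. const (Poly_Mapping.lookup x w) * mon w)"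
proof (rule poly_mapping_eqI)
  fix v
  show "Poly_Mapping.lookup x v = Poly_Mapping.lookup (\<Sum>w\<in>Poly_Mapping.keys x. const (Poly_Mapping.lookup x w) * mon w) v"
    by (simp add: lookup_sum const_times_mon lookup_single when_def sum.delta in_keys_iff)
qed

section \<open>Spans of sets of words\<close>

definition supp_in :: "letter list set \<Rightarrow> free_elt set" where
  "supp_in W = {x. Poly_Mapping.keys x \<subseteq> W}"

lemma supp_in_mono: "W \<subseteq> W' \<Longrightarrow> supp_in W \<subseteq> supp_in W'"
  by (auto simp: supp_in_def)

lemma supp_in_UNIV [simp]: "supp_in UNIV = UNIV"
  by (simp add: supp_in_def)

lemma supp_in_0 [simp]: "0 \<in> supp_in W"
  by (simp add: supp_in_def)

lemma mon_supp_in_iff [simp]: "mon w \<in> supp_in W \<longleftrightarrow> w \<in> W"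
  by (simp add: supp_in_def)

lemma supp_in_add: "x \<in> supp_in W \<Longrightarrow> y \<in> supp_in W \<Longrightarrow> x + y \<in> supp_in W"
  using keys_add[of x y] by (auto simp: supp_in_def)

lemma supp_in_uminus: "x \<in> supp_in W \<Longrightarrow> - x \<in> supp_in W"
  by (auto simp: supp_in_def)

lemma supp_in_diff: "x \<in> supp_in W \<Longrightarrow> y \<in> supp_in W \<Longrightarrow> x - y \<in> supp_in W"
  using supp_in_add[of x W "- y"] supp_in_uminus[of y W] by simp

lemma supp_in_const_times: "x \<in> supp_in W \<Longrightarrow> const c * x \<in> supp_in W"
  by (auto simp: supp_in_def in_keys_iff lookup_const_times)

lemmas supp_in_closed = supp_in_add supp_in_diff supp_in_const_times supp_in_uminus supp_in_0

lemma supp_in_induct [consumes 1, case_names zero add mon]: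
  assumes "x \<in> supp_in W" and "P 0"
    and add: "\<And>x y. x \<in> supp_in W \<Longrightarrow> y \<in> supp_in W \<Longrightarrow> P x \<Longrightarrow> P y \<Longrightarrow> P (x + y)"
    and mon: "\<And>c w. w \<in> W \<Longrightarrow> P (const c * mon w)"
  shows "P x"
proof -
  have "(\<Sum>w\<in>K. const (Poly_Mapping.lookup x w) * mon w) \<in> supp_in W
      \<and> P (\<Sum>w\<in>K. const (Poly_Mapping.lookup x w) * mon w)"
    if "finite K" "K \<subseteq> W" for K
    using that
  proof (induction K)
    case empty
    then show ?case using assms(2) by simp
  next
    case (insert a F)
    then show ?case by (auto intro!: add mon supp_in_closed)
  qed
  from this[of "Poly_Mapping.keys x"] show ?thesis
    using assms(1) mon_expansion[of x] by (simp add: supp_in_def)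
qed

text \<open>Multiplication by \<open>const c\<close> can therefore serve as scalar multiplication:
  it passes through products on either side.\<close>

lemma const_commute: "const c * x = x * const c"
proof -
  have "x \<in> supp_in UNIV" by simp
  then show ?thesis
  proof (induction x rule: supp_in_induct)
    case (mon d w)
    then show ?case
      by (simp add: const_times_mon) (simp add: const_def mult_single plus_list_def mult.commute)
  qed (simp_all add: algebra_simps)
qed

lemma mult_const_left: "x * (const c * y) = const c * (x * y)"
  by (metis const_commute mult.assoc)

section \<open>Complex linear maps of the free algebra\<close>

definition clin :: "(free_elt \<Rightarrow> free_elt) \<Rightarrow> bool" where
  "clin f \<longleftrightarrow> (\<forall>x y. f (x + y) = f x + f y) \<and> (\<forall>c x. f (const c * x) = const c * f x)"

lemma clinI:
  "(\<And>x y. f (x + y) = f x + f y) \<Longrightarrow> (\<And>c x. f (const c * x) = const c * f x) \<Longrightarrow> clin f"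
  by (simp add: clin_def)

lemma clin_add: "clin f \<Longrightarrow> f (x + y) = f x + f y"
  by (simp add: clin_def)

lemma clin_const: "clin f \<Longrightarrow> f (const c * x) = const c * f x"
  by (simp add: clin_def)

lemma clin_0: "clin f \<Longrightarrow> f 0 = 0"
  using clin_const[of f 0 0] by simp

lemma clin_uminus: "clin f \<Longrightarrow> f (- x) = - f x"
  using clin_const[of f "- 1" x] by simp

lemma clin_diff: "clin f \<Longrightarrow> f (x - y) = f x - f y"
  using clin_add[of f x "- y"] clin_uminus[of f y] by simp

lemmas clin_simps = clin_add clin_diff clin_const clin_uminus clin_0

lemma clin_id [simp]: "clin (\<lambda>x. x)"
  and clin_zero [simp]: "clin (\<lambda>x. 0)"
  by (simp_all add: clin_def)

lemma clin_comp: "clin f \<Longrightarrow> clin g \<Longrightarrow> clin (\<lambda>x. f (g x))"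
  by (simp add: clin_def)

lemma clin_plus: "clin f \<Longrightarrow> clin g \<Longrightarrow> clin (\<lambda>x. f x + g x)"
  by (simp add: clin_def algebra_simps)

lemma clin_minus: "clin f \<Longrightarrow> clin g \<Longrightarrow> clin (\<lambda>x. f x - g x)"
  by (simp add: clin_def algebra_simps)

lemma clin_mult_left: "clin f \<Longrightarrow> clin (\<lambda>x. a * f x)"
  by (simp add: clin_def algebra_simps mult_const_left)

lemma clin_mult_right: "clin f \<Longrightarrow> clin (\<lambda>x. f x * a)"
  by (simp add: clin_def algebra_simps)

lemmas clin_intros = clin_id clin_zero clin_plus clin_minus clin_mult_left clin_mult_right

text \<open>Identities that are linear in one argument are reduced to single words in this way; with
  several arguments it is applied to one after the other.\<close>

lemma clin_eq:
  assumes "clin f" "clin g" "\<And>w. w \<in> W \<Longrightarrow> f (mon w) = g (mon w)" "x \<in> supp_in W"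
  shows "f x = g x"
  using assms(4)
  by (induction x rule: supp_in_induct) (simp_all add: assms clin_simps)

lemma clin_into:
  assumes "clin f" "\<And>w. w \<in> W \<Longrightarrow> f (mon w) \<in> supp_in W'" "x \<in> supp_in W"
  shows "f x \<in> supp_in W'"
  using assms(3)
  by (induction x rule: supp_in_induct) (auto simp add: assms clin_simps intro!: supp_in_closed)

definition lin_ext :: "(letter list \<Rightarrow> free_elt) \<Rightarrow> free_elt \<Rightarrow> free_elt" where
  "lin_ext f x = (\<Sum>w\<in>Poly_Mapping.keys x. const (Poly_Mapping.lookup x w) * f w)"

lemma lin_ext_superset:
  assumes "finite K" "Poly_Mapping.keys x \<subseteq> K"
  shows "lin_ext f x = (\<Sum>w\<in>K. const (Poly_Mapping.lookup x w) * f w)"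
  unfolding lin_ext_def
  by (rule sum.mono_neutral_left) (use assms in \<open>auto simp: in_keys_iff\<close>)

lemma clin_lin_ext [simp]: "clin (lin_ext f)"
proof (rule clinI)
  fix x y :: free_elt
  let ?K = "Poly_Mapping.keys x \<union> Poly_Mapping.keys y"
  have "lin_ext f (x + y) = (\<Sum>w\<in>?K. const (Poly_Mapping.lookup (x + y) w) * f w)"
    by (rule lin_ext_superset) (use keys_add[of x y] in auto)
  also have "\<dots> = lin_ext f x + lin_ext f y"
    by (simp add: lin_ext_superset[of ?K x] lin_ext_superset[of ?K y] lookup_add const_add
        distrib_right sum.distrib)
  finally show "lin_ext f (x + y) = lin_ext f x + lin_ext f y" .
next
  fix c and x :: free_elt
  have "Poly_Mapping.keys (const c * x) \<subseteq> Poly_Mapping.keys x"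
    by (auto simp: in_keys_iff lookup_const_times)
  then have "lin_ext f (const c * x) = (\<Sum>w\<in>Poly_Mapping.keys x. const (Poly_Mapping.lookup (const c * x) w) * f w)"
    by (rule lin_ext_superset[rotated]) simp
  also have "\<dots> = const c * lin_ext f x"
    by (simp add: lookup_const_times const_mult lin_ext_def sum_distrib_left mult.assoc)
  finally show "lin_ext f (const c * x) = const c * lin_ext f x" .
qed

lemma lin_ext_mon [simp]: "lin_ext f (mon w) = f w"
  by (simp add: lin_ext_def) (simp add: mon_def)

section \<open>Projections onto the span of the words with a given property\<close>

definition restrict_words :: "(letter list \<Rightarrow> bool) \<Rightarrow> free_elt \<Rightarrow> free_elt" where
  "restrict_words P = lin_ext (\<lambda>w. if P w then mon w else 0)"

lemma clin_cut [simp]: "clin (restrict_words P)"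
  by (simp add: restrict_words_def)

lemmas cut_simps [simp] = clin_simps[OF clin_cut]

lemma cut_mon [simp]: "restrict_words P (mon w) = (if P w then mon w else 0)"
  by (simp add: restrict_words_def)

lemma cut_in: "x \<in> supp_in W \<Longrightarrow> restrict_words P x \<in> supp_in {w \<in> W. P w}"
  by (rule clin_into[OF clin_cut]) auto

lemma cut_id: "x \<in> supp_in {w. P w} \<Longrightarrow> restrict_words P x = x"
  by (rule clin_eq[of _ "\<lambda>x. x"]) auto

lemma cut_zero: "x \<in> supp_in {w. \<not> P w} \<Longrightarrow> restrict_words P x = 0"
  by (rule clin_eq[of _ "\<lambda>x. 0" "{w. \<not> P w}"]) auto

lemma cut_diff_in: "x \<in> supp_in W \<Longrightarrow> x - restrict_words P x \<in> supp_in {w \<in> W. \<not> P w}"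
  by (rule clin_into[where W = W]) (auto intro: clin_intros)

section \<open>Normal forms in a Clifford algebra\<close>

text \<open>Words are sorted by mode first, so the letters of positive mode come last.\<close>

definition key :: "letter \<Rightarrow> int" where
  "key u = 2 * snd u + (if fst u = Pls then 0 else 1)"

lemma key_eq_iff [simp]: "key u = key v \<longleftrightarrow> u = v"
proof
  assume eq: "key u = key v"
  then have "snd u = snd v"
    by (simp add: key_def split: if_splits; presburger)
  with eq show "u = v"
    by (cases "fst u"; cases "fst v") (auto simp: key_def prod_eq_iff)
qed simp

lemma key_less_imp: "key u < key v \<Longrightarrow> snd u \<le> snd v"
  by (auto simp: key_def split: if_splits)

definition above :: "letter \<Rightarrow> letter set" where
  "above s = {v. key s < key v}"

definition increasing :: "letter set \<Rightarrow> letter list set" where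
  "increasing P = {w. sorted_wrt (\<lambda>s t. key s < key t) w \<and> set w \<subseteq> P}"

lemma Nil_in_sw [simp]: "[] \<in> increasing P"
  by (simp add: increasing_def)

lemma Cons_in_sw: "s # t \<in> increasing P \<longleftrightarrow> s \<in> P \<and> t \<in> increasing (P \<inter> above s)"
  by (auto simp: increasing_def above_def)

lemma sw_mono: "P \<subseteq> Q \<Longrightarrow> increasing P \<subseteq> increasing Q"
  by (auto simp: increasing_def)

lemma sw_lists: "increasing P \<subseteq> lists P"
  by (auto simp: increasing_def)

lemma mult_supp_lists: "x \<in> supp_in (lists P) \<Longrightarrow> y \<in> supp_in (lists P) \<Longrightarrow> x * y \<in> supp_in (lists P)"
  using keys_mult[of x y] by (fastforce simp: supp_in_def plus_list_def)

lemma const_supp_lists [simp]: "const c \<in> supp_in (lists P)"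
  using supp_in_const_times[of 1 "lists P" c] mon_supp_in_iff[of "[]" "lists P"] by simp

lemma one_supp_lists [simp]: "1 \<in> supp_in (lists P)"
  using const_supp_lists[of 1] by simp

lemma one_supp_sw [simp]: "1 \<in> supp_in (increasing P)"
  using mon_supp_in_iff[of "[]" "increasing P"] by simp

lemma mon_Cons_supp:
  assumes "s \<in> P" "x \<in> supp_in (increasing (P \<inter> above s))"
  shows "mon [s] * x \<in> supp_in (increasing P)"
  by (rule clin_into[OF _ _ assms(2)])
    (use assms(1) in \<open>auto intro: clin_intros simp: mon_Cons[symmetric] Cons_in_sw\<close>)

section \<open>Straightening for an arbitrary symmetric form\<close>

locale clifford =
  fixes B :: "letter \<Rightarrow> letter \<Rightarrow> complex"
  assumes B_sym: "B u v = B v u"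
begin

definition I :: "free_elt set" where
  "I = Idl\<^bsub>free_alg\<^esub> {mon [u] * mon [v] + mon [v] * mon [u] - const (B u v) | u v. True}"

text \<open>\<open>straighten u w\<close> is the product of \<open>u\<close> and an increasing word \<open>w\<close>, written in increasing words.\<close>

fun straighten :: "letter \<Rightarrow> letter list \<Rightarrow> free_elt" where
  "straighten u [] = mon [u]"
| "straighten u (s # t) = (if key u < key s then mon (u # s # t)
     else if u = s then const (B u u / 2) * mon t
     else const (B u s) * mon t - mon [s] * straighten u t)"

text \<open>Left multiplication by u in the model spanned by the increasing words. It is defined on
  the whole free algebra to be total; the Clifford relations are asserted on that span.\<close>

definition L :: "letter \<Rightarrow> free_elt \<Rightarrow> free_elt" where
  "L u = lin_ext (straighten u)"

lemma clin_L [simp]: "clin (L u)"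
  by (simp add: L_def)

lemmas L_simps [simp] = clin_simps[OF clin_L]

lemma L_mon: "L u (mon w) = straighten u w"
  by (simp add: L_def)

lemma L_1 [simp]: "L u 1 = mon [u]"
  using L_mon[of u "[]"] by simp

text \<open>Straightening only moves or contracts letters, so none outside P appears. A letter that
  has passed s lies above s, which keeps \<open>mon [s] * straighten u t\<close> increasing.\<close>

lemma ins_supp: "u \<in> P \<Longrightarrow> w \<in> increasing P \<Longrightarrow> straighten u w \<in> supp_in (increasing P)"
proof (induction w arbitrary: P)
  case Nil
  then show ?case by (simp add: Cons_in_sw)
next
  case (Cons s t)
  then have t: "t \<in> increasing (P \<inter> above s)" "s \<in> P" by (simp_all add: Cons_in_sw)
  then have t': "t \<in> increasing P" using sw_mono[of "P \<inter> above s" P] by auto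
  consider "key u < key s" | "u = s" | "key s < key u"
    by (metis key_eq_iff linorder_neqE)
  then show ?case
  proof cases
    case 1
    with Cons.prems have "u # s # t \<in> increasing P"
      by (auto simp: increasing_def)
    with 1 show ?thesis by simp
  next
    case 2
    with t' show ?thesis by (simp add: supp_in_closed)
  next
    case 3
    with Cons t have "straighten u t \<in> supp_in (increasing (P \<inter> above s))"
      by (simp add: above_def)
    with t have "mon [s] * straighten u t \<in> supp_in (increasing P)"
      by (simp add: mon_Cons_supp)
    with 3 t' show ?thesis by (auto simp: supp_in_closed)
  qed
qed

lemma L_supp: "u \<in> P \<Longrightarrow> x \<in> supp_in (increasing P) \<Longrightarrow> L u x \<in> supp_in (increasing P)"
  by (rule clin_into[OF clin_L]) (auto simp: L_mon ins_supp)

lemma L_greater: "key s < key u \<Longrightarrow> L u (mon [s] * x) = const (B u s) * x - mon [s] * L u x"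
  by (rule clin_eq[of _ _ UNIV])
    (auto simp: L_mon mon_Cons[symmetric] intro!: clin_intros intro: clin_comp[OF clin_L])

lemma L_same: "L u (mon [u] * x) = const (B u u / 2) * x"
  by (rule clin_eq[of _ _ UNIV])
    (auto simp: L_mon mon_Cons[symmetric] intro!: clin_intros intro: clin_comp[OF clin_L])

lemma L_less: "x \<in> supp_in (increasing (above u)) \<Longrightarrow> L u x = mon [u] * x"
proof (erule clin_eq[rotated 3])
  fix w assume "w \<in> increasing (above u)"
  then show "L u (mon w) = mon [u] * mon w"
    by (cases w) (auto simp: L_mon mon_Cons[symmetric] Cons_in_sw above_def)
qed (auto intro: clin_intros)

lemma const_half: "const (c / 2) * x + const (c / 2) * x = const c * x"
  by (simp flip: distrib_right const_add)

text \<open>The claim is symmetric in u and v, so key u <= key v may be assumed; the position of u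
  relative to the first letter s then decides. If u precedes s, it is merely prepended. If u is s,
  the square B u u / 2 enters. If both letters have to pass s, their contractions with s cancel in
  the sum and the induction hypothesis applies to the tail.\<close>

lemma L_anticommute_mon:
  "w \<in> increasing UNIV \<Longrightarrow> L u (L v (mon w)) + L v (L u (mon w)) = const (B u v) * mon w"
proof (induction w arbitrary: u v)
  case Nil
  have wlog: "L u (L v (mon [])) + L v (L u (mon [])) = const (B u v) * mon []"
    if le: "key u \<le> key v" for u v
  proof -
    show ?thesis
    proof (cases "u = v")
      case True
      then show ?thesis
        using L_same[of u 1] by (simp add: L_mon const_half flip: mon_Nil)
    next
      case False
      with le have less: "key u < key v" by (simp add: order_le_less)
      then have "L u (mon [v]) = mon [u] * mon [v]" "L v (mon [u]) = const (B v u) - mon [u] * mon [v]"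
        using L_greater[of u v 1] by (simp_all add: L_mon flip: mon_Cons)
      then show ?thesis
        by (simp add: B_sym[of u v])
    qed
  qed
  show ?case
    using wlog[of u v] wlog[of v u] B_sym[of u v] by (cases "key u \<le> key v") (simp_all add: add.commute)
next
  case (Cons s t)
  let ?T = "mon t"
  have w: "mon (s # t) = mon [s] * ?T" by (rule mon_Cons)
  have t: "t \<in> increasing (above s)" "t \<in> increasing UNIV"
    using Cons.prems sw_mono[of "above s" UNIV] by (auto simp: Cons_in_sw)
  have wlog: "L u (L v (mon (s # t))) + L v (L u (mon (s # t))) = const (B u v) * mon (s # t)"
    if le: "key u \<le> key v" for u v
  proof -
    consider "key u < key s" | "u = s" | "key s < key u"
      by (metis key_eq_iff linorder_neqE)
    then show ?thesis
    proof cases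
      case 1
      then have st: "mon (s # t) \<in> supp_in (increasing (above u))"
        using Cons.prems by (auto simp: increasing_def above_def)
      show ?thesis
      proof (cases "u = v")
        case True
        with st show ?thesis
          by (simp add: L_less L_same const_half)
      next
        case False
        with le have less: "key u < key v" by (simp add: order_le_less)
        then have "L v (mon (s # t)) \<in> supp_in (increasing (above u))"
          by (intro L_supp st) (simp add: above_def)
        with st less show ?thesis
          by (simp add: L_less L_greater B_sym)
      qed
    next
      case 2
      have lt: "L u ?T = mon [u] * ?T"
        using t 2 by (simp add: L_less)
      show ?thesis
      proof (cases "u = v")
        case True
        with 2 lt show ?thesis
          by (simp add: w L_same const_half)
      next
        case False
        with le have less: "key u < key v" by (simp add: order_le_less)
        with 2 show ?thesis
          by (simp add: w L_same L_greater lt[unfolded 2] B_sym[of v s])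
      qed
    next
      case 3
      with le have gr: "key s < key u" "key s < key v" by auto
      have "L u (L v (mon [s] * ?T)) + L v (L u (mon [s] * ?T))
          = mon [s] * (L u (L v ?T) + L v (L u ?T))"
        using gr by (simp add: L_greater algebra_simps)
      then show ?thesis
        using Cons.IH[OF t(2)] by (simp add: w mult_const_left)
    qed
  qed
  show ?case
    using wlog[of u v] wlog[of v u] B_sym[of u v] by (cases "key u \<le> key v") (simp_all add: add.commute)
qed

lemma L_anticommute:
  "x \<in> supp_in (increasing UNIV) \<Longrightarrow> L u (L v x) + L v (L u x) = const (B u v) * x"
  by (rule clin_eq[of _ _ "increasing UNIV"])
    (auto simp: L_anticommute_mon intro!: clin_intros intro: clin_comp[OF clin_L])

section \<open>The free algebra acting through straightening, and normal forms\<close>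

lemma clin_foldr_L: "clin (foldr L w)"
  by (induction w) (simp_all add: clin_def)

text \<open>A word acts letter by letter, so multiplicativity (\<open>act_mult\<close>) is built in.
  That the relations act by zero on increasing words is a separate fact,
  \<open>act_I\<close>.\<close>

definition act :: "free_elt \<Rightarrow> free_elt \<Rightarrow> free_elt" where
  "act x y = lin_ext (\<lambda>w. foldr L w y) x"

lemma clin_act_left: "clin (\<lambda>x. act x y)"
  by (simp add: act_def)

lemma clin_act [simp]: "clin (act x)"
proof (intro clinI)
  fix y z c
  show "act x (y + z) = act x y + act x z"
    by (simp add: act_def lin_ext_def clin_add[OF clin_foldr_L] distrib_left sum.distrib)
  have "const d * (const c * foldr L w y) = const c * (const d * foldr L w y)" for d w
    by (rule mult_const_left)
  then show "act x (const c * y) = const c * act x y"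
    by (simp add: act_def lin_ext_def clin_const[OF clin_foldr_L] sum_distrib_left)
qed

lemmas act_simps [simp] = clin_simps[OF clin_act] clin_simps[OF clin_act_left]

lemma act_mon_Cons [simp]: "act (mon (u # w)) y = L u (act (mon w) y)"
  and act_1 [simp]: "act 1 y = y"
  by (simp_all add: act_def flip: mon_Nil)

lemma act_mult: "act (x * y) z = act x (act y z)"
proof -
  have 1: "act (mon v * y) z = act (mon v) (act y z)" for v
  proof (rule clin_eq[where W = UNIV and x = y])
    show "clin (\<lambda>y. act (mon v * y) z)"
      by (rule clin_comp[OF clin_act_left clin_mult_left[OF clin_id]])
    show "clin (\<lambda>y. act (mon v) (act y z))"
      by (rule clin_comp[OF clin_act clin_act_left])
    show "act (mon v * mon w) z = act (mon v) (act (mon w) z)" for w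
      by (simp add: act_def mon_append[symmetric])
  qed simp
  show ?thesis
  proof (rule clin_eq[where W = UNIV and x = x])
    show "clin (\<lambda>x. act (x * y) z)"
      by (rule clin_comp[OF clin_act_left clin_mult_right[OF clin_id]])
  qed (simp_all add: 1 clin_act_left)
qed

lemma act_supp:
  assumes "x \<in> supp_in (lists P)" "y \<in> supp_in (increasing P)"
  shows "act x y \<in> supp_in (increasing P)"
proof (rule clin_into[OF clin_act_left _ assms(1)])
  fix w assume "w \<in> lists P"
  then show "act (mon w) y \<in> supp_in (increasing P)"
    by (induction w) (simp_all add: assms L_supp)
qed

text \<open>The empty word stands for 1, so acting on it rewrites x in increasing words.\<close>

definition nf :: "free_elt \<Rightarrow> free_elt" where
  "nf x = act x 1"

lemma clin_nf [simp]: "clin nf"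
  unfolding nf_def[abs_def] by (rule clin_act_left)

lemmas nf_simps [simp] = clin_simps[OF clin_nf]

lemma nf_supp: "x \<in> supp_in (lists P) \<Longrightarrow> nf x \<in> supp_in (increasing P)"
  by (simp add: nf_def act_supp)

lemma nf_mult: "nf (x * y) = act x (nf y)"
  by (simp add: nf_def act_mult)

text \<open>Each letter of an increasing word precedes the rest, so acting by it only prepends
  it.\<close>

lemma nf_mon_sw: "w \<in> increasing P \<Longrightarrow> nf (mon w) = mon w"
proof (induction w arbitrary: P)
  case (Cons u w)
  then have "w \<in> increasing (above u)"
    using sw_mono[of "P \<inter> above u" "above u"] by (auto simp: Cons_in_sw)
  then have "L u (mon w) = mon [u] * mon w" "nf (mon w) = mon w"
    using Cons.IH by (simp_all add: L_less)
  then show ?case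
    by (simp add: nf_def mon_Cons[of u w] act_mult)
qed (simp add: nf_def)

lemma nf_id: "x \<in> supp_in (increasing P) \<Longrightarrow> nf x = x"
  by (rule clin_eq[of _ _ "increasing P"]) (auto simp: nf_mon_sw)

section \<open>The ideal of relations as the kernel of normalization\<close>

lemma ring_free_alg: "ring (free_alg :: free_elt ring)"
proof -
  have "\<exists>y. x + y = 0" for x :: free_elt
    using add.right_inverse by blast
  then show ?thesis
    unfolding ring_of_type_algebra_def using add.right_inverse
    by unfold_locales (auto simp: algebra_simps Units_def)
qed

lemma free_alg_sel [simp]:
  "carrier (free_alg :: free_elt ring) = UNIV" "mult (free_alg :: free_elt ring) = (*)"
  "add (free_alg :: free_elt ring) = (+)" "\<one>\<^bsub>free_alg\<^esub> = (1 :: free_elt)" "\<zero>\<^bsub>free_alg\<^esub> = (0 :: free_elt)"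
  by (simp_all add: ring_of_type_algebra_def fun_eq_iff)

lemma ideal_free_algI:
  assumes "0 \<in> J" "\<And>x y. x \<in> J \<Longrightarrow> y \<in> J \<Longrightarrow> x - y \<in> J"
    "\<And>x y. y \<in> J \<Longrightarrow> x * y \<in> J" "\<And>x y. y \<in> J \<Longrightarrow> y * x \<in> J"
  shows "ideal J (free_alg :: free_elt ring)"
proof (rule idealI[OF ring_free_alg])
  interpret ring "free_alg :: free_elt ring" by (rule ring_free_alg)
  have inv: "\<ominus>\<^bsub>free_alg\<^esub> x = - x" for x :: free_elt
    using minus_equality[of "- x" x] by simp
  show "subgroup J (add_monoid (free_alg :: free_elt ring))"
  proof (rule add.subgroupI)
    show "J \<noteq> {}" using assms(1) by auto
    show "\<ominus>\<^bsub>free_alg\<^esub> a \<in> J" if "a \<in> J" for a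
      using assms(2)[OF assms(1) that] unfolding inv by simp
    show "a \<oplus>\<^bsub>free_alg\<^esub> b \<in> J" if "a \<in> J" "b \<in> J" for a b
      using assms(2)[OF that(1) assms(2)[OF assms(1) that(2)]] by simp
  qed auto
qed (use assms in auto)

lemma ideal_I: "ideal I free_alg"
  unfolding I_def by (rule ring.genideal_ideal[OF ring_free_alg]) simp

lemma I_rel: "mon [u] * mon [v] + mon [v] * mon [u] - const (B u v) \<in> I"
  unfolding I_def
  by (rule subsetD[OF ring.genideal_self[OF ring_free_alg]]) (simp, blast)

lemma I_add: "x \<in> I \<Longrightarrow> y \<in> I \<Longrightarrow> x + y \<in> I"
  using additive_subgroup.a_closed[OF ideal.axioms(1)[OF ideal_I]] by simp

lemma I_mult_left: "y \<in> I \<Longrightarrow> x * y \<in> I"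
  and I_mult_right: "y \<in> I \<Longrightarrow> y * x \<in> I"
  using ideal.I_l_closed[OF ideal_I] ideal.I_r_closed[OF ideal_I] by simp_all

lemma I_0 [simp]: "0 \<in> I"
  using additive_subgroup.zero_closed[OF ideal.axioms(1)[OF ideal_I]] by simp

lemma I_uminus: "x \<in> I \<Longrightarrow> - x \<in> I"
  using I_mult_left[of x "- 1"] by simp

lemma I_diff: "x \<in> I \<Longrightarrow> y \<in> I \<Longrightarrow> x - y \<in> I"
  using I_add[of x "- y"] I_uminus[of y] by simp

text \<open>The relation with two equal letters determines twice the square; halving it gives the
  form in which \<open>straighten\<close> uses it.\<close>

lemma I_sq: "mon [u] * mon [u] - const (B u u / 2) \<in> I"
proof -
  have "const (1 / 2) * (mon [u] * mon [u] + mon [u] * mon [u] - const (B u u)) \<in> I"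
    by (intro I_mult_left I_rel)
  also have "const (1 / 2) * (mon [u] * mon [u] + mon [u] * mon [u] - const (B u u))
      = mon [u] * mon [u] - const (B u u / 2)"
    using const_half[of 1 "mon [u] * mon [u]"]
    by (simp add: algebra_simps flip: const_mult)
  finally show ?thesis .
qed

text \<open>The elements annihilating the span of the increasing words form a two-sided ideal,
  because this span is stable under the action. By \<open>L_anticommute\<close> the generating
  relations belong to it.\<close>

lemma act_I: "x \<in> I \<Longrightarrow> y \<in> supp_in (increasing UNIV) \<Longrightarrow> act x y = 0"
proof -
  define J where "J = {x. \<forall>y\<in>supp_in (increasing UNIV). act x y = 0}"
  have "ideal J (free_alg :: free_elt ring)"
    by (rule ideal_free_algI) (auto simp: J_def act_mult intro!: act_supp[of _ UNIV, simplified lists_UNIV supp_in_UNIV])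
  moreover have "{mon [u] * mon [v] + mon [v] * mon [u] - const (B u v) | u v. True} \<subseteq> J"
  proof -
    have "act (const c) y = const c * y" for c y
      using clin_const[OF clin_act_left, of c 1 y] by simp
    then show ?thesis
      by (auto simp: J_def act_mult L_anticommute)
  qed
  ultimately have "I \<subseteq> J"
    unfolding I_def by (rule ring.genideal_minimal[OF ring_free_alg])
  then show "x \<in> I \<Longrightarrow> y \<in> supp_in (increasing UNIV) \<Longrightarrow> act x y = 0"
    by (auto simp: J_def)
qed

text \<open>Each rewriting step of \<open>straighten\<close> is an instance of a relation or of
  \<open>I_sq\<close>, so straightening does not change the class.\<close>

lemma L_cong_I: "mon [u] * x - L u x \<in> I"
proof -
  have *: "mon [u] * mon w - straighten u w \<in> I" for w
  proof (induction w)
    case Nil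
    show ?case by simp
  next
    case (Cons s t)
    have w: "mon (s # t) = mon [s] * mon t" by (rule mon_Cons)
    \<comment> \<open>The relation for u and s, multiplied by the tail, moves u past s; behind s the
      induction hypothesis takes over.\<close>
    have 1: "(mon [u] * mon [s] + mon [s] * mon [u] - const (B u s)) * mon t
        - mon [s] * (mon [u] * mon t - straighten u t) \<in> I"
      by (intro I_diff I_mult_left I_mult_right Cons I_rel)
    have 2: "(mon [u] * mon [u] - const (B u u / 2)) * mon t \<in> I"
      by (intro I_mult_right I_sq)
    show ?case
      using 1 2 by (auto simp: w algebra_simps mon_Cons[of u "s # t"])
  qed
  have "x \<in> supp_in UNIV" by simp
  then show ?thesis
  proof (induction x rule: supp_in_induct)
    case (add x y)
    then show ?case
      using I_add[of "mon [u] * x - L u x" "mon [u] * y - L u y"] by (simp add: algebra_simps)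
  next
    case (mon c w)
    then show ?case
      using I_mult_left[OF *[of w], of "const c"] 
      by (simp add: L_mon algebra_simps mult_const_left)
  qed simp
qed

lemma diff_nf_in_I: "x - nf x \<in> I"
proof -
  have *: "mon w - nf (mon w) \<in> I" for w
  proof (induction w)
    case (Cons u w)
    have "mon [u] * (mon w - nf (mon w)) + (mon [u] * nf (mon w) - L u (nf (mon w))) \<in> I"
      by (intro I_add I_mult_left Cons L_cong_I)
    then show ?case
      by (simp add: nf_def mon_Cons[of u w, symmetric] algebra_simps)
  qed (simp add: nf_def)
  have "x \<in> supp_in UNIV" by simp
  then show ?thesis
  proof (induction x rule: supp_in_induct)
    case (add x y)
    then show ?case
      using I_add[of "x - nf x" "y - nf y"] by (simp add: algebra_simps)
  next
    case (mon c w)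
    then show ?case
      using I_mult_left[OF *[of w], of "const c"] by (simp add: algebra_simps)
  qed simp
qed

text \<open>The Poincare-Birkhoff-Witt statement. An element of the ideal acts by zero on the empty
  word; conversely x differs from \<open>nf x\<close> by an element of the ideal. So the increasing
  words represent a basis of the quotient.\<close>

lemma in_I_iff: "x \<in> I \<longleftrightarrow> nf x = 0"
  using act_I[of x 1] diff_nf_in_I[of x] by (auto simp: nf_def)

lemma nf_eq_iff: "nf x = nf y \<longleftrightarrow> x - y \<in> I"
  by (simp add: in_I_iff)

lemma nf_mult_cong: "nf x = nf x' \<Longrightarrow> nf y = nf y' \<Longrightarrow> nf (x * y) = nf (x' * y')"
proof -
  assume "nf x = nf x'" "nf y = nf y'"
  then have "(x - x') * y + x' * (y - y') \<in> I"
    by (intro I_add I_mult_left I_mult_right) (simp_all add: nf_eq_iff)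
  then show ?thesis
    by (simp add: nf_eq_iff algebra_simps)
qed

lemma nf_nf [simp]: "nf (nf x) = nf x"
  using nf_id[OF nf_supp[of x UNIV]] by simp

end

text \<open>A concatenation uses only letters of P if and only if both factors do. The cut is thus
  the algebra endomorphism that sends all other letters to 0.\<close>

lemma mult_cut_lists:
  "restrict_words (\<lambda>w. set w \<subseteq> P) (x * y) = restrict_words (\<lambda>w. set w \<subseteq> P) x * restrict_words (\<lambda>w. set w \<subseteq> P) y"
proof -
  let ?c = "restrict_words (\<lambda>w. set w \<subseteq> P)"
  have 1: "?c (mon v * y) = ?c (mon v) * ?c y" for v
  proof (rule clin_eq[where W = UNIV and x = y])
    show "clin (\<lambda>y. ?c (mon v * y))"
      by (rule clin_comp[OF clin_cut clin_mult_left[OF clin_id]])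
    show "clin (\<lambda>y. ?c (mon v) * ?c y)"
      by (rule clin_mult_left[OF clin_cut])
  qed (auto simp flip: mon_append)
  show ?thesis
  proof (rule clin_eq[where W = UNIV and x = x])
    show "clin (\<lambda>x. ?c (x * y))"
      by (rule clin_comp[OF clin_cut clin_mult_right[OF clin_id]])
    show "clin (\<lambda>x. ?c x * ?c y)"
      by (rule clin_mult_right[OF clin_cut])
  qed (auto simp: 1)
qed

section \<open>Splitting off the least or the greatest letter\<close>

lemma sw_Un_Cons:
  assumes "w \<in> increasing P" "\<And>v. v \<in> P \<Longrightarrow> v = s \<or> key s < key v"
  shows "w \<in> increasing (P \<inter> above s) \<or> (\<exists>t\<in>increasing (P \<inter> above s). w = s # t)"
proof (cases w)
  case (Cons v t)
  then show ?thesis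
    using assms by (fastforce simp: increasing_def above_def)
qed simp

lemma sw_Un_snoc:
  assumes "w \<in> increasing P" "\<And>v. v \<in> P \<Longrightarrow> v = s \<or> key v < key s"
  shows "w \<in> increasing (P - {s}) \<or> (\<exists>t\<in>increasing (P - {s}). w = t @ [s])"
proof (cases w rule: rev_cases)
  case (snoc t v)
  then have w: "sorted_wrt (\<lambda>s t. key s < key t) w" "sorted_wrt (\<lambda>s t. key s < key t) t"
    "set t \<subseteq> P" "v \<in> P" "\<And>x. x \<in> set t \<Longrightarrow> key x < key v"
    using assms(1) by (simp_all add: increasing_def sorted_wrt_append)
  show ?thesis
  proof (cases "v = s")
    case True
    then have "s \<notin> set t" using w(5)[of s] by auto
    then have "t \<in> increasing (P - {s})" using w by (auto simp: increasing_def)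
    then show ?thesis using snoc True by blast
  next
    case False
    then have "key v < key s" using assms(2) w by blast
    then have "s \<notin> set w" using w(5)[of s] snoc by auto
    then have "w \<in> increasing (P - {s})" using assms(1) by (auto simp: increasing_def)
    then show ?thesis by blast
  qed
qed simp

text \<open>The letter s can occur only once and only in front, so words either avoid it or start
  with it.\<close>

lemma supp_sw_Cons:
  assumes "f \<in> supp_in (increasing P)" "\<And>v. v \<in> P \<Longrightarrow> v = s \<or> key s < key v"
  obtains f0 f1 where "f0 \<in> supp_in (increasing (P \<inter> above s))" "f1 \<in> supp_in (increasing (P \<inter> above s))"
    "f = f0 + mon [s] * f1"
proof -
  have "\<exists>f0\<in>supp_in (increasing (P \<inter> above s)). \<exists>f1\<in>supp_in (increasing (P \<inter> above s)). f = f0 + mon [s] * f1"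
    using assms(1)
  proof (induction f rule: supp_in_induct)
    case zero
    show ?case by (intro bexI[of _ 0]) auto
  next
    case (add x y)
    then obtain x0 x1 y0 y1 where
      "x0 \<in> supp_in (increasing (P \<inter> above s))" "x1 \<in> supp_in (increasing (P \<inter> above s))" "x = x0 + mon [s] * x1"
      "y0 \<in> supp_in (increasing (P \<inter> above s))" "y1 \<in> supp_in (increasing (P \<inter> above s))" "y = y0 + mon [s] * y1"
      by blast
    then show ?case
      by (intro bexI[of _ "x0 + y0"] bexI[of _ "x1 + y1"]) (auto simp: algebra_simps supp_in_closed)
  next
    case (mon c w)
    have "w \<in> increasing (P \<inter> above s) \<or> (\<exists>t\<in>increasing (P \<inter> above s). w = s # t)"
      by (rule sw_Un_Cons[OF mon]) (rule assms(2))
    then show ?case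
    proof (elim disjE bexE)
      assume "w \<in> increasing (P \<inter> above s)"
      then show ?thesis
        by (intro bexI[of _ "const c * mon w"] bexI[of _ 0]) (auto simp: supp_in_closed)
    next
      fix t assume "t \<in> increasing (P \<inter> above s)" "w = s # t"
      then show ?thesis
        by (intro bexI[of _ 0] bexI[of _ "const c * mon t"])
          (auto simp: supp_in_closed mult_const_left[of "mon [s]"] mon_Cons[of s t])
    qed
  qed
  with that show thesis by blast
qed

text \<open>The mirror image at the end of words. It serves \<open>simple_algebra_01\<close>, where
  the modes of index 1 are multiplied in from the right.\<close>

lemma supp_sw_snoc:
  assumes "f \<in> supp_in (increasing P)" "\<And>v. v \<in> P \<Longrightarrow> v = s \<or> key v < key s"
  obtains f0 f1 where "f0 \<in> supp_in (increasing (P - {s}))" "f1 \<in> supp_in (increasing (P - {s}))"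
    "f = f0 + f1 * mon [s]"
proof -
  have "\<exists>f0\<in>supp_in (increasing (P - {s})). \<exists>f1\<in>supp_in (increasing (P - {s})). f = f0 + f1 * mon [s]"
    using assms(1)
  proof (induction f rule: supp_in_induct)
    case zero
    show ?case by (intro bexI[of _ 0]) auto
  next
    case (add x y)
    then obtain x0 x1 y0 y1 where
      "x0 \<in> supp_in (increasing (P - {s}))" "x1 \<in> supp_in (increasing (P - {s}))" "x = x0 + x1 * mon [s]"
      "y0 \<in> supp_in (increasing (P - {s}))" "y1 \<in> supp_in (increasing (P - {s}))" "y = y0 + y1 * mon [s]"
      by blast
    then show ?case
      by (intro bexI[of _ "x0 + y0"] bexI[of _ "x1 + y1"]) (auto simp: algebra_simps supp_in_closed)
  next
    case (mon c w)
    have "w \<in> increasing (P - {s}) \<or> (\<exists>t\<in>increasing (P - {s}). w = t @ [s])"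
      by (rule sw_Un_snoc[OF mon]) (rule assms(2))
    then show ?case
    proof (elim disjE bexE)
      assume "w \<in> increasing (P - {s})"
      then show ?thesis
        by (intro bexI[of _ "const c * mon w"] bexI[of _ 0]) (auto simp: supp_in_closed)
    next
      fix t assume "t \<in> increasing (P - {s})" "w = t @ [s]"
      then show ?thesis
        by (intro bexI[of _ 0] bexI[of _ "const c * mon t"])
          (auto simp: supp_in_closed mult.assoc mon_append)
    qed
  qed
  with that show thesis by blast
qed

lemma Cons_supp_in:
  assumes "x \<in> supp_in W" "\<And>w. w \<in> W \<Longrightarrow> s # w \<in> W'"
  shows "mon [s] * x \<in> supp_in W'"
  by (rule clin_into[OF clin_mult_left[OF clin_id] _ assms(1)]) (simp add: assms(2) flip: mon_Cons)

section \<open>The Fock space\<close>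

definition idx :: "int set \<Rightarrow> letter set" where
  "idx N = {u. snd u \<in> N}"

lemma in_idx [simp]: "u \<in> idx N \<longleftrightarrow> snd u \<in> N"
  by (simp add: idx_def)

lemma idx_01: "idx {0..} \<inter> idx {..1} = idx {0, 1}"
  by auto

definition bform :: "conn \<Rightarrow> letter \<Rightarrow> letter \<Rightarrow> complex" where
  "bform A u v = of_int (snd u) * symp (fst u) (fst v) * (if snd u + snd v = 0 then 1 else 0)
     + C_mat A (snd u + snd v) $ fst u $ fst v"

lemma UNIV_pm: "(UNIV :: pm set) = {Pls, Mns}"
  using pm.exhaust by auto

lemma C_mat_nth: "C_mat A k $ a $ b = (if a = Pls then - A k $ Mns $ b else A k $ Pls $ b)"
  by (cases a) (simp_all add: C_mat_def J_mat_def matrix_matrix_mult_def UNIV_pm)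

lemma opp_opp [simp]: "opp (opp a) = a"
  by (cases a) auto

lemma opp_neq [simp]: "opp a \<noteq> a" "a \<noteq> opp a"
  by (cases a; simp)+

locale sl2_conn =
  fixes A :: conn and \<xi> :: complex
  assumes sl2: "\<And>k. trace (A k) = 0"
    and A_gt: "\<And>k. k > 1 \<Longrightarrow> A k = 0"
    and A_1: "A 1 = diag_pm \<xi> (- \<xi>)"
    and xi: "\<xi> \<noteq> 0"
begin

text \<open>Exchanging the letters when m + n = 0 changes the sign of m and of the symplectic form,
  so the first term is symmetric. The matrices \<open>C_mat A k\<close> are symmetric because A k is
  traceless.\<close>

sublocale clifford "bform A"
proof
  fix u v :: letter
  have tr: "A k $ Pls $ Pls = - (A k $ Mns $ Mns)" for k
    using sl2[of k] by (simp add: trace_def UNIV_pm add_eq_0_iff2)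
  have C: "C_mat A k $ a $ b = C_mat A k $ b $ a" for k a b
    by (cases a; cases b) (simp_all add: C_mat_nth tr)
  have s: "symp a b = - symp b a" for a b
    by (cases a; cases b) simp_all
  show "bform A u v = bform A v u"
    using C[of _ "fst u" "fst v"] s[of "fst u" "fst v"]
    by (auto simp: bform_def add.commute add_eq_0_iff2)
qed

text \<open>Both terms vanish: the total mode is not 0, and A k = 0 for k > 1. In particular
  positive modes anticommute with each other.\<close>

lemma bform_ge_2: "2 \<le> snd u + snd v \<Longrightarrow> bform A u v = 0"
  by (simp add: bform_def C_mat_nth A_gt)

lemma bform_1: "snd u + snd v = 1 \<Longrightarrow> bform A u v = (if fst v = opp (fst u) then \<xi> else 0)"
  by (cases "fst u"; cases "fst v") (simp_all add: bform_def C_mat_nth A_1 diag_pm_def)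

lemma SF_ideal_eq: "SF_ideal A = I"
proof -
  have "SF_rel A = {mon [u] * mon [v] + mon [v] * mon [u] - const (bform A u v) | u v. True}"
    by (auto simp: SF_rel_def bform_def gen_eq_mon) 
  then show ?thesis by (simp add: SF_ideal_def I_def)
qed

section \<open>Stability of the words with a letter of mode above c\<close>

definition below :: "int \<Rightarrow> letter list \<Rightarrow> bool" where
  "below c w \<longleftrightarrow> set w \<subseteq> idx {..c}"

lemma below_simps [simp]:
  "below c []" "below c (u # w) \<longleftrightarrow> snd u \<le> c \<and> below c w"
  by (auto simp: below_def)

text \<open>The letter s can disappear only by contraction with u, and only if u does not precede s.
  If s is the only letter of mode above c, the mode of u is at least that of s, hence both are at
  least 1 and the contraction vanishes.\<close>

lemma not_below_Cons:
  assumes "0 \<le> c" "\<not> below c (s # t)" and IH: "\<not> below c t \<Longrightarrow> straighten u t \<in> supp_in {w. \<not> below c w}"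
  shows "straighten u (s # t) \<in> supp_in {w. \<not> below c w}"
proof -
  have s: "c < snd s" if "below c t" using assms that by auto
  consider "key u < key s" | "u = s" | "key s < key u"
    by (metis key_eq_iff linorder_neqE)
  then show ?thesis
  proof cases
    case 1
    then show ?thesis using assms(2) by simp
  next
    case 2
    then show ?thesis
      using s assms(1) bform_ge_2[of s s] by (cases "below c t") (auto intro!: supp_in_closed)
  next
    case 3
    show ?thesis
    proof (cases "below c t")
      case True
      have "bform A u s = 0"
        using bform_ge_2[of u s] key_less_imp[OF 3] s[OF True] assms(1) by simp
      moreover have "mon [s] * straighten u t \<in> supp_in {w. \<not> below c w}"
        using s[OF True] by (intro Cons_supp_in[of _ UNIV]) auto
      ultimately show ?thesis using 3 by (auto intro!: supp_in_closed)
    next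
      case False
      then have "mon [s] * straighten u t \<in> supp_in {w. \<not> below c w}"
        by (intro Cons_supp_in[OF IH]) auto
      with 3 False show ?thesis by (auto intro!: supp_in_closed)
    qed
  qed
qed

lemma ins_not_below:
  assumes "0 \<le> c" shows "\<not> below c w \<Longrightarrow> straighten u w \<in> supp_in {w. \<not> below c w}"
  by (induction w) (simp, rule not_below_Cons[OF assms])

lemma L_not_below:
  "0 \<le> c \<Longrightarrow> x \<in> supp_in {w. \<not> below c w} \<Longrightarrow> L u x \<in> supp_in {w. \<not> below c w}"
  by (rule clin_into[OF clin_L]) (auto simp: L_mon ins_not_below)

text \<open>The discarded words are stable under \<open>L u\<close>, so the cut describes a quotient
  on which \<open>L u\<close> acts. It is used with c = 0 for the Fock space and with c = 1 for
  \<open>theta\<close>.\<close>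

lemma cut_L:
  assumes "0 \<le> c" shows "restrict_words (below c) (L u (restrict_words (below c) x)) = restrict_words (below c) (L u x)"
proof -
  have "x - restrict_words (below c) x \<in> supp_in {w. \<not> below c w}"
    using cut_diff_in[of x UNIV "below c"] by simp
  from cut_zero[OF L_not_below[OF assms this]] show ?thesis
    by simp
qed

text \<open>The image of x in the Fock space, given by its representative in increasing words of
  nonpositive letters.\<close>

definition phi :: "free_elt \<Rightarrow> free_elt" where
  "phi x = restrict_words (below 0) (nf x)"

lemma clin_phi [simp]: "clin phi"
  unfolding phi_def[abs_def] by (rule clin_comp) simp_all

lemmas phi_simps [simp] = clin_simps[OF clin_phi]

lemma phi_nf_cong: "nf x = nf y \<Longrightarrow> phi x = phi y"
  by (simp add: phi_def)

lemma phi_supp: "x \<in> supp_in (lists P) \<Longrightarrow> phi x \<in> supp_in (increasing (P \<inter> idx {..0}))"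
  using cut_in[OF nf_supp, of x P "below 0"] supp_in_mono[of "{w \<in> increasing P. below 0 w}" "increasing (P \<inter> idx {..0})"]
  by (force simp: phi_def below_def increasing_def)

lemma phi_id:
  assumes "x \<in> supp_in (increasing (idx {..0}))" shows "phi x = x"
proof -
  have "x \<in> supp_in {w. below 0 w}"
    using assms supp_in_mono[of "increasing (idx {..0})" "{w. below 0 w}"] by (auto simp: below_def increasing_def)
  then show ?thesis
    by (simp add: phi_def nf_id[OF assms] cut_id)
qed

lemma nf_phi [simp]: "nf (phi x) = phi x"
  using nf_id phi_supp[of x UNIV] by simp

lemma phi_1 [simp]: "phi 1 = 1"
  by (rule phi_id) simp

lemma cut_act: "restrict_words (below 0) (act x (restrict_words (below 0) y)) = restrict_words (below 0) (act x y)"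
proof (rule clin_eq[where W = UNIV and x = x])
  show "clin (\<lambda>x. restrict_words (below 0) (act x (restrict_words (below 0) y)))" "clin (\<lambda>x. restrict_words (below 0) (act x y))"
    by (rule clin_comp[OF clin_cut clin_act_left])+
  fix w
  show "restrict_words (below 0) (act (mon w) (restrict_words (below 0) y)) = restrict_words (below 0) (act (mon w) y)"
  proof (induction w)
    case Nil
    show ?case by (simp add: cut_id[OF cut_in[of y UNIV, simplified]])
  next
    case (Cons u w)
    then show ?case
      by (metis act_mon_Cons cut_L order_refl)
  qed
qed simp

text \<open>What \<open>phi\<close> drops from y is carried by x into words that are dropped as
  well. This is the associativity of the action on the Fock space.\<close>

lemma phi_mult: "phi (x * phi y) = phi (x * y)"
  by (simp add: phi_def nf_mult cut_act nf_phi[unfolded phi_def])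

lemma phi_mult_annihilator:
  assumes "0 < snd u" shows "phi (x * mon [u]) = 0"
proof -
  have "nf (mon [u]) = mon [u]"
    by (rule nf_mon_sw[of _ UNIV]) (simp add: Cons_in_sw)
  then have "phi (mon [u]) = 0"
    using assms by (simp add: phi_def)
  then show ?thesis
    using phi_mult[of x "mon [u]"] by simp
qed

text \<open>Letters are sorted by mode, so a positive letter anywhere forces the last letter to be
  positive: such a word lies in the left ideal generated by the positive modes.\<close>

lemma not_below_snoc:
  assumes "w \<in> increasing P" "\<not> below 0 w"
  obtains v u where "w = v @ [u]" "v \<in> lists P" "u \<in> P" "0 < snd u"
proof (cases w rule: rev_cases)
  case Nil
  then show ?thesis using assms by simp
next
  case (snoc v u)
  have "\<exists>s\<in>set w. s \<notin> idx {..0}"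
    using assms(2) unfolding below_def by blast
  then obtain s where s: "s \<in> set w" "0 < snd s"
    by auto
  then have "s = u \<or> key s < key u"
    using assms(1) snoc by (auto simp: increasing_def sorted_wrt_append)
  then have "0 < snd u"
    using s key_less_imp[of s u] by auto
  with that snoc assms(1) show ?thesis by (auto simp: increasing_def)
qed

lemma nf_minus_phi_supp:
  assumes "x \<in> supp_in (lists P)" shows "nf x - phi x \<in> supp_in {w \<in> increasing P. \<not> below 0 w}"
  unfolding phi_def by (rule cut_diff_in[OF nf_supp[OF assms]])

text \<open>No contraction with a letter of P can remove d, so every resulting word still contains
  d.\<close>

lemma L_annihilator_supp:
  assumes "c < snd d" "\<And>v. v \<in> P \<Longrightarrow> bform A d v = 0" "f \<in> supp_in (lists P)"
  shows "L d f \<in> supp_in {w. \<not> below c w}"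
proof (rule clin_into[OF clin_L _ assms(3)])
  fix w assume "w \<in> lists P"
  then show "L d (mon w) \<in> supp_in {w. \<not> below c w}"
    unfolding L_mon
  proof (induction w)
    case (Cons s t)
    then have "straighten d t \<in> supp_in {w. \<not> below c w}" by simp
    then have "mon [s] * straighten d t \<in> supp_in {w. \<not> below c w}"
      by (rule Cons_supp_in) auto
    moreover have "bform A d s = 0"
      by (rule assms(2)) (use Cons in simp)
    ultimately show ?case
      using assms(1) by (cases "d = s") (simp_all add: supp_in_closed)
  qed (use assms(1) in simp)
qed

text \<open>Induction on the lowest key that may occur. With the lowest letter split off, f = f0 + s
  f1, the partner of s sends f to \<xi> f1 if f1 is nonzero; otherwise s does not occur. The bound
  on the modes of x lets the same lemma serve the subalgebra of the modes 0 and 1, with N =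
  0.\<close>

lemma phi_to_vacuum:
  assumes "f \<in> supp_in (increasing (idx {- N..0}))" "f \<noteq> 0"
  obtains x where "x \<in> supp_in (lists (idx {1..N + 1}))" "phi (x * f) = 1"
proof -
  \<comment> \<open>The largest key of a nonpositive mode is 1, so \<open>Q 2\<close> is empty, and
    j counts the keys from 2 - j to 1.\<close>
  define Q where "Q k = {u. k \<le> key u \<and> snd u \<le> 0 \<and> - N \<le> snd u}" for k
  have Q0: "supp_in (increasing (Q k)) \<subseteq> supp_in (increasing (idx {..0}))" for k
    by (intro supp_in_mono sw_mono) (auto simp: Q_def)
  have "\<exists>x\<in>supp_in (lists (idx {1..N + 1})). phi (x * f) = 1"
    if "f \<in> supp_in (increasing (Q (2 - int j)))" "f \<noteq> 0" for j f
    using that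
  proof (induction j arbitrary: f)
    case 0
    have "Q 2 = {}" by (auto simp: Q_def key_def split: if_splits)
    then have "increasing (Q 2) = {[]}" by (auto simp: increasing_def)
    with 0 have "f \<in> supp_in {[]}" by simp
    then have "\<exists>c. f = const c"
    proof (induction f rule: supp_in_induct)
      case zero
      show ?case by (rule exI[of _ 0]) simp
    next
      case (add x y)
      then show ?case by (metis const_add)
    qed auto
    then obtain c where f: "f = const c" by blast
    with 0 have "c \<noteq> 0" by auto
    then have "const (1 / c) * f = 1"
      using f by (simp flip: const_mult)
    then show ?case
      by (intro bexI[of _ "const (1 / c)"]) auto
  next
    case (Suc j)
    define k where "k = 2 - int (Suc j)"
    \<comment> \<open>The unique letter with key k. Its mode may lie below - N, in which case
      \<open>Q k\<close> contains nothing new.\<close>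
    define s :: letter where "s = (if even k then Pls else Mns, k div 2)"
    have s: "key s = k" by (auto simp: s_def key_def)
    have le: "v = s \<or> key s < key v" if "v \<in> Q k" for v
      using that s key_eq_iff[of v s] by (auto simp: Q_def simp del: key_eq_iff)
    have Q: "Q k \<inter> above s = Q (2 - int j)"
      by (auto simp: Q_def above_def s k_def)
    obtain f0 f1 where f: "f0 \<in> supp_in (increasing (Q (2 - int j)))" "f1 \<in> supp_in (increasing (Q (2 - int j)))"
      "f = f0 + mon [s] * f1"
      using supp_sw_Cons[OF Suc.prems(1)[folded k_def] le, unfolded Q] by metis
    show ?case
    proof (cases "s \<in> Q k \<and> f1 \<noteq> 0")
      case False
      have "f \<in> supp_in (increasing (Q (2 - int j)))"
      proof (cases "s \<in> Q k")
        case True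
        with False f show ?thesis by simp
      next
        case False
        then have "Q k = Q (2 - int j)"
          using le Q by (auto simp: above_def)
        then show ?thesis using Suc.prems by (simp add: k_def)
      qed
      then show ?thesis
        by (rule Suc.IH[OF _ Suc.prems(2)])
    next
      case True
      \<comment> \<open>At total mode 1 the form pairs opposite signs, with value \<xi>; this
        determines the partner of s.\<close>
      define d :: letter where "d = (opp (fst s), 1 - snd s)"
      have sn: "snd s \<le> 0" "- N \<le> snd s" using True by (auto simp: Q_def)
      then have d: "0 < snd d" "d \<in> idx {1..N + 1}" by (auto simp: d_def)
      have "key s < key d" using sn by (auto simp: key_def d_def)
      then have ds: "L d (mon [s] * f1) = const \<xi> * f1 - mon [s] * L d f1"
        using bform_1[of d s] by (simp add: L_greater d_def)
      \<comment> \<open>A later letter has either the mode of s and the other sign, which d does not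
        pair with, or a larger mode, so that the total is at least 2.\<close>
      have B0: "bform A d v = 0" if "v \<in> Q (2 - int j)" for v
      proof -
        have v: "key s < key v" using that s by (simp add: Q_def k_def)
        show ?thesis
        proof (cases "snd s = snd v")
          case True
          then have "fst v \<noteq> fst s" using v by (auto simp: key_def split: if_splits)
          then show ?thesis
            using True by (simp add: bform_1 d_def)
        next
          case False
          then show ?thesis
            using key_less_imp[OF v] by (intro bform_ge_2) (simp add: d_def)
        qed
      qed
      have z: "L d f0 \<in> supp_in {w. \<not> below 0 w}" "L d f1 \<in> supp_in {w. \<not> below 0 w}"
        using L_annihilator_supp[OF d(1) B0] f(1,2) supp_in_mono[OF sw_lists] by blast+
      then have "mon [s] * L d f1 \<in> supp_in {w. \<not> below 0 w}"
        by (intro Cons_supp_in[OF z(2)]) auto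
      then have "restrict_words (below 0) (L d f) = const \<xi> * restrict_words (below 0) f1"
        using z by (simp add: f(3) ds cut_zero)
      moreover have "f1 \<in> supp_in (increasing (idx {..0}))" "f \<in> supp_in (increasing (idx {..0}))"
        using f(2) Suc.prems(1) Q0 by blast+
      then have "restrict_words (below 0) f1 = f1" "nf f = f"
        using phi_id[of f1] by (simp_all add: phi_def nf_id)
      ultimately have phi_d: "phi (mon [d] * f) = const \<xi> * f1"
        by (simp add: phi_def nf_mult)
      obtain x where x: "x \<in> supp_in (lists (idx {1..N + 1}))" "phi (x * f1) = 1"
        using Suc.IH[OF f(2)] True by blast
      have "phi (const (1 / \<xi>) * x * mon [d] * f) = phi (const (1 / \<xi>) * x * phi (mon [d] * f))"
        using phi_mult[of "const (1 / \<xi>) * x" "mon [d] * f"] by (simp only: mult.assoc)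
      also have "\<dots> = const (1 / \<xi>) * (const \<xi> * phi (x * f1))"
        by (simp add: phi_d mult.assoc mult_const_left[of x])
      also have "\<dots> = 1"
        using x xi by (simp flip: const_mult)
      finally show ?thesis
        using x d(2) by (intro bexI[of _ "const (1 / \<xi>) * x * mon [d]"])
          (auto intro!: mult_supp_lists supp_in_const_times)
    qed
  qed
  \<comment> \<open>The lowest key at mode - N is - 2 N = 2 - (2 N + 2).\<close>
  moreover have "idx {- N..0} \<subseteq> Q (2 - int (nat (2 * N + 2)))"
    by (auto simp: Q_def key_def)
  ultimately show thesis
    using assms that supp_in_mono[OF sw_mono] by blast
qed

text \<open>On nonnegative modes \<open>theta\<close> preserves the relations, because no bracket of a mode above 1
  with a nonnegative mode survives. It is the projection through which representations of the
  modes 0 and 1 are extended.\<close>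

definition theta :: "free_elt \<Rightarrow> free_elt" where
  "theta = restrict_words (below 1)"

lemma clin_theta [simp]: "clin theta"
  by (simp add: theta_def)

lemmas theta_simps [simp] = clin_simps[OF clin_theta]

lemma theta_mult: "theta (x * y) = theta x * theta y"
  unfolding theta_def below_def[abs_def] by (rule mult_cut_lists)

lemma theta_mon: "theta (mon w) = (if below 1 w then mon w else 0)"
  by (simp add: theta_def)

lemma theta_1 [simp]: "theta 1 = 1"
  using theta_mon[of "[]"] by simp

lemma theta_id: "x \<in> supp_in (lists (idx {..1})) \<Longrightarrow> theta x = x"
  unfolding theta_def by (rule cut_id) (auto simp: supp_in_def below_def)

lemma theta_supp:
  "x \<in> supp_in (lists (idx {0..})) \<Longrightarrow> theta x \<in> supp_in (lists (idx {0, 1}))"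
  unfolding theta_def
  by (rule subsetD[OF supp_in_mono cut_in])
    (auto simp: below_def lists_eq_set idx_01[symmetric])

text \<open>Induction on the word. A letter of mode at most 1 preserves the span of the modes 0 and
  1, and \<open>cut_L\<close> with c = 1 applies. A letter of mode above 1 contracts with no
  nonnegative mode, so both sides vanish.\<close>

lemma nf_theta:
  assumes "x \<in> supp_in (lists (idx {0..}))" shows "nf (theta x) = theta (nf x)"
proof (rule clin_eq[OF _ _ _ assms])
  fix w assume "w \<in> lists (idx {0..})"
  then show "nf (theta (mon w)) = theta (nf (mon w))"
  proof (induction w)
    case Nil
    show ?case by (simp add: nf_def)
  next
    case (Cons u w)
    let ?y = "nf (mon w)"
    have y: "?y \<in> supp_in (increasing (idx {0..}))"
      using Cons by (intro nf_supp) simp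
    show ?case
    proof (cases "snd u \<le> 1")
      case True
      have "theta ?y \<in> supp_in (increasing (idx {0..}) \<inter> {w. below 1 w})"
        unfolding theta_def using cut_in[OF y, of "below 1"] by (simp add: Int_def)
      moreover have "increasing (idx {0..}) \<inter> {w. below 1 w} \<subseteq> increasing (idx {0, 1})"
        by (auto simp: increasing_def below_def idx_01[symmetric])
      ultimately have "theta ?y \<in> supp_in (increasing (idx {0, 1}))"
        using supp_in_mono by blast
      then have "L u (theta ?y) \<in> supp_in (increasing (idx {0, 1}))"
        using True Cons by (intro L_supp) auto
      then have "L u (theta ?y) \<in> supp_in (lists (idx {..1}))"
        by (rule subsetD[OF supp_in_mono[OF order_trans[OF sw_lists lists_mono]], rotated]) auto
      then have "L u (theta ?y) = theta (L u (theta ?y))"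
        by (simp add: theta_id)
      also have "\<dots> = theta (L u ?y)"
        by (simp add: theta_def cut_L)
      finally show ?thesis
        using True Cons
        by (simp add: mon_Cons[of u w] theta_mult nf_mult theta_mon[of "[u]"])
    next
      case False
      have "L u ?y \<in> supp_in {w. \<not> below 1 w}"
        using False y supp_in_mono[OF sw_lists]
        by (intro L_annihilator_supp[of _ _ "idx {0..}"] bform_ge_2) auto
      then have "theta (L u ?y) = 0"
        by (simp add: theta_def cut_zero)
      then show ?thesis
        using False by (simp add: mon_Cons[of u w] theta_mult nf_mult theta_mon[of "[u]"])
    qed
  qed
qed (auto intro: clin_comp)

lemma nf_sq_annihilator: "0 < snd u \<Longrightarrow> nf (mon [u] * mon [u]) = 0"
  using I_sq[of u] bform_ge_2[of u u] by (simp add: in_I_iff)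

lemma nf_anticommute: "nf (mon [u] * mon [v] + mon [v] * mon [u]) = nf (const (bform A u v))"
  using I_rel[of u v] by (simp only: nf_eq_iff)

end

section \<open>The tensor product as a module\<close>

locale tensor_product = R?: ring R + V?: abelian_group V
  for R :: "('a, 'c) ring_scheme" (structure) and V :: "('a, 'v) module" +
  fixes S :: "'a set"
  assumes S_subset: "S \<subseteq> carrier R"
    and smult_V_closed: "\<lbrakk>s \<in> S; v \<in> carrier V\<rbrakk> \<Longrightarrow> s \<odot>\<^bsub>V\<^esub> v \<in> carrier V"
begin

abbreviation G where "G \<equiv> tensor_free R V"
abbreviation N where "N \<equiv> tensor_rel R S V"
abbreviation K where "K \<equiv> carrier R \<times> carrier V"
abbreviation T where "T \<equiv> tensor_module R S V"

definition tcoset where "tcoset x = N #>\<^bsub>G\<^esub> x"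

text \<open>The action on formal sums, before passing to cosets; it descends by
  \<open>sm_N\<close>.\<close>

definition frag_smult :: "'a \<Rightarrow> (('a \<times> 'v) \<Rightarrow>\<^sub>0 int) \<Rightarrow> (('a \<times> 'v) \<Rightarrow>\<^sub>0 int)" where
  "frag_smult r = frag_extend (\<lambda>(x, v). frag_of (r \<otimes> x, v))"

definition rels :: "(('a \<times> 'v) \<Rightarrow>\<^sub>0 int) set" where
  "rels = {frag_of (x \<oplus> y, v) - frag_of (x, v) - frag_of (y, v) | x y v.
         x \<in> carrier R \<and> y \<in> carrier R \<and> v \<in> carrier V} \<union>
      {frag_of (x, v \<oplus>\<^bsub>V\<^esub> w) - frag_of (x, v) - frag_of (x, w) | x v w.
         x \<in> carrier R \<and> v \<in> carrier V \<and> w \<in> carrier V} \<union>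
      {frag_of (x \<otimes> s, v) - frag_of (x, s \<odot>\<^bsub>V\<^esub> v) | x s v.
         x \<in> carrier R \<and> s \<in> S \<and> v \<in> carrier V}"

lemma N_eq: "N = generate G rels"
  by (simp add: tensor_rel_def rels_def)

lemma keys_frag_diff: "Poly_Mapping.keys x \<subseteq> P \<Longrightarrow> Poly_Mapping.keys y \<subseteq> P \<Longrightarrow> Poly_Mapping.keys (x - y) \<subseteq> P"
  for x y :: "'k \<Rightarrow>\<^sub>0 int"
  using keys_diff[of x y] by blast

lemma keys_frag_add: "Poly_Mapping.keys x \<subseteq> P \<Longrightarrow> Poly_Mapping.keys y \<subseteq> P \<Longrightarrow> Poly_Mapping.keys (x + y) \<subseteq> P"
  for x y :: "'k \<Rightarrow>\<^sub>0 int"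
  using keys_add[of x y] by blast

lemma relsE:
  assumes "h \<in> rels"
  obtains x y v where "x \<in> carrier R" "y \<in> carrier R" "v \<in> carrier V"
      "h = frag_of (x \<oplus> y, v) - frag_of (x, v) - frag_of (y, v)"
    | x v w where "x \<in> carrier R" "v \<in> carrier V" "w \<in> carrier V"
      "h = frag_of (x, v \<oplus>\<^bsub>V\<^esub> w) - frag_of (x, v) - frag_of (x, w)"
    | x s v where "x \<in> carrier R" "s \<in> S" "v \<in> carrier V"
      "h = frag_of (x \<otimes> s, v) - frag_of (x, s \<odot>\<^bsub>V\<^esub> v)"
  using assms unfolding rels_def
  by (elim UnE CollectE exE conjE)
    ((rule that(1); assumption) | (rule that(2); assumption) | (rule that(3); assumption))+

lemma S_in_carrier [simp]: "s \<in> S \<Longrightarrow> s \<in> carrier R"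
  using S_subset by blast

lemma rels_subset: "rels \<subseteq> carrier G"
proof
  fix h assume "h \<in> rels"
  then show "h \<in> carrier G"
    by (cases rule: relsE) (simp_all add: keys_frag_diff smult_V_closed)
qed

lemma subgroup_N: "subgroup N G"
  unfolding N_eq by (rule group.generate_is_subgroup[OF group_free_Abelian_group rels_subset])

lemma normal_N: "N \<lhd> G"
  by (rule comm_group.subgroup_imp_normal[OF abelian_free_Abelian_group subgroup_N])

lemma N_keys: "n \<in> N \<Longrightarrow> Poly_Mapping.keys n \<subseteq> K"
  using subgroup.subset[OF subgroup_N] carrier_free_Abelian_group_iff[THEN iffD1] by blast

lemma N_0: "0 \<in> N"
  using subgroup.one_closed[OF subgroup_N] by simp

lemma N_add: "m \<in> N \<Longrightarrow> n \<in> N \<Longrightarrow> m + n \<in> N"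
  using subgroup.m_closed[OF subgroup_N] by simp

lemma N_uminus: "n \<in> N \<Longrightarrow> - n \<in> N"
  using subgroup.m_inv_closed[OF subgroup_N] N_keys by fastforce

lemma N_diff: "m \<in> N \<Longrightarrow> n \<in> N \<Longrightarrow> m - n \<in> N"
  using N_add[OF _ N_uminus] by fastforce

lemma rels_in_N: "rels \<subseteq> N"
  unfolding N_eq by (auto intro: generate.incl)

lemma tc_alt: "tcoset x = (\<lambda>n. n + x) ` N"
  by (auto simp: tcoset_def r_coset_def)

lemma tc_eq_iff: "tcoset x = tcoset y \<longleftrightarrow> x - y \<in> N"
proof
  assume "tcoset x = tcoset y"
  moreover have "x \<in> tcoset x" unfolding tc_alt using N_0 by force
  ultimately show "x - y \<in> N" by (auto simp: tc_alt)
next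
  assume *: "x - y \<in> N"
  have "n + x \<in> tcoset y" if "n \<in> N" for n
    unfolding tc_alt using N_add[OF that *] by (intro image_eqI[of _ _ "n + (x - y)"]) auto
  moreover have "n + y \<in> tcoset x" if "n \<in> N" for n
    unfolding tc_alt using N_diff[OF that *] by (intro image_eqI[of _ _ "n - (x - y)"]) auto
  ultimately show "tcoset x = tcoset y"
    by (auto simp: tc_alt)
qed

lemma T_sel:
  "carrier T = tcoset ` {x. Poly_Mapping.keys x \<subseteq> K}"
  "\<zero>\<^bsub>T\<^esub> = tcoset 0"
  "x \<oplus>\<^bsub>T\<^esub> y = x <#>\<^bsub>G\<^esub> y"
  "r \<odot>\<^bsub>T\<^esub> x = (\<Union>t\<in>x. tcoset (frag_smult r t))"
  by (auto simp: tensor_module_def Let_def FactGroup_def RCOSETS_def tcoset_def frag_smult_def)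
    (simp add: r_coset_def)+

lemma tc_add: "Poly_Mapping.keys x \<subseteq> K \<Longrightarrow> Poly_Mapping.keys y \<subseteq> K \<Longrightarrow> tcoset x \<oplus>\<^bsub>T\<^esub> tcoset y = tcoset (x + y)"
  using normal.rcos_sum[OF normal_N, of x y] by (simp add: T_sel tcoset_def)

lemma sm_diff: "frag_smult r (x - y) = frag_smult r x - frag_smult r y"
  and sm_add: "frag_smult r (x + y) = frag_smult r x + frag_smult r y"
  and sm_uminus: "frag_smult r (- x) = - frag_smult r x"
  and sm_0 [simp]: "frag_smult r 0 = 0"
  by (simp_all add: frag_smult_def frag_extend_diff frag_extend_add frag_extend_minus)

lemma sm_of [simp]: "frag_smult r (frag_of (x, v)) = frag_of (r \<otimes> x, v)"
  by (simp add: frag_smult_def)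

lemma sm_keys:
  "r \<in> carrier R \<Longrightarrow> Poly_Mapping.keys x \<subseteq> K \<Longrightarrow> Poly_Mapping.keys (frag_smult r x) \<subseteq> K"
  unfolding frag_smult_def by (rule order_trans[OF keys_frag_extend]) auto

text \<open>Left multiplication by r maps each defining relation to one of the same kind, hence the
  generated subgroup into itself.\<close>

lemma sm_N: "r \<in> carrier R \<Longrightarrow> n \<in> N \<Longrightarrow> frag_smult r n \<in> N"
proof -
  assume r: "r \<in> carrier R"
  have rel: "frag_smult r h \<in> rels" if "h \<in> rels" for h
  proof -
    from that show ?thesis
    proof (cases rule: relsE)
      case (1 x y v)
      then have "frag_smult r h = frag_of (r \<otimes> x \<oplus> r \<otimes> y, v) - frag_of (r \<otimes> x, v) - frag_of (r \<otimes> y, v)"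
        using r by (simp add: sm_diff r_distr)
      then show ?thesis unfolding rels_def using r 1 by blast
    next
      case (2 x v w)
      then have "frag_smult r h = frag_of (r \<otimes> x, v \<oplus>\<^bsub>V\<^esub> w) - frag_of (r \<otimes> x, v) - frag_of (r \<otimes> x, w)"
        using r by (simp add: sm_diff)
      then show ?thesis unfolding rels_def using r 2 by blast
    next
      case (3 x s v)
      then have "frag_smult r h = frag_of (r \<otimes> x \<otimes> s, v) - frag_of (r \<otimes> x, s \<odot>\<^bsub>V\<^esub> v)"
        using r by (simp add: sm_diff m_assoc)
      then show ?thesis unfolding rels_def using r 3 by blast
    qed
  qed
  assume "n \<in> N"
  then have "n \<in> generate G rels" by (simp add: N_eq)
  then show ?thesis
  proof (induction n rule: generate.induct)
    case one
    then show ?case by (simp add: N_0)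
  next
    case (incl h)
    then show ?case using rel rels_in_N by blast
  next
    case (inv h)
    then have "Poly_Mapping.keys h \<subseteq> K" "frag_smult r h \<in> N"
      using rel rels_in_N N_keys by blast+
    then show ?case by (simp add: sm_uminus N_uminus)
  next
    case (eng h1 h2)
    then show ?case by (simp add: sm_add N_add)
  qed
qed

text \<open>The union in \<open>tensor_module\<close> runs over all representatives of the coset; by
  \<open>sm_N\<close> they all yield the same coset.\<close>

lemma smult_tc: "r \<in> carrier R \<Longrightarrow> r \<odot>\<^bsub>T\<^esub> tcoset x = tcoset (frag_smult r x)"
proof -
  assume r: "r \<in> carrier R"
  have "tcoset (frag_smult r (n + x)) = tcoset (frag_smult r x)" if "n \<in> N" for n
    using sm_N[OF r that] by (simp add: tc_eq_iff sm_add)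
  then show ?thesis
    using N_0 by (auto simp: T_sel(4) tc_alt[of x])
qed

lemma tc_closed: "Poly_Mapping.keys x \<subseteq> K \<Longrightarrow> tcoset x \<in> carrier T"
  by (simp add: T_sel)

text \<open>The module axioms of the tensor product are verified with f the difference of their two
  sides, so that only single pairs have to be checked.\<close>

lemma frag_rel_induct:
  assumes "Poly_Mapping.keys x \<subseteq> K"
    and diff: "\<And>x y. f (x - y) = f x - f y"
    and of: "\<And>a v. a \<in> carrier R \<Longrightarrow> v \<in> carrier V \<Longrightarrow> f (frag_of (a, v)) \<in> N"
  shows "f x \<in> N"
  using assms(1)
proof (induction x rule: frag_induction)
  case zero
  have "f 0 = 0" using diff[of 0 0] by simp
  then show ?case by (simp add: N_0)
next
  case (diff a b)
  then show ?case by (simp add: assms(2) N_diff)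
next
  case (one a)
  then show ?case using of by (cases a) auto
qed

lemma lmodule_T: "lmodule R T"
proof -
  have "abelian_group T"
  proof (rule abelian_groupI)
    fix x y z assume "x \<in> carrier T" "y \<in> carrier T" "z \<in> carrier T"
    then obtain a b c where abc: "Poly_Mapping.keys a \<subseteq> K" "x = tcoset a" "Poly_Mapping.keys b \<subseteq> K" "y = tcoset b"
      "Poly_Mapping.keys c \<subseteq> K" "z = tcoset c" by (auto simp: T_sel(1))
    note add = keys_frag_add[OF abc(1,3)] keys_frag_add[OF abc(3,5)]
    show "x \<oplus>\<^bsub>T\<^esub> y \<in> carrier T" using abc add by (simp add: tc_add tc_closed)
    show "x \<oplus>\<^bsub>T\<^esub> y = y \<oplus>\<^bsub>T\<^esub> x" using abc by (simp add: tc_add add.commute)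
    show "x \<oplus>\<^bsub>T\<^esub> y \<oplus>\<^bsub>T\<^esub> z = x \<oplus>\<^bsub>T\<^esub> (y \<oplus>\<^bsub>T\<^esub> z)" using abc add by (simp add: tc_add add.assoc)
    show "\<zero>\<^bsub>T\<^esub> \<oplus>\<^bsub>T\<^esub> x = x" using abc tc_add[of 0 a] by (simp add: T_sel(2))
    show "\<exists>y\<in>carrier T. y \<oplus>\<^bsub>T\<^esub> x = \<zero>\<^bsub>T\<^esub>"
      using abc by (intro bexI[of _ "tcoset (- a)"]) (simp_all add: tc_add tc_closed T_sel(2))
  qed (simp add: T_sel(2) tc_closed)
  then interpret T: abelian_group T .
  show ?thesis
  proof (intro lmodule.intro lmodule_axioms.intro ring_axioms T.abelian_group_axioms)
    fix a x assume a: "a \<in> carrier R" and "x \<in> carrier T"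
    then obtain c where c: "Poly_Mapping.keys c \<subseteq> K" "x = tcoset c"
      by (auto simp: T_sel(1))
    show "a \<odot>\<^bsub>T\<^esub> x \<in> carrier T"
      using a c by (simp add: smult_tc tc_closed sm_keys)
    show "a \<odot>\<^bsub>T\<^esub> (x \<oplus>\<^bsub>T\<^esub> y) = a \<odot>\<^bsub>T\<^esub> x \<oplus>\<^bsub>T\<^esub> a \<odot>\<^bsub>T\<^esub> y" if "y \<in> carrier T" for y
      using a c that by (auto simp: smult_tc tc_add sm_add sm_keys T_sel(1))
    fix b assume b: "b \<in> carrier R"
    have "frag_smult (a \<oplus> b) c - (frag_smult a c + frag_smult b c) \<in> N"
    proof (rule frag_rel_induct[OF c(1)])
      fix x v assume xv: "x \<in> carrier R" "v \<in> carrier V"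
      with a b have "frag_of (a \<otimes> x \<oplus> b \<otimes> x, v) - frag_of (a \<otimes> x, v) - frag_of (b \<otimes> x, v) \<in> rels"
        unfolding rels_def by blast
      with a b xv rels_in_N
      show "frag_smult (a \<oplus> b) (frag_of (x, v)) - (frag_smult a (frag_of (x, v)) + frag_smult b (frag_of (x, v))) \<in> N"
        by (auto simp: l_distr diff_diff_eq)
    qed (simp add: sm_diff)
    then show "(a \<oplus> b) \<odot>\<^bsub>T\<^esub> x = a \<odot>\<^bsub>T\<^esub> x \<oplus>\<^bsub>T\<^esub> b \<odot>\<^bsub>T\<^esub> x"
      using a b c by (simp add: smult_tc tc_add tc_eq_iff sm_keys)
    have "frag_smult (a \<otimes> b) c - frag_smult a (frag_smult b c) \<in> N"
      by (rule frag_rel_induct[OF c(1)]) (use a b in \<open>simp_all add: sm_diff m_assoc N_0\<close>)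
    then show "(a \<otimes> b) \<odot>\<^bsub>T\<^esub> x = a \<odot>\<^bsub>T\<^esub> (b \<odot>\<^bsub>T\<^esub> x)"
      using a b c by (simp add: smult_tc tc_eq_iff)
  next
    fix x assume "x \<in> carrier T"
    then obtain c where c: "Poly_Mapping.keys c \<subseteq> K" "x = tcoset c"
      by (auto simp: T_sel(1))
    have "frag_smult \<one> c - c \<in> N"
      by (rule frag_rel_induct[OF c(1)]) (simp_all add: sm_diff N_0)
    then show "\<one> \<odot>\<^bsub>T\<^esub> x = x"
      using c by (simp add: smult_tc tc_eq_iff)
  qed
qed

abbreviation pt where "pt \<equiv> pure_tensor R S V"

lemma pt_eq: "pt x v = tcoset (frag_of (x, v))"
  by (simp add: pure_tensor_def tcoset_def)

lemma pt_closed: "x \<in> carrier R \<Longrightarrow> v \<in> carrier V \<Longrightarrow> pt x v \<in> carrier T"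
  by (simp add: pt_eq tc_closed)

lemma smult_pt: "r \<in> carrier R \<Longrightarrow> r \<odot>\<^bsub>T\<^esub> pt x v = pt (r \<otimes> x) v"
  by (simp add: pt_eq smult_tc)

lemma pt_balanced:
  assumes "x \<in> carrier R" "s \<in> S" "v \<in> carrier V"
  shows "pt (x \<otimes> s) v = pt x (s \<odot>\<^bsub>V\<^esub> v)"
  unfolding pt_eq tc_eq_iff
  by (rule subsetD[OF rels_in_N]) (use assms in \<open>auto simp: rels_def\<close>)

lemma pt_add_right:
  assumes "x \<in> carrier R" "v \<in> carrier V" "w \<in> carrier V"
  shows "pt x (v \<oplus>\<^bsub>V\<^esub> w) = pt x v \<oplus>\<^bsub>T\<^esub> pt x w"
proof -
  have "frag_of (x, v \<oplus>\<^bsub>V\<^esub> w) - frag_of (x, v) - frag_of (x, w) \<in> rels"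
    using assms unfolding rels_def by blast
  then show ?thesis
    using assms rels_in_N by (auto simp: pt_eq tc_add tc_eq_iff diff_diff_eq)
qed

lemma pt_zero_right: "x \<in> carrier R \<Longrightarrow> pt x \<zero>\<^bsub>V\<^esub> = \<zero>\<^bsub>T\<^esub>"
proof -
  assume x: "x \<in> carrier R"
  interpret T: abelian_group T
    using lmodule_T by (rule lmodule.axioms)
  have "pt x \<zero>\<^bsub>V\<^esub> \<oplus>\<^bsub>T\<^esub> pt x \<zero>\<^bsub>V\<^esub> = pt x \<zero>\<^bsub>V\<^esub>"
    using pt_add_right[OF x V.zero_closed V.zero_closed] by simp
  then show ?thesis
    using pt_closed[OF x V.zero_closed] T.add.l_cancel[of "pt x \<zero>\<^bsub>V\<^esub>" "pt x \<zero>\<^bsub>V\<^esub>" "\<zero>\<^bsub>T\<^esub>"]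
    by simp
qed

lemma T_span:
  assumes "subgroup H (add_monoid T)" "\<And>x v. x \<in> carrier R \<Longrightarrow> v \<in> carrier V \<Longrightarrow> pt x v \<in> H"
  shows "carrier T \<subseteq> H"
proof
  fix y assume "y \<in> carrier T"
  then obtain c where c: "Poly_Mapping.keys c \<subseteq> K" "y = tcoset c" by (auto simp: T_sel(1))
  interpret T: abelian_group T using lmodule_T by (rule lmodule.axioms)
  have "Poly_Mapping.keys c \<subseteq> K \<and> tcoset c \<in> H" using c(1)
  proof (induction c rule: frag_induction)
    case zero
    show ?case using subgroup.one_closed[OF assms(1)] by (simp add: T_sel(2))
  next
    case (diff x y)
    have "tcoset (- y) \<oplus>\<^bsub>T\<^esub> tcoset y = \<zero>\<^bsub>T\<^esub>"
      using diff by (simp add: tc_add T_sel(2))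
    then have "\<ominus>\<^bsub>T\<^esub> tcoset y = tcoset (- y)"
      using diff by (intro T.minus_equality) (simp_all add: tc_closed)
    then have "tcoset (- y) \<in> H"
      using subgroup.m_inv_closed[OF assms(1), of "tcoset y"] diff by (simp add: a_inv_def)
    then have "tcoset x \<oplus>\<^bsub>T\<^esub> tcoset (- y) \<in> H"
      using subgroup.m_closed[OF assms(1), of "tcoset x" "tcoset (- y)"] diff by simp
    then show ?case using diff by (simp add: tc_add keys_frag_diff)
  next
    case (one a)
    then show ?case using assms(2) by (cases a) (auto simp: pt_eq)
  qed
  with c show "y \<in> H" by simp
qed

text \<open>The universal property as a test for nonvanishing: the additive extension of f to formal
  sums kills the relations, so f would vanish wherever the pure tensor is zero.\<close>

lemma pt_nonzero:
  fixes f :: "'a \<Rightarrow> 'v \<Rightarrow> 'z :: ab_group_add"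
  assumes add_left: "\<And>x y v. x \<in> carrier R \<Longrightarrow> y \<in> carrier R \<Longrightarrow> v \<in> carrier V \<Longrightarrow> f (x \<oplus> y) v = f x v + f y v"
    and add_right: "\<And>x v w. x \<in> carrier R \<Longrightarrow> v \<in> carrier V \<Longrightarrow> w \<in> carrier V \<Longrightarrow> f x (v \<oplus>\<^bsub>V\<^esub> w) = f x v + f x w"
    and bal: "\<And>x s v. x \<in> carrier R \<Longrightarrow> s \<in> S \<Longrightarrow> v \<in> carrier V \<Longrightarrow> f (x \<otimes> s) v = f x (s \<odot>\<^bsub>V\<^esub> v)"
    and xv: "x \<in> carrier R" "v \<in> carrier V" "f x v \<noteq> 0"
  shows "pt x v \<noteq> \<zero>\<^bsub>T\<^esub>"
proof
  define Z :: "'z monoid" where "Z = \<lparr>carrier = UNIV, monoid.mult = (+), one = 0\<rparr>"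
  have "\<exists>y. y + x = 0" for x :: 'z by (rule exI[of _ "- x"]) simp
  then have Z: "comm_group Z"
    by (intro comm_groupI) (auto simp: Z_def algebra_simps)
  obtain h where h: "h \<in> hom G Z" "\<And>p. p \<in> K \<Longrightarrow> h (frag_of p) = (\<lambda>(x, v). f x v) p"
    using comm_group.free_Abelian_group_universal[OF Z, of "\<lambda>(x, v). f x v" K] by (auto simp: Z_def)
  have hadd: "h (a + b) = h a + h b" if "Poly_Mapping.keys a \<subseteq> K" "Poly_Mapping.keys b \<subseteq> K" for a b
    using hom_mult[OF h(1), of a b] that by (simp add: Z_def)
  have hdiff: "h (a - b) = h a - h b" if "Poly_Mapping.keys a \<subseteq> K" "Poly_Mapping.keys b \<subseteq> K" for a b
    using hadd[OF keys_frag_diff[OF that] that(2)] by simp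
  have h0: "h 0 = 0" using hadd[of 0 0] by simp
  have hrel: "h g = 0" if "g \<in> rels" for g
    using that
    by (cases rule: relsE)
      (simp_all add: hdiff h add_left add_right bal smult_V_closed keys_frag_diff)
  have "h n = 0" if "n \<in> N" for n
    using that unfolding N_eq
  proof (induction n rule: generate.induct)
    case one
    then show ?case by (simp add: h0)
  next
    case (incl g)
    then show ?case by (rule hrel)
  next
    case (inv g)
    then have "Poly_Mapping.keys g \<subseteq> K"
      using rels_in_N N_keys by blast
    then show ?case
      using hrel[OF inv] hdiff[of 0 g] by (simp add: h0)
  next
    case (eng g1 g2)
    then show ?case using hadd[of g1 g2] N_keys by (simp add: N_eq)
  qed
  moreover assume "pt x v = \<zero>\<^bsub>T\<^esub>"
  ultimately have "h (frag_of (x, v)) = 0"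
    by (simp add: pt_eq T_sel(2) tc_eq_iff)
  with xv h(2)[of "(x, v)"] show False by simp
qed

end

section \<open>The algebra of a connection and its vacuum modules\<close>

lemma isomorphic_modules_sym:
  assumes "lmodule R M" "isomorphic_modules R M N"
  shows "isomorphic_modules R N M"
proof -
  from assms(2) obtain f where f: "bij_betw f (carrier M) (carrier N)"
    "\<And>x y. x \<in> carrier M \<Longrightarrow> y \<in> carrier M \<Longrightarrow> f (x \<oplus>\<^bsub>M\<^esub> y) = f x \<oplus>\<^bsub>N\<^esub> f y"
    "\<And>r x. r \<in> carrier R \<Longrightarrow> x \<in> carrier M \<Longrightarrow> f (r \<odot>\<^bsub>M\<^esub> x) = r \<odot>\<^bsub>N\<^esub> f x"
    unfolding isomorphic_modules_def module_iso_def by blast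
  interpret M: abelian_group M using assms(1) by (rule lmodule.axioms)
  define g where "g = inv_into (carrier M) f"
  have g: "f (g y) = y" "g y \<in> carrier M" if "y \<in> carrier N" for y
    using that f(1) unfolding g_def
    by (auto simp: bij_betw_def f_inv_into_f inv_into_into)
  have gf: "g (f x) = x" if "x \<in> carrier M" for x
    using that f(1) by (simp add: g_def bij_betw_def)
  have "g (x \<oplus>\<^bsub>N\<^esub> y) = g x \<oplus>\<^bsub>M\<^esub> g y" if "x \<in> carrier N" "y \<in> carrier N" for x y
    using gf[of "g x \<oplus>\<^bsub>M\<^esub> g y"] g that by (simp add: f(2))
  moreover have "g (r \<odot>\<^bsub>N\<^esub> x) = r \<odot>\<^bsub>M\<^esub> g x" if "r \<in> carrier R" "x \<in> carrier N" for r x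
    using gf[of "r \<odot>\<^bsub>M\<^esub> g x"] g that lmodule.smult_closed[OF assms(1)] by (simp add: f(3))
  moreover have "bij_betw g (carrier N) (carrier M)"
    unfolding g_def by (rule bij_betw_inv_into[OF f(1)])
  ultimately show ?thesis
    unfolding isomorphic_modules_def module_iso_def by blast
qed

lemma isomorphic_modules_trans:
  assumes "isomorphic_modules R M N" "isomorphic_modules R N P"
  shows "isomorphic_modules R M P"
proof -
  from assms obtain f g where "f \<in> module_iso R M N" "g \<in> module_iso R N P"
    unfolding isomorphic_modules_def by blast
  then have "g \<circ> f \<in> module_iso R M P"
    by (auto simp: module_iso_def intro: bij_betw_trans dest: bij_betwE)
  then show ?thesis unfolding isomorphic_modules_def by blast
qed

lemma isomorphic_modules_refl: "isomorphic_modules R M M"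
proof -
  have "id \<in> module_iso R M M" by (simp add: module_iso_def)
  then show ?thesis unfolding isomorphic_modules_def by blast
qed

context sl2_conn
begin

section \<open>Classes of free elements, the subalgebras and the Fock space\<close>

abbreviation FR :: "int set \<Rightarrow> free_elt set" where
  "FR N \<equiv> supp_in (lists (idx N))"

definition cls :: "free_elt \<Rightarrow> sf_elt" where
  "cls x = SF_ideal A +>\<^bsub>free_alg\<^esub> x"

lemma FR_mono: "N \<subseteq> N' \<Longrightarrow> x \<in> FR N \<Longrightarrow> x \<in> FR N'"
  by (rule subsetD[OF supp_in_mono[OF lists_mono]]) auto

lemma FR_UNIV [simp]: "FR UNIV = UNIV"
  by (simp add: idx_def)

lemma FR_mult: "x \<in> FR N \<Longrightarrow> y \<in> FR N \<Longrightarrow> x * y \<in> FR N"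
  by (rule mult_supp_lists)

lemmas FR_closed = FR_mult supp_in_closed const_supp_lists one_supp_lists

lemma nf_FR: "x \<in> FR N \<Longrightarrow> nf x \<in> FR N"
  using nf_supp supp_in_mono[OF sw_lists] by blast

lemma phi_FR: "x \<in> FR N \<Longrightarrow> phi x \<in> FR (N \<inter> {..0})"
proof -
  assume "x \<in> FR N"
  from phi_supp[OF this] have "phi x \<in> supp_in (lists (idx N \<inter> idx {..0}))"
    using supp_in_mono[OF sw_lists] by blast
  moreover have "idx N \<inter> idx {..0} = idx (N \<inter> {..0})" by auto
  ultimately show ?thesis by simp
qed

text \<open>Equal cosets mean a difference in the ideal, and \<open>nf_eq_iff\<close> translates
  this. From here on, equality in \<open>SF A\<close> is decided by words.\<close>

lemma cls_eq_iff: "cls x = cls y \<longleftrightarrow> nf x = nf y"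
proof -
  have cls: "cls x = (\<lambda>i. i + x) ` I" for x
    by (auto simp: cls_def SF_ideal_eq a_r_coset_def r_coset_def)
  show ?thesis
  proof
    assume "cls x = cls y"
    moreover have "x \<in> cls x" unfolding cls by (rule image_eqI[of _ _ 0]) auto
    ultimately show "nf x = nf y" by (auto simp: cls nf_eq_iff)
  next
    assume "nf x = nf y"
    then have *: "x - y \<in> I" by (simp add: nf_eq_iff)
    have "i + x \<in> cls y" if "i \<in> I" for i
      unfolding cls using I_add[OF that *] by (intro image_eqI[of _ _ "i + (x - y)"]) auto
    moreover have "i + y \<in> cls x" if "i \<in> I" for i
      unfolding cls using I_diff[OF that *] by (intro image_eqI[of _ _ "i - (x - y)"]) auto
    ultimately show "cls x = cls y" by (auto simp: cls)
  qed
qed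

lemma cls_nf [simp]: "cls (nf x) = cls x"
  by (simp add: cls_eq_iff)

lemma SF_sel:
  "carrier (SF A) = range cls" "\<one>\<^bsub>SF A\<^esub> = cls 1" "\<zero>\<^bsub>SF A\<^esub> = cls 0"
  "cls x \<otimes>\<^bsub>SF A\<^esub> cls y = cls (x * y)" "cls x \<oplus>\<^bsub>SF A\<^esub> cls y = cls (x + y)"
proof -
  have i: "ideal (SF_ideal A) free_alg" using ideal_I by (simp add: SF_ideal_eq)
  interpret ideal "SF_ideal A" free_alg by (rule i)
  show "carrier (SF A) = range cls"
    by (auto simp: SF_def FactRing_def A_RCOSETS_def RCOSETS_def cls_def a_r_coset_def)
  show "\<one>\<^bsub>SF A\<^esub> = cls 1" by (simp add: SF_def FactRing_def cls_def)
  have "SF_ideal A = cls 0" using a_coset_add_zero by (simp add: cls_def SF_ideal_eq a_r_coset_def r_coset_def)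
  then show "\<zero>\<^bsub>SF A\<^esub> = cls 0" by (simp add: SF_def FactRing_def)
  show "cls x \<otimes>\<^bsub>SF A\<^esub> cls y = cls (x * y)"
    using rcoset_mult_add[of x y] by (simp add: SF_def FactRing_def cls_def)
  show "cls x \<oplus>\<^bsub>SF A\<^esub> cls y = cls (x + y)"
    using a_rcos_sum[of x y] by (simp add: SF_def FactRing_def cls_def)
qed

lemma ring_SF: "ring (SF A)"
  using ideal.quotient_is_ring[OF ideal_I] by (simp add: SF_def SF_ideal_eq)

lemma psi_eq: "psi A a n = cls (mon [(a, n)])"
  by (simp add: psi_def cls_def gen_eq_mon)

lemma scal_eq: "scal A c = cls (const c)"
  by (simp add: scal_def cls_def)

lemma cls_uminus: "\<ominus>\<^bsub>SF A\<^esub> cls x = cls (- x)"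
proof -
  interpret ring "SF A" by (rule ring_SF)
  show ?thesis by (rule minus_equality) (simp_all add: SF_sel)
qed

lemma SF_sub_carrier: "carrier (SF_sub A N) = cls ` FR N"
proof -
  let ?H = "range (scal A) \<union> {psi A a n | a n. n \<in> N}"
  have "z \<in> cls ` FR N" if "z \<in> generate_ring (SF A) ?H" for z
    using that
  proof (induction z rule: generate_ring.induct)
    case one
    show ?case by (auto simp: SF_sel intro!: FR_closed)
  next
    case (incl h)
    then show ?case by (auto simp: scal_eq psi_eq intro!: imageI FR_closed)
  next
    case (a_inv h)
    then show ?case by (auto simp: cls_uminus intro!: imageI FR_closed)
  next
    case (eng_add h1 h2)
    then show ?case by (auto simp: SF_sel intro!: imageI FR_closed)
  next
    case (eng_mult h1 h2)
    then show ?case by (auto simp: SF_sel intro!: imageI FR_closed)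
  qed
  moreover have "cls x \<in> generate_ring (SF A) ?H" if "x \<in> FR N" for x
    using that
  proof (induction x rule: supp_in_induct)
    case zero
    show ?case by (rule generate_ring.incl) (auto simp: scal_eq intro: range_eqI[of _ _ 0])
  next
    case (add x y)
    then show ?case using generate_ring.eng_add[OF add(3,4)] by (simp add: SF_sel)
  next
    case (mon c w)
    have "cls (mon w) \<in> generate_ring (SF A) ?H"
      using mon
    proof (induction w)
      case Nil
      show ?case using generate_ring.one[of "SF A" ?H] by (simp add: SF_sel)
    next
      case (Cons u w)
      have "cls (mon [u]) \<in> generate_ring (SF A) ?H"
        using Cons by (intro generate_ring.incl) (cases u, auto simp: psi_eq)
      from generate_ring.eng_mult[OF this Cons.IH] show ?case
        by (simp add: SF_sel mon_Cons[of u w])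
    qed
    moreover have "cls (const c) \<in> generate_ring (SF A) ?H"
      by (intro generate_ring.incl) (auto simp: scal_eq)
    ultimately show ?case
      using generate_ring.eng_mult[of "cls (const c)" "SF A" ?H "cls (mon w)"] by (simp add: SF_sel)
  qed
  ultimately show ?thesis by (auto simp: SF_sub_def)
qed

lemma SF_sub_sel [simp]:
  "\<one>\<^bsub>SF_sub A N\<^esub> = cls 1" "\<zero>\<^bsub>SF_sub A N\<^esub> = cls 0"
  "cls x \<otimes>\<^bsub>SF_sub A N\<^esub> cls y = cls (x * y)" "cls x \<oplus>\<^bsub>SF_sub A N\<^esub> cls y = cls (x + y)"
  by (simp_all add: SF_sub_def SF_sel)

lemma ring_SF_sub: "ring (SF_sub A N)"
  unfolding SF_sub_def
  by (rule ring.generate_ring_is_ring[OF ring_SF]) (auto simp: SF_sel scal_eq psi_eq)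

lemma SF_sub_UNIV: "SF_sub A UNIV = SF A"
  using SF_sub_carrier[of UNIV] by (simp add: SF_sub_def SF_sel)

lemma SF_sub_minus:
  assumes "x \<in> FR N" "y \<in> FR N" shows "cls x \<ominus>\<^bsub>SF_sub A N\<^esub> cls y = cls (x - y)"
proof -
  interpret ring "SF_sub A N" by (rule ring_SF_sub)
  have "\<ominus>\<^bsub>SF_sub A N\<^esub> cls y = cls (- y)"
    by (rule minus_equality) (use assms in \<open>simp_all add: SF_sub_carrier FR_closed\<close>)
  then show ?thesis by (simp add: a_minus_def)
qed

text \<open>Taking the normal form removes the dependence on the chosen representative.\<close>

definition rep :: "sf_elt \<Rightarrow> free_elt" where
  "rep U = nf (SOME x. cls x = U)"

lemma rep_cls [simp]: "rep (cls x) = nf x"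
proof -
  have "cls (SOME y. cls y = cls x) = cls x" by (rule someI) simp
  then show ?thesis by (simp add: rep_def cls_eq_iff)
qed

lemma phi_mult_nf: "phi (nf x * nf y) = phi (x * y)"
  by (rule phi_nf_cong) (simp add: nf_mult_cong[of "nf x" x "nf y" y])

text \<open>The action on the quotient by the left ideal of the positive modes, with \<open>phi\<close> selecting
  the representative in nonpositive modes.\<close>

definition fock :: "int set \<Rightarrow> (sf_elt, sf_elt) module" where
  "fock N = \<lparr>carrier = carrier (SF_sub A (N \<inter> {..0})), mult = undefined, one = undefined,
     ring.zero = cls 0, add = add (SF A), module.smult = (\<lambda>U Y. cls (phi (rep U * rep Y)))\<rparr>"

lemma fock_sel:
  "carrier (fock N) = cls ` FR (N \<inter> {..0})" "\<zero>\<^bsub>fock N\<^esub> = cls 0"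
  "cls x \<oplus>\<^bsub>fock N\<^esub> cls y = cls (x + y)" "cls x \<odot>\<^bsub>fock N\<^esub> cls y = cls (phi (x * y))"
  by (simp_all add: fock_def SF_sub_carrier SF_sel phi_mult_nf)

lemma FR_nonpos: "x \<in> FR (N \<inter> {..0}) \<Longrightarrow> x \<in> FR N"
  by (erule FR_mono[rotated]) auto

lemma cls_phi_id: "x \<in> FR {..0} \<Longrightarrow> cls (phi x) = cls x"
proof -
  assume "x \<in> FR {..0}"
  then have "phi x = nf x"
    using phi_id[OF nf_supp] phi_nf_cong[of "nf x" x] by simp
  then show ?thesis by simp
qed

text \<open>Associativity of the action is \<open>phi_mult\<close>; the unit acts trivially because
  \<open>phi\<close> preserves the class of an element in nonpositive modes.\<close>

lemma lmodule_fock: "lmodule (SF_sub A N) (fock N)"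
proof -
  have ag: "abelian_group (fock N)"
  proof (rule abelian_groupI)
    fix x y z assume "x \<in> carrier (fock N)" "y \<in> carrier (fock N)" "z \<in> carrier (fock N)"
    then obtain a b c where abc: "x = cls a" "y = cls b" "z = cls c"
      "a \<in> FR (N \<inter> {..0})" "b \<in> FR (N \<inter> {..0})" "c \<in> FR (N \<inter> {..0})"
      by (auto simp: fock_sel(1))
    show "x \<oplus>\<^bsub>fock N\<^esub> y \<in> carrier (fock N)" using abc by (auto simp: fock_sel intro!: FR_closed)
    show "x \<oplus>\<^bsub>fock N\<^esub> y = y \<oplus>\<^bsub>fock N\<^esub> x" using abc by (simp add: fock_sel add.commute)
    show "x \<oplus>\<^bsub>fock N\<^esub> y \<oplus>\<^bsub>fock N\<^esub> z = x \<oplus>\<^bsub>fock N\<^esub> (y \<oplus>\<^bsub>fock N\<^esub> z)"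
      using abc by (simp add: fock_sel add.assoc)
    show "\<zero>\<^bsub>fock N\<^esub> \<oplus>\<^bsub>fock N\<^esub> x = x" using abc by (simp add: fock_sel)
    show "\<exists>y\<in>carrier (fock N). y \<oplus>\<^bsub>fock N\<^esub> x = \<zero>\<^bsub>fock N\<^esub>"
      using abc by (intro bexI[of _ "cls (- a)"]) (auto simp: fock_sel intro!: imageI FR_closed)
  qed (auto simp: fock_sel)
  show ?thesis
  proof (intro lmodule.intro lmodule_axioms.intro ring_SF_sub ag)
    fix a x assume "a \<in> carrier (SF_sub A N)" "x \<in> carrier (fock N)"
    then obtain c d where cd: "a = cls c" "c \<in> FR N" "x = cls d" "d \<in> FR (N \<inter> {..0})"
      by (auto simp: fock_sel SF_sub_carrier)
    show "a \<odot>\<^bsub>fock N\<^esub> x \<in> carrier (fock N)"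
      using cd by (auto simp: fock_sel intro!: imageI phi_FR FR_mult intro: FR_nonpos)
    show "a \<odot>\<^bsub>fock N\<^esub> (x \<oplus>\<^bsub>fock N\<^esub> y) = a \<odot>\<^bsub>fock N\<^esub> x \<oplus>\<^bsub>fock N\<^esub> a \<odot>\<^bsub>fock N\<^esub> y"
      if "y \<in> carrier (fock N)" for y
      using cd that by (auto simp: fock_sel algebra_simps)
    fix b assume "b \<in> carrier (SF_sub A N)"
    then obtain e where e: "b = cls e" by (auto simp: SF_sub_carrier)
    show "(a \<oplus>\<^bsub>SF_sub A N\<^esub> b) \<odot>\<^bsub>fock N\<^esub> x = a \<odot>\<^bsub>fock N\<^esub> x \<oplus>\<^bsub>fock N\<^esub> b \<odot>\<^bsub>fock N\<^esub> x"
      using cd e by (simp add: fock_sel algebra_simps)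
    show "a \<otimes>\<^bsub>SF_sub A N\<^esub> b \<odot>\<^bsub>fock N\<^esub> x = a \<odot>\<^bsub>fock N\<^esub> (b \<odot>\<^bsub>fock N\<^esub> x)"
      using cd e by (simp add: fock_sel phi_mult mult.assoc)
  next
    fix x assume "x \<in> carrier (fock N)"
    then obtain d where d: "x = cls d" "d \<in> FR (N \<inter> {..0})"
      by (auto simp: fock_sel)
    then have "d \<in> FR {..0}" by (auto intro: FR_mono[rotated])
    then show "\<one>\<^bsub>SF_sub A N\<^esub> \<odot>\<^bsub>fock N\<^esub> x = x"
      using d by (simp add: fock_sel cls_phi_id)
  qed
qed

text \<open>Irreducibility of the Fock space, in terms of representatives.\<close>

definition reaches_vacuum :: "int set \<Rightarrow> bool" where
  "reaches_vacuum N \<longleftrightarrow> (\<forall>f\<in>supp_in (increasing (idx (N \<inter> {..0}))). f \<noteq> 0 \<longrightarrow> (\<exists>x\<in>FR N. phi (x * f) = 1))"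

lemma reaches_vacuum_01: "reaches_vacuum {0, 1}"
  unfolding reaches_vacuum_def
proof (intro ballI impI)
  fix f assume "f \<in> supp_in (increasing (idx ({0, 1} \<inter> {..0})))" "f \<noteq> 0"
  moreover have "{0, 1} \<inter> {..0} = {- 0..0 :: int}" by auto
  ultimately obtain x where "x \<in> FR {1..0 + 1}" "phi (x * f) = 1"
    using phi_to_vacuum[of f 0] by metis
  then show "\<exists>x\<in>FR {0, 1}. phi (x * f) = 1"
    using FR_mono[of "{1..0 + 1}" "{0, 1}" x] by auto
qed

text \<open>An element involves finitely many words, so its modes are bounded below and
  \<open>phi_to_vacuum\<close> applies.\<close>

lemma reaches_vacuum_UNIV: "reaches_vacuum UNIV"
  unfolding reaches_vacuum_def
proof (intro ballI impI)
  fix f assume f: "f \<in> supp_in (increasing (idx (UNIV \<inter> {..0})))" "f \<noteq> 0"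
  define S where "S = snd ` (\<Union>w\<in>Poly_Mapping.keys f. set w)"
  have "finite S" by (simp add: S_def)
  then obtain M where M: "\<And>n. n \<in> S \<Longrightarrow> - M \<le> n"
    by (metis (no_types, opaque_lifting) Min_le minus_minus)
  have "f \<in> supp_in (increasing (idx {- M..0}))"
    using f(1) M unfolding supp_in_def increasing_def S_def by fastforce
  from phi_to_vacuum[OF this f(2)] show "\<exists>x\<in>FR UNIV. phi (x * f) = 1" by auto
qed

end

section \<open>Vacuum vectors in an arbitrary module\<close>

locale sf_module = sl2_conn +
  fixes N :: "int set" and M :: "(sf_elt, 'm) module"
  assumes lmod: "lmodule (SF_sub A N) M"
begin

sublocale M: abelian_group M
  using lmod by (rule lmodule.axioms)

text \<open>The action pulled back along \<open>cls\<close> to the free algebra, where elements can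
  be taken apart into words.\<close>

definition act_on :: "free_elt \<Rightarrow> 'm \<Rightarrow> 'm" where
  "act_on x m = cls x \<odot>\<^bsub>M\<^esub> m"

lemma ac_cong: "nf x = nf y \<Longrightarrow> act_on x m = act_on y m"
  using cls_eq_iff[of x y] by (simp add: act_on_def)

lemma ac_closed: "x \<in> FR N \<Longrightarrow> m \<in> carrier M \<Longrightarrow> act_on x m \<in> carrier M"
  using lmodule.smult_closed[OF lmod] by (simp add: act_on_def SF_sub_carrier)

lemma ac_add_left: "x \<in> FR N \<Longrightarrow> y \<in> FR N \<Longrightarrow> m \<in> carrier M \<Longrightarrow> act_on (x + y) m = act_on x m \<oplus>\<^bsub>M\<^esub> act_on y m"
  using lmodule.smult_l_distr[OF lmod, of "cls x" "cls y" m] by (simp add: act_on_def SF_sub_carrier)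

lemma ac_add_right: "x \<in> FR N \<Longrightarrow> m \<in> carrier M \<Longrightarrow> n \<in> carrier M \<Longrightarrow> act_on x (m \<oplus>\<^bsub>M\<^esub> n) = act_on x m \<oplus>\<^bsub>M\<^esub> act_on x n"
  using lmodule.smult_r_distr[OF lmod, of "cls x" m n] by (simp add: act_on_def SF_sub_carrier)

lemma ac_mult: "x \<in> FR N \<Longrightarrow> y \<in> FR N \<Longrightarrow> m \<in> carrier M \<Longrightarrow> act_on (x * y) m = act_on x (act_on y m)"
  using lmodule.smult_assoc[OF lmod, of "cls x" "cls y" m] by (simp add: act_on_def SF_sub_carrier)

lemma ac_1: "m \<in> carrier M \<Longrightarrow> act_on 1 m = m"
  using lmodule.smult_one[OF lmod, of m] by (simp add: act_on_def)

lemma ac_0: "m \<in> carrier M \<Longrightarrow> act_on 0 m = \<zero>\<^bsub>M\<^esub>"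
  using ac_add_left[of 0 0 m] ac_closed[of 0 m] M.add.l_cancel[of "act_on 0 m" "act_on 0 m" "\<zero>\<^bsub>M\<^esub>"] by simp

lemma ac_zero: "x \<in> FR N \<Longrightarrow> act_on x \<zero>\<^bsub>M\<^esub> = \<zero>\<^bsub>M\<^esub>"
  using ac_add_right[of x "\<zero>\<^bsub>M\<^esub>" "\<zero>\<^bsub>M\<^esub>"] ac_closed[of x "\<zero>\<^bsub>M\<^esub>"]
    M.add.l_cancel[of "act_on x \<zero>\<^bsub>M\<^esub>" "act_on x \<zero>\<^bsub>M\<^esub>" "\<zero>\<^bsub>M\<^esub>"] by simp

definition vacuum :: "'m \<Rightarrow> bool" where
  "vacuum u \<longleftrightarrow> u \<in> carrier M \<and> (\<forall>v. snd v \<in> N \<longrightarrow> 0 < snd v \<longrightarrow> act_on (mon [v]) u = \<zero>\<^bsub>M\<^esub>)"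

lemma vacD: "vacuum u \<Longrightarrow> snd v \<in> N \<Longrightarrow> 0 < snd v \<Longrightarrow> act_on (mon [v]) u = \<zero>\<^bsub>M\<^esub>"
  unfolding vacuum_def by blast

text \<open>The difference of \<open>nf x\<close> and \<open>phi x\<close> is a combination of words
  ending in a positive letter, and that letter kills u.\<close>

lemma ac_phi:
  assumes "vacuum u" "x \<in> FR N" shows "act_on (phi x) u = act_on x u"
proof -
  have u: "u \<in> carrier M" using assms(1) by (simp add: vacuum_def)
  have sub: "{w \<in> increasing (idx N). \<not> below 0 w} \<subseteq> lists (idx N)" using sw_lists by auto
  have zero: "act_on z u = \<zero>\<^bsub>M\<^esub>" if "z \<in> supp_in {w \<in> increasing (idx N). \<not> below 0 w}" for z
    using that
  proof (induction z rule: supp_in_induct)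
    case zero
    show ?case by (rule ac_0[OF u])
  next
    case (add x y)
    then show ?case using supp_in_mono[OF sub] by (simp add: ac_add_left u subset_iff)
  next
    case (mon c w)
    then obtain v l where w: "w = v @ [l]" "v \<in> lists (idx N)" "l \<in> idx N" "0 < snd l"
      using not_below_snoc[of w "idx N"] by auto
    have "act_on (const c * mon v * mon [l]) u = act_on (const c * mon v) (act_on (mon [l]) u)"
      using w by (intro ac_mult u FR_closed) auto
    also have "\<dots> = \<zero>\<^bsub>M\<^esub>"
      using vacD[OF assms(1), of l] w by (simp add: ac_zero FR_closed)
    finally show ?case by (simp add: w(1) mon_append mult.assoc)
  qed
  have p: "phi x \<in> FR N" by (rule FR_nonpos[OF phi_FR[OF assms(2)]])
  have "act_on x u = act_on (phi x + (nf x - phi x)) u"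
    by (rule ac_cong) simp
  also have "\<dots> = act_on (phi x) u \<oplus>\<^bsub>M\<^esub> \<zero>\<^bsub>M\<^esub>"
    using p u nf_FR[OF assms(2)] zero[OF nf_minus_phi_supp[OF assms(2)]]
    by (subst ac_add_left) (auto intro!: FR_closed)
  finally show ?thesis using ac_closed[OF p u] by simp
qed

text \<open>If \<open>phi y\<close> were nonzero, some x would bring it back to 1; applying x to the
  zero vector y u would then give u.\<close>

lemma vac_faithful:
  assumes "vacuum u" "u \<noteq> \<zero>\<^bsub>M\<^esub>" "reaches_vacuum N" "y \<in> FR N" "act_on y u = \<zero>\<^bsub>M\<^esub>"
  shows "phi y = 0"
proof (rule ccontr)
  assume "phi y \<noteq> 0"
  moreover have "idx N \<inter> idx {..0} = idx (N \<inter> {..0})" by auto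
  then have "phi y \<in> supp_in (increasing (idx (N \<inter> {..0})))"
    using phi_supp[OF assms(4)] by simp
  ultimately obtain x where x: "x \<in> FR N" "phi (x * phi y) = 1"
    using assms(3) unfolding reaches_vacuum_def by blast
  have u: "u \<in> carrier M" using assms(1) by (simp add: vacuum_def)
  have "act_on x (act_on y u) = act_on (x * y) u"
    using x assms u by (simp add: ac_mult)
  also have "\<dots> = act_on (phi (x * y)) u"
    using x assms by (simp add: ac_phi FR_closed)
  also have "\<dots> = u"
    using x u by (simp add: phi_mult ac_1)
  finally show False
    using assms x by (simp add: ac_zero)
qed

definition cyclic :: "'m \<Rightarrow> bool" where
  "cyclic u \<longleftrightarrow> carrier M = (\<lambda>x. act_on x u) ` FR N"

text \<open>A nonzero element of a submodule is y u with \<open>phi y\<close> nonzero. Some x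
  returns it to u, and u generates the module.\<close>

lemma vac_simple:
  assumes "vacuum u" "u \<noteq> \<zero>\<^bsub>M\<^esub>" "reaches_vacuum N" "cyclic u"
  shows "simple_module (SF_sub A N) M"
  unfolding simple_module_def
proof (intro conjI allI impI lmod)
  have u: "u \<in> carrier M" using assms(1) by (simp add: vacuum_def)
  then show "carrier M \<noteq> {\<zero>\<^bsub>M\<^esub>}" using assms(2) by auto
  fix H assume H: "submodule H (SF_sub A N) M"
  interpret H: submodule H "SF_sub A N" M by (rule H)
  have smult: "act_on x m \<in> H" if "x \<in> FR N" "m \<in> H" for x m
    using H.smult_closed that by (simp add: act_on_def SF_sub_carrier)
  show "H = {\<zero>\<^bsub>M\<^esub>} \<or> H = carrier M"
  proof (cases "H \<subseteq> {\<zero>\<^bsub>M\<^esub>}")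
    case True
    then show ?thesis using H.one_closed by auto
  next
    case False
    then obtain m where m: "m \<in> H" "m \<noteq> \<zero>\<^bsub>M\<^esub>" by auto
    then have "m \<in> carrier M" using H.subset by auto
    then obtain y where y: "y \<in> FR N" "m = act_on y u"
      using assms(4) by (auto simp: cyclic_def)
    have "phi y \<noteq> 0"
      using ac_phi[OF assms(1) y(1)] m(2) y(2) ac_0[OF u] by auto
    moreover have "idx N \<inter> idx {..0} = idx (N \<inter> {..0})" by auto
    then have "phi y \<in> supp_in (increasing (idx (N \<inter> {..0})))"
      using phi_supp[OF y(1)] by simp
    ultimately obtain x where x: "x \<in> FR N" "phi (x * phi y) = 1"
      using assms(3) unfolding reaches_vacuum_def by blast
    have "act_on x m = act_on (phi (x * y)) u"
      using x y u assms(1) by (simp add: ac_phi FR_closed ac_mult)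
    also have "\<dots> = u" using x u by (simp add: phi_mult ac_1)
    finally have "u \<in> H" using smult[OF x(1) m(1)] by simp
    then have "carrier M \<subseteq> H"
      using assms(4) smult by (auto simp: cyclic_def)
    then show ?thesis using H.subset by auto
  qed
qed

text \<open>Injectivity is \<open>vac_faithful\<close>; surjectivity holds because x and
  \<open>phi x\<close> have the same effect on u. Modules with different types of elements can thus
  be compared through the Fock space.\<close>

lemma vac_iso:
  assumes "vacuum u" "u \<noteq> \<zero>\<^bsub>M\<^esub>" "reaches_vacuum N" "cyclic u"
  shows "(\<lambda>U. U \<odot>\<^bsub>M\<^esub> u) \<in> module_iso (SF_sub A N) (fock N) M"
proof -
  have u: "u \<in> carrier M" using assms(1) by (simp add: vacuum_def)
  let ?f = "\<lambda>U. U \<odot>\<^bsub>M\<^esub> u"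
  have f: "?f (cls x) = act_on x u" for x by (simp add: act_on_def)
  have "inj_on ?f (carrier (fock N))"
  proof (rule inj_onI)
    fix U Y assume "U \<in> carrier (fock N)" "Y \<in> carrier (fock N)" "?f U = ?f Y"
    then obtain x y where xy: "U = cls x" "x \<in> FR (N \<inter> {..0})" "Y = cls y" "y \<in> FR (N \<inter> {..0})"
      "act_on x u = act_on y u"
      by (auto simp: fock_sel f)
    then have xyN: "x \<in> FR N" "y \<in> FR N" by (auto intro: FR_nonpos)
    have "act_on (x - y) u \<oplus>\<^bsub>M\<^esub> act_on y u = \<zero>\<^bsub>M\<^esub> \<oplus>\<^bsub>M\<^esub> act_on y u"
      using xyN xy(5) u by (subst ac_add_left[symmetric]) (auto simp: FR_closed ac_closed)
    then have "act_on (x - y) u = \<zero>\<^bsub>M\<^esub>"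
      using xyN u by (simp add: ac_closed FR_closed)
    then have "phi (x - y) = 0"
      by (rule vac_faithful[OF assms(1-3) supp_in_diff[OF xyN]])
    then have "cls (phi x) = cls (phi y)" by simp
    moreover have "x \<in> FR {..0}" "y \<in> FR {..0}"
      using xy FR_mono[of "N \<inter> {..0}" "{..0}"] by auto
    ultimately show "U = Y" by (simp add: xy cls_phi_id)
  qed
  moreover have "?f ` carrier (fock N) = carrier M"
  proof -
    have *: "act_on x u \<in> (\<lambda>x. act_on x u) ` FR (N \<inter> {..0})" if "x \<in> FR N" for x
      by (rule image_eqI[of _ _ "phi x"]) (use ac_phi[OF assms(1) that] phi_FR[OF that] in auto)
    have "carrier M = (\<lambda>x. act_on x u) ` FR (N \<inter> {..0})"
      unfolding assms(4)[unfolded cyclic_def]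
    proof (rule equalityI)
      show "(\<lambda>x. act_on x u) ` FR N \<subseteq> (\<lambda>x. act_on x u) ` FR (N \<inter> {..0})"
        by (rule image_subsetI) (rule *)
      show "(\<lambda>x. act_on x u) ` FR (N \<inter> {..0}) \<subseteq> (\<lambda>x. act_on x u) ` FR N"
        by (intro image_mono supp_in_mono lists_mono) auto
    qed
    then show ?thesis by (simp add: fock_sel image_image f)
  qed
  moreover have "?f (U \<oplus>\<^bsub>fock N\<^esub> Y) = ?f U \<oplus>\<^bsub>M\<^esub> ?f Y"
    if "U \<in> carrier (fock N)" "Y \<in> carrier (fock N)" for U Y
    using that u FR_nonpos by (auto simp: fock_sel f ac_add_left)
  moreover have "?f (R \<odot>\<^bsub>fock N\<^esub> U) = R \<odot>\<^bsub>M\<^esub> ?f U"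
    if "R \<in> carrier (SF_sub A N)" "U \<in> carrier (fock N)" for R U
  proof -
    from that obtain r x where rx: "R = cls r" "r \<in> FR N" "U = cls x" "x \<in> FR N"
      by (auto simp: fock_sel SF_sub_carrier intro: FR_nonpos)
    then show ?thesis
      using ac_mult[OF rx(2,4) u] ac_phi[OF assms(1) FR_mult[OF rx(2,4)]]
      by (simp add: fock_sel f) (simp add: act_on_def)
  qed
  ultimately show ?thesis
    by (simp add: module_iso_def bij_betw_def)
qed

lemma cyclic_of_simple:
  assumes "simple_module (SF_sub A N) M" "u \<in> carrier M" "u \<noteq> \<zero>\<^bsub>M\<^esub>"
  shows "cyclic u"
proof -
  let ?H = "(\<lambda>x. act_on x u) ` FR N"
  have "submodule ?H (SF_sub A N) M"
  proof (intro submodule.intro submodule_axioms.intro)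
    show "subgroup ?H (add_monoid M)"
    proof (rule M.add.subgroupI)
      show "?H \<subseteq> carrier M" using assms(2) by (auto simp: ac_closed)
      show "?H \<noteq> {}" using one_supp_lists by blast
    next
      fix a assume "a \<in> ?H"
      then obtain x where x: "x \<in> FR N" "a = act_on x u" by auto
      have "\<ominus>\<^bsub>M\<^esub> a = act_on (- x) u"
        by (rule M.minus_equality)
          (use x assms(2) in \<open>auto simp: ac_closed FR_closed ac_0 simp flip: ac_add_left\<close>)
      then show "\<ominus>\<^bsub>M\<^esub> a \<in> ?H" using x by (auto intro!: FR_closed)
    next
      fix a b assume "a \<in> ?H" "b \<in> ?H"
      then show "a \<oplus>\<^bsub>M\<^esub> b \<in> ?H"
        using assms(2) by (auto simp: FR_closed simp flip: ac_add_left)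
    qed
  next
    fix a x assume "a \<in> carrier (SF_sub A N)" "x \<in> ?H"
    then show "a \<odot>\<^bsub>M\<^esub> x \<in> ?H"
      using assms(2) by (auto simp: SF_sub_carrier FR_closed simp flip: act_on_def ac_mult)
  qed
  moreover have "u \<in> ?H"
    using ac_1[OF assms(2)] by (intro image_eqI[of _ _ 1]) auto
  ultimately show ?thesis
    using assms unfolding simple_module_def cyclic_def by blast
qed

text \<open>Only the two modes of index 1 remain. Each squares to zero and anticommutes with every
  positive mode. If such a mode does not kill the vector, the image under it is a nonzero vector
  that it kills, and no annihilation obtained before is lost.\<close>

lemma obtain_vac:
  assumes "{0, 1} \<subseteq> N" "v \<in> carrier M" "v \<noteq> \<zero>\<^bsub>M\<^esub>"
    and "\<And>l. snd l \<in> N \<Longrightarrow> 2 \<le> snd l \<Longrightarrow> act_on (mon [l]) v = \<zero>\<^bsub>M\<^esub>"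
  obtains u where "vacuum u" "u \<noteq> \<zero>\<^bsub>M\<^esub>"
proof -
  define P where "P u \<longleftrightarrow> u \<in> carrier M \<and> u \<noteq> \<zero>\<^bsub>M\<^esub> \<and> (\<forall>l. snd l \<in> N \<longrightarrow> 2 \<le> snd l \<longrightarrow> act_on (mon [l]) u = \<zero>\<^bsub>M\<^esub>)" for u
  have anti: "act_on (mon [l]) (act_on (mon [k]) u) = \<zero>\<^bsub>M\<^esub>"
    if "u \<in> carrier M" "act_on (mon [l]) u = \<zero>\<^bsub>M\<^esub>" "snd l \<in> N" "snd k \<in> N" "0 < snd l" "0 < snd k" for k l u
  proof -
    have N: "mon [l] \<in> FR N" "mon [k] \<in> FR N" using that by auto
    have "nf (mon [l] * mon [k]) = nf (- 1 * (mon [k] * mon [l]))"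
      using nf_anticommute[of l k] bform_ge_2[of l k] that by (simp add: add_eq_0_iff2)
    then have "act_on (mon [l] * mon [k]) u = act_on (- 1 * (mon [k] * mon [l])) u"
      by (rule ac_cong)
    also have "\<dots> = act_on (- 1) (act_on (mon [k]) (act_on (mon [l]) u))"
      using N that(1) by (subst ac_mult) (auto simp: ac_mult FR_closed supp_in_uminus)
    also have "\<dots> = \<zero>\<^bsub>M\<^esub>" using N that by (simp add: ac_zero supp_in_uminus)
    finally show ?thesis using N that by (simp add: ac_mult)
  qed
  have sq: "act_on (mon [l]) (act_on (mon [l]) u) = \<zero>\<^bsub>M\<^esub>" if "u \<in> carrier M" "snd l \<in> N" "0 < snd l" for l u
  proof -
    have "act_on (mon [l] * mon [l]) u = act_on 0 u"
      by (rule ac_cong) (simp add: nf_sq_annihilator that(3))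
    then show ?thesis using that by (simp add: ac_mult ac_0)
  qed
  have step: "\<exists>u'. P u' \<and> act_on (mon [l]) u' = \<zero>\<^bsub>M\<^esub> \<and>
      (\<forall>k. snd k \<in> N \<longrightarrow> 0 < snd k \<longrightarrow> act_on (mon [k]) u = \<zero>\<^bsub>M\<^esub> \<longrightarrow> act_on (mon [k]) u' = \<zero>\<^bsub>M\<^esub>)"
    if "P u" "snd l = 1" for u l
  proof (cases "act_on (mon [l]) u = \<zero>\<^bsub>M\<^esub>")
    case True
    then show ?thesis using that by blast
  next
    case False
    have l: "snd l \<in> N" using that assms(1) by auto
    have "P (act_on (mon [l]) u)"
      unfolding P_def
    proof (intro conjI allI impI)
      show "act_on (mon [l]) u \<in> carrier M" using that l by (auto simp: P_def intro!: ac_closed)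
      show "act_on (mon [l]) u \<noteq> \<zero>\<^bsub>M\<^esub>" by (rule False)
      show "act_on (mon [k]) (act_on (mon [l]) u) = \<zero>\<^bsub>M\<^esub>" if "snd k \<in> N" "2 \<le> snd k" for k
      proof (rule anti)
        show "u \<in> carrier M" "act_on (mon [k]) u = \<zero>\<^bsub>M\<^esub>"
          using \<open>P u\<close> that unfolding P_def by blast+
      qed (use that \<open>snd l = 1\<close> l in auto)
    qed
    then show ?thesis
      using sq[of u l] anti[of u _ l] that l by (auto simp: P_def)
  qed
  have "P v" using assms by (auto simp: P_def)
  from step[OF this, of "(Pls, 1)"] obtain u1 where u1: "P u1" "act_on (mon [(Pls, 1)]) u1 = \<zero>\<^bsub>M\<^esub>" by auto
  from step[OF this(1), of "(Mns, 1)"] u1(2) assms(1) obtain u2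
    where u2: "P u2" "act_on (mon [(Mns, 1)]) u2 = \<zero>\<^bsub>M\<^esub>" "act_on (mon [(Pls, 1)]) u2 = \<zero>\<^bsub>M\<^esub>" by auto
  have "vacuum u2"
    unfolding vacuum_def
  proof (intro conjI allI impI)
    show "u2 \<in> carrier M" using u2 by (simp add: P_def)
    fix k :: letter assume k: "snd k \<in> N" "0 < snd k"
    show "act_on (mon [k]) u2 = \<zero>\<^bsub>M\<^esub>"
    proof (cases "snd k = 1")
      case True
      then have "k = (Pls, 1) \<or> k = (Mns, 1)" by (cases "fst k") (auto simp: prod_eq_iff)
      then show ?thesis using u2 by auto
    next
      case False
      then have "2 \<le> snd k" using k by simp
      then show ?thesis using u2(1) k unfolding P_def by blast
    qed
  qed
  then show thesis using that u2 by (auto simp: P_def)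
qed

lemma simple_iso_fock:
  assumes "simple_module (SF_sub A N) M" "vacuum u" "u \<noteq> \<zero>\<^bsub>M\<^esub>" "reaches_vacuum N"
  shows "isomorphic_modules (SF_sub A N) (fock N) M"
proof -
  have "cyclic u" using cyclic_of_simple assms by (auto simp: vacuum_def)
  from vac_iso[OF assms(2-4) this] show ?thesis
    unfolding isomorphic_modules_def by blast
qed

end

context sl2_conn
begin

section \<open>The subalgebra generated by the modes 0 and 1\<close>

lemma idx_0: "idx {0} = insert (Pls, 0) (insert (Mns, 0) {})"
proof (rule Set.set_eqI)
  fix u :: letter
  show "u \<in> idx {0} \<longleftrightarrow> u \<in> insert (Pls, 0) (insert (Mns, 0) {})"
    by (cases u; cases "fst u") auto
qed

lemma idx_0_1: "idx {0, 1} = insert (Pls, 0) (insert (Mns, 0) (insert (Pls, 1) (insert (Mns, 1) {})))"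
proof (rule Set.set_eqI)
  fix u :: letter
  show "u \<in> idx {0, 1} \<longleftrightarrow> u \<in> insert (Pls, 0) (insert (Mns, 0) (insert (Pls, 1) (insert (Mns, 1) {})))"
    by (cases u; cases "fst u") auto
qed

text \<open>A letter preceding all of P may be prepended or not, which doubles the count. The
  letters are therefore inserted in decreasing order of their keys.\<close>

lemma card_sw_insert:
  assumes "finite (increasing P)" "\<And>v. v \<in> P \<Longrightarrow> key s < key v"
  shows "finite (increasing (insert s P)) \<and> card (increasing (insert s P)) = 2 * card (increasing P)"
proof -
  have P: "insert s P \<inter> above s = P"
    using assms(2) by (auto simp: above_def)
  have "increasing (insert s P) = increasing P \<union> (#) s ` increasing P"
  proof (intro equalityI subsetI)
    fix w assume "w \<in> increasing (insert s P)"
    then show "w \<in> increasing P \<union> (#) s ` increasing P"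
      using sw_Un_Cons[of w "insert s P" s] assms(2) P by auto
  next
    fix w assume "w \<in> increasing P \<union> (#) s ` increasing P"
    then show "w \<in> increasing (insert s P)"
      using sw_mono[of P "insert s P"] by (auto simp: Cons_in_sw P)
  qed
  moreover have "increasing P \<inter> (#) s ` increasing P = {}"
    using assms(2)[of s] by (auto simp: increasing_def)
  ultimately show ?thesis
    using assms(1) by (simp add: card_Un_disjoint card_image)
qed

lemma card_sw_empty: "finite (increasing {}) \<and> card (increasing {}) = 1"
proof -
  have "increasing {} = {[]}" by (auto simp: increasing_def)
  then show ?thesis by simp
qed

lemma card_sw_0: "finite (increasing (idx {0})) \<and> card (increasing (idx {0})) = 2 ^ 2"
proof -
  have 1: "finite (increasing {(Mns, 0)}) \<and> card (increasing {(Mns, 0)}) = 2"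
    using card_sw_insert[of "{}" "(Mns, 0)"] card_sw_empty by simp
  show ?thesis
    unfolding idx_0 using card_sw_insert[of "{(Mns, 0)}" "(Pls, 0)"] 1 by (simp add: key_def)
qed

lemma card_sw_0_1: "finite (increasing (idx {0, 1})) \<and> card (increasing (idx {0, 1})) = 2 ^ 4"
proof -
  have 1: "finite (increasing {(Mns, 1)}) \<and> card (increasing {(Mns, 1)}) = 2"
    using card_sw_insert[of "{}" "(Mns, 1)"] card_sw_empty by simp
  have 2: "finite (increasing {(Pls, 1), (Mns, 1)}) \<and> card (increasing {(Pls, 1), (Mns, 1)}) = 4"
    using card_sw_insert[of "{(Mns, 1)}" "(Pls, 1)"] 1 by (simp add: key_def)
  have 3: "finite (increasing {(Mns, 0), (Pls, 1), (Mns, 1)}) \<and> card (increasing {(Mns, 0), (Pls, 1), (Mns, 1)}) = 8"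
  proof -
    have "key (Mns, 0) < key v" if "v \<in> {(Pls, 1), (Mns, 1)}" for v
      using that by (auto simp: key_def)
    from card_sw_insert[OF conjunct1[OF 2] this] 2 show ?thesis by simp
  qed
  have "key (Pls, 0) < key v" if "v \<in> {(Mns, 0), (Pls, 1), (Mns, 1)}" for v
    using that by (auto simp: key_def)
  from card_sw_insert[OF conjunct1[OF 3] this] 3 show ?thesis
    unfolding idx_0_1 by simp
qed

text \<open>Each increasing word is its own normal form, so a further word lies outside the span of
  the previous ones and raises the dimension by one.\<close>

lemma dimension_supp:
  "finite W \<Longrightarrow> W \<subseteq> increasing UNIV \<Longrightarrow> ring.dimension (SF A) (card W) (range (scal A)) (cls ` supp_in W)"
proof (induction W rule: finite_induct)
  interpret R: ring "SF A" by (rule ring_SF)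
  {
    case empty
    have "supp_in {} = {0 :: free_elt}" by (auto simp: supp_in_def)
    then show ?case using R.zero_dim by (simp add: SF_sel)
  next
    case (insert w W)
    have "cls (mon w) \<notin> cls ` supp_in W"
    proof
      assume "cls (mon w) \<in> cls ` supp_in W"
      then obtain x where x: "x \<in> supp_in W" "nf (mon w) = nf x"
        by (auto simp: cls_eq_iff)
      have "x \<in> supp_in (increasing UNIV)"
        using x(1) insert.prems supp_in_mono[of W "increasing UNIV"] by auto
      then have "mon w = x"
        using x insert.prems nf_mon_sw[of w UNIV] by (simp add: nf_id)
      with x(1) insert.hyps show False by auto
    qed
    moreover have "R.line_extension (range (scal A)) (cls (mon w)) (cls ` supp_in W) = cls ` supp_in (insert w W)"
    proof (intro equalityI subsetI)
      fix z assume "z \<in> R.line_extension (range (scal A)) (cls (mon w)) (cls ` supp_in W)"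
      then obtain c x where "x \<in> supp_in W" "z = cls (const c * mon w + x)"
        by (auto simp: R.line_extension_mem_iff scal_eq SF_sel)
      moreover have "x \<in> supp_in (insert w W)" using \<open>x \<in> supp_in W\<close> by (auto simp: supp_in_def)
      ultimately show "z \<in> cls ` supp_in (insert w W)"
        by (auto intro!: imageI supp_in_closed)
    next
      fix z assume "z \<in> cls ` supp_in (insert w W)"
      then obtain x where x: "z = cls x" "x \<in> supp_in (insert w W)" by auto
      have "\<exists>c. \<exists>y\<in>supp_in W. x = const c * mon w + y"
        using x(2)
      proof (induction x rule: supp_in_induct)
        case zero
        show ?case by (intro exI[of _ 0] bexI[of _ 0]) auto
      next
        case (add x y)
        then obtain c d x' y' where "x = const c * mon w + x'" "y = const d * mon w + y'"
          "x' \<in> supp_in W" "y' \<in> supp_in W" by auto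
        then show ?case
          by (intro exI[of _ "c + d"] bexI[of _ "x' + y'"])
            (auto simp: const_add algebra_simps supp_in_closed)
      next
        case (mon c v)
        show ?case
        proof (cases "v = w")
          case True
          then show ?thesis by (intro exI[of _ c] bexI[of _ 0]) auto
        next
          case False
          with mon show ?thesis
            by (intro exI[of _ 0] bexI[of _ "const c * mon v"]) (auto intro!: supp_in_closed)
        qed
      qed
      then obtain c y where "y \<in> supp_in W" "x = const c * mon w + y" by blast
      then show "z \<in> R.line_extension (range (scal A)) (cls (mon w)) (cls ` supp_in W)"
        unfolding R.line_extension_mem_iff
        by (intro bexI[of _ "scal A c"] bexI[of _ "cls y"]) (auto simp: x(1) scal_eq SF_sel)
    qed
    ultimately show ?case
      using R.Suc_dim[of "cls (mon w)" "cls ` supp_in W" "card W" "range (scal A)"] insert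
      by (simp add: SF_sel)
  }
qed

lemma SF_sub_carrier_nf: "carrier (SF_sub A N) = cls ` supp_in (increasing (idx N))"
proof -
  have "cls x \<in> cls ` supp_in (increasing (idx N))" if "x \<in> FR N" for x
    by (rule image_eqI[of _ _ "nf x"]) (simp_all add: nf_supp[OF that])
  moreover have "supp_in (increasing (idx N)) \<subseteq> FR N"
    by (rule supp_in_mono[OF sw_lists])
  ultimately show ?thesis
    by (auto simp: SF_sub_carrier)
qed

lemma dimension_SF_sub:
  assumes "finite (increasing (idx N)) \<and> card (increasing (idx N)) = n"
  shows "ring.dimension (SF A) n (range (scal A)) (carrier (SF_sub A N))"
  using dimension_supp[of "increasing (idx N)"] assms sw_mono[of "idx N" UNIV] by (auto simp: SF_sub_carrier_nf)

section \<open>Simplicity of the algebra of the modes 0 and 1\<close>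

abbreviation p where "p \<equiv> mon [(Pls, 1)]"
abbreviation q where "q \<equiv> mon [(Mns, 1)]"

lemma anti_in_I:
  "2 \<le> m + n \<Longrightarrow> mon [(a, m)] * mon [(b, n)] + mon [(b, n)] * mon [(a, m)] \<in> I"
  "m + n = 1 \<Longrightarrow> mon [(a, m)] * mon [(b, n)] + mon [(b, n)] * mon [(a, m)]
     - const (if b = opp a then \<xi> else 0) \<in> I"
  using I_rel[of "(a, m)" "(b, n)"] bform_ge_2[of "(a, m)" "(b, n)"] bform_1[of "(a, m)" "(b, n)"]
  by simp_all

lemma sq_in_I: "0 < m \<Longrightarrow> mon [(a, m)] * mon [(a, m)] \<in> I"
  using I_sq[of "(a, m)"] bform_ge_2[of "(a, m)" "(a, m)"] by simp

text \<open>The product p * q behaves like a vacuum inside the algebra: p and q anticommute and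
  square to zero, so both annihilate it from the left.\<close>

lemma letter_pq_in_I:
  assumes "snd l \<in> {0, 1}" "0 < snd l" shows "mon [l] * p * q \<in> I"
proof -
  have "l = (Pls, 1) \<or> l = (Mns, 1)"
    using assms by (cases "fst l") (auto simp: prod_eq_iff)
  then show ?thesis
  proof
    assume "l = (Pls, 1)"
    then show ?thesis using I_mult_right[OF sq_in_I[of 1 Pls], of q] by simp
  next
    assume l: "l = (Mns, 1)"
    have "(q * p + p * q) * q - p * (q * q) \<in> I"
      by (intro I_diff I_mult_right I_mult_left sq_in_I anti_in_I) auto
    moreover have "(q * p + p * q) * q - p * (q * q) = q * p * q"
      by (simp add: algebra_simps)
    ultimately show ?thesis using l by simp
  qed
qed

text \<open>Right multiplication by p and q turns a nonzero element of the ideal into g * p * q,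
  with g nonzero in the modes 0. Since p * q behaves like a vacuum, \<open>phi_to_vacuum\<close>
  replaces g by 1. Brackets with the modes 0 then remove p and q and leave a nonzero scalar.\<close>

lemma simple_algebra_01: "simple_algebra (SF_sub A {0, 1})"
  unfolding simple_algebra_def
proof (intro conjI allI impI ring_SF_sub)
  let ?R = "SF_sub A {0, 1}"
  have "cls 1 \<noteq> cls 0" by (simp add: cls_eq_iff nf_def)
  moreover have "cls 1 \<in> carrier ?R" by (auto simp: SF_sub_carrier)
  ultimately show "carrier ?R \<noteq> {\<zero>\<^bsub>?R\<^esub>}" by auto
  fix J assume J: "ideal J ?R"
  interpret J: ideal J ?R by (rule J)
  \<comment> \<open>The preimage of the ideal in the free algebra on the modes 0 and 1, where
    congruences modulo the relations can be used.\<close>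
  define Y where "Y = {y \<in> FR {0, 1}. cls y \<in> J}"
  have Y_FR: "y \<in> FR {0, 1}" if "y \<in> Y" for y using that by (simp add: Y_def)
  have Y_left: "x * y \<in> Y" if "y \<in> Y" "x \<in> FR {0, 1}" for x y
    using J.I_l_closed[of "cls y" "cls x"] that by (auto simp: Y_def SF_sub_carrier FR_closed)
  have Y_right: "y * x \<in> Y" if "y \<in> Y" "x \<in> FR {0, 1}" for x y
    using J.I_r_closed[of "cls y" "cls x"] that by (auto simp: Y_def SF_sub_carrier FR_closed)
  have Y_add: "x + y \<in> Y" if "x \<in> Y" "y \<in> Y" for x y
    using additive_subgroup.a_closed[OF ideal.axioms(1)[OF J], of "cls x" "cls y"] that by (auto simp: Y_def FR_closed)
  have Y_minus: "- y \<in> Y" if "y \<in> Y" for y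
    using Y_left[of y "- 1"] that by (simp add: FR_closed)
  have Y_diff: "x - y \<in> Y" if "x \<in> Y" "y \<in> Y" for x y
    using Y_add[OF that(1) Y_minus[OF that(2)]] by simp
  have Y_cong: "x \<in> Y" if "y \<in> Y" "x - y \<in> I" "x \<in> FR {0, 1}" for x y
    using that cls_eq_iff[of x y] by (simp add: Y_def nf_eq_iff)
  have pq: "p \<in> FR {0, 1}" "q \<in> FR {0, 1}" by auto
  show "J = {\<zero>\<^bsub>?R\<^esub>} \<or> J = carrier ?R"
  proof (cases "J \<subseteq> {\<zero>\<^bsub>?R\<^esub>}")
    case True
    then show ?thesis using additive_subgroup.zero_closed[OF ideal.axioms(1)[OF J]] by auto
  next
    case False
    then obtain z where "z \<in> J" "z \<noteq> cls 0" by auto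
    moreover from this(1) have "z \<in> cls ` supp_in (increasing (idx {0, 1}))"
      using J.a_subset by (auto simp: SF_sub_carrier_nf)
    ultimately obtain y where y: "y \<in> supp_in (increasing (idx {0, 1}))" "y \<noteq> 0" "cls y \<in> J" by auto
    let ?P1 = "idx {0, 1} - {(Mns, 1)}" and ?P2 = "idx {0, 1} - {(Mns, 1)} - {(Pls, 1)}"
    have sw_FR: "supp_in (increasing P) \<subseteq> FR {0, 1}" if "P \<subseteq> idx {0, 1}" for P
      using supp_in_mono[OF order_trans[OF sw_lists lists_mono[OF that]]] .
    have yY: "y \<in> Y" using y sw_FR[of "idx {0, 1}"] by (auto simp: Y_def)
    have max1: "v = (Mns, 1) \<or> key v < key (Mns, 1)" if "v \<in> idx {0, 1}" for v
      using that unfolding idx_0_1 by (auto simp: key_def)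
    have max2: "v = (Pls, 1) \<or> key v < key (Pls, 1)" if "v \<in> ?P1" for v
      using that unfolding idx_0_1 by (auto simp: key_def)
    obtain a b where ab: "a \<in> supp_in (increasing ?P1)" "b \<in> supp_in (increasing ?P1)" "y = a + b * q"
      using supp_sw_snoc[OF y(1) max1] by metis
    have ab_FR: "a \<in> FR {0, 1}" "b \<in> FR {0, 1}" using ab sw_FR[of ?P1] by auto
    \<comment> \<open>If a is nonzero, right multiplication by q removes the term b * q because q
      squares to zero; otherwise y is already b * q.\<close>
    obtain b' where b': "b' \<in> supp_in (increasing ?P1)" "b' \<noteq> 0" "b' * q \<in> Y"
    proof (cases "a = 0")
      case True
      with ab y yY that[of b] show thesis by (cases "b = 0") auto
    next
      case False
      have "a * q - y * q = - b * (q * q)"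
        by (simp add: ab(3) algebra_simps)
      then have "a * q - y * q \<in> I"
        using I_mult_left[OF sq_in_I[of 1 Mns], of "- b"] by simp
      then have "a * q \<in> Y"
        by (rule Y_cong[OF Y_right[OF yY pq(2)]]) (intro FR_mult ab_FR pq)
      with False ab that[of a] show thesis by auto
    qed
    obtain c d where cd: "c \<in> supp_in (increasing ?P2)" "d \<in> supp_in (increasing ?P2)" "b' = c + d * p"
      using supp_sw_snoc[OF b'(1) max2] by metis
    have cd_FR: "c \<in> FR {0, 1}" "d \<in> FR {0, 1}" using cd sw_FR[of ?P2] by auto
    \<comment> \<open>If c is nonzero, b' * q * p is congruent to - c * p * q, because d * p * q * p
      is congruent to 0; otherwise b' * q is already d * p * q.\<close>
    obtain g where g: "g \<in> supp_in (increasing ?P2)" "g \<noteq> 0" "g * p * q \<in> Y"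
    proof (cases "c = 0")
      case True
      with cd b' that[of d] show thesis by (cases "d = 0") auto
    next
      case False
      have "c * p * q - - (b' * q * p) = c * (p * q + q * p) + d * (p * (q * p + p * q)) - d * ((p * p) * q)"
        by (simp add: cd(3) algebra_simps)
      also have "\<dots> \<in> I"
        by (intro I_add I_diff I_mult_left I_mult_right sq_in_I anti_in_I) auto
      finally have "c * p * q \<in> Y"
        by (rule Y_cong[OF Y_minus[OF Y_right[OF b'(3) pq(1)]]]) (intro FR_mult cd_FR pq)
      with False cd that[of c] show thesis by auto
    qed
    have "?P2 \<subseteq> idx {- 0..0}" unfolding idx_0_1 by auto
    then have "g \<in> supp_in (increasing (idx {- 0..0}))"
      using g(1) supp_in_mono[OF sw_mono] by blast
    from phi_to_vacuum[OF this g(2)] obtain x where x: "x \<in> FR {1..0 + 1}" "phi (x * g) = 1" .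
    have x01: "x \<in> FR {0, 1}" using FR_mono[OF _ x(1), of "{0, 1}"] by simp
    have g_FR: "g \<in> FR {0, 1}" using g sw_FR[of ?P2] by auto
    \<comment> \<open>The words dropped by \<open>phi\<close> end in a positive letter, which
      annihilates p * q.\<close>
    have kill: "z * p * q \<in> I" if "z \<in> supp_in {w \<in> increasing (idx {0, 1}). \<not> below 0 w}" for z
      using that
    proof (induction z rule: supp_in_induct)
      case (add x y)
      then show ?case using I_add[of "x * p * q" "y * p * q"] by (simp add: algebra_simps)
    next
      case (mon e w)
      then obtain v l where w: "w = v @ [l]" "v \<in> lists (idx {0, 1})" "l \<in> idx {0, 1}" "0 < snd l"
        using not_below_snoc[of w "idx {0, 1}"] by auto
      have "const e * mon v * (mon [l] * p * q) \<in> I"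
        using w by (intro I_mult_left letter_pq_in_I) auto
      then show ?case by (simp add: w(1) mon_append mult.assoc)
    qed simp
    have "(nf (x * g) - phi (x * g)) * p * q \<in> I"
      by (rule kill[OF nf_minus_phi_supp[OF FR_mult[OF x01 g_FR]]])
    moreover have "(x * g - nf (x * g)) * p * q \<in> I"
      by (intro I_mult_right diff_nf_in_I)
    ultimately have "(nf (x * g) - phi (x * g)) * p * q + (x * g - nf (x * g)) * p * q \<in> I"
      by (rule I_add)
    then have "p * q - x * (g * p * q) \<in> I"
      using I_uminus by (fastforce simp: x(2) algebra_simps)
    then have pqY: "p * q \<in> Y"
      by (rule Y_cong[OF Y_left[OF g(3) x01]]) (intro FR_mult pq)
    have xi_cancel: "z \<in> Y" if "const \<xi> * z \<in> Y" for z
    proof -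
      have "const (1 / \<xi>) * (const \<xi> * z) \<in> Y"
        by (rule Y_left[OF that]) simp
      then show ?thesis using xi by (simp flip: const_mult mult.assoc)
    qed
    let ?r = "mon [(Mns, 0)]" and ?s = "mon [(Pls, 0)]"
    have rs: "?r \<in> FR {0, 1}" "?s \<in> FR {0, 1}" by auto
    have r: "?r * p + p * ?r - const \<xi> \<in> I" "?r * q + q * ?r \<in> I" "?s * q + q * ?s - const \<xi> \<in> I"
      using anti_in_I(2)[of 0 1 Mns Pls] anti_in_I(2)[of 0 1 Mns Mns] anti_in_I(2)[of 0 1 Pls Mns] by simp_all
    \<comment> \<open>The letter \<open>?r\<close> has anticommutator \<xi> with p and 0 with q, so
      its commutator with p * q is \<xi> q.\<close>
    have "const \<xi> * q - (?r * (p * q) - p * q * ?r) = p * (?r * q + q * ?r) - (?r * p + p * ?r - const \<xi>) * q"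
      by (simp add: algebra_simps)
    also have "\<dots> \<in> I"
      by (intro I_diff I_mult_left I_mult_right r)
    finally have "const \<xi> * q \<in> Y"
      by (rule Y_cong[OF Y_diff[OF Y_left[OF pqY rs(1)] Y_right[OF pqY rs(1)]]]) (intro FR_mult pq const_supp_lists)
    then have qY: "q \<in> Y" by (rule xi_cancel)
    \<comment> \<open>The letter \<open>?s\<close> has anticommutator \<xi> with q, which puts a
      nonzero scalar into the ideal.\<close>
    have "const \<xi> * 1 - (?s * q + q * ?s) \<in> I"
      using I_uminus[OF r(3)] by simp
    then have "const \<xi> * 1 \<in> Y"
      by (rule Y_cong[OF Y_add[OF Y_left[OF qY rs(2)] Y_right[OF qY rs(2)]]]) simp
    then have "1 \<in> Y" by (rule xi_cancel)
    then have "cls x \<in> J" if "x \<in> FR {0, 1}" for x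
      using Y_left[of 1 x] that by (simp add: Y_def)
    then show ?thesis
      using J.a_subset by (auto simp: SF_sub_carrier)
  qed
qed

section \<open>The module of the modes 0 and 1\<close>

lemma nonpos_01 [simp]: "{0, 1} \<inter> {..0} = {0 :: int}"
  by auto

lemma phi_swap:
  "phi (mon [u] * (mon [v] * y)) = const (bform A u v) * phi y - phi (mon [v] * (mon [u] * y))"
proof -
  have "(mon [u] * mon [v] + mon [v] * mon [u] - const (bform A u v)) * y \<in> I"
    by (intro I_mult_right I_rel)
  then have "phi ((mon [u] * mon [v] + mon [v] * mon [u] - const (bform A u v)) * y) = 0"
    by (simp add: phi_def in_I_iff)
  then show ?thesis by (simp add: algebra_simps)
qed

lemma cls_phi_0: "x \<in> FR {0} \<Longrightarrow> cls (phi x) = cls x"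
  by (rule cls_phi_id) (erule FR_mono[rotated], simp)

lemma phi_FR_0: "x \<in> FR {0, 1} \<Longrightarrow> phi x \<in> FR {0}"
  using phi_FR[of x "{0, 1}"] by simp

lemma FR_0_imp_01: "x \<in> FR {0} \<Longrightarrow> x \<in> FR {0, 1}"
  by (erule FR_mono[rotated]) simp

text \<open>A mode of index 1 acts on the Fock space as \<xi> times the derivative by the mode 0 of
  opposite sign; dividing by \<xi> isolates the derivative.\<close>

definition dpsi :: "pm \<Rightarrow> sf_elt \<Rightarrow> sf_elt" where
  "dpsi a U = cls (const (1 / \<xi>) * phi (mon [(a, 1)] * rep U))"

lemma dpsi_cls: "dpsi a (cls x) = cls (const (1 / \<xi>) * phi (mon [(a, 1)] * x))"
proof -
  have "phi (mon [(a, 1)] * nf x) = phi (mon [(a, 1)] * x)"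
    by (rule phi_nf_cong) (rule nf_mult_cong, simp_all)
  then show ?thesis by (simp add: dpsi_def)
qed

text \<open>The anti-derivation rule is the anticommutator of a mode 1 with a mode 0, read in the
  Fock space: the bracket gives the first term of the rule, and exchanging the two modes gives the
  minus sign of the second.\<close>

lemma is_dpsi_dpsi: "is_dpsi A (opp a) (dpsi a)"
  unfolding is_dpsi_def Let_def
proof (intro conjI allI ballI)
  let ?R = "SF_sub A {0}"
  let ?u = "mon [(a, 1)]"
  have FR: "phi (?u * x) \<in> FR {0}" if "x \<in> FR {0}" for x
    by (rule phi_FR_0[OF FR_mult[OF _ FR_0_imp_01[OF that]]]) simp
  show "dpsi a \<in> carrier ?R \<rightarrow> carrier ?R"
    by (auto simp: SF_sub_carrier dpsi_cls intro!: imageI supp_in_const_times FR)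
  show "dpsi a (x \<oplus>\<^bsub>?R\<^esub> y) = dpsi a x \<oplus>\<^bsub>?R\<^esub> dpsi a y" if "x \<in> carrier ?R" "y \<in> carrier ?R" for x y
    using that by (auto simp: SF_sub_carrier dpsi_cls algebra_simps)
  show "dpsi a (scal A c \<otimes>\<^bsub>?R\<^esub> x) = scal A c \<otimes>\<^bsub>?R\<^esub> dpsi a x" if "x \<in> carrier ?R" for c x
    using that
    by (auto simp: SF_sub_carrier dpsi_cls scal_eq mult_const_left[of ?u] mult_const_left[of "const (1 / \<xi>)" c])
  show "dpsi a \<one>\<^bsub>?R\<^esub> = \<zero>\<^bsub>?R\<^esub>"
    using phi_mult_annihilator[of "(a, 1)" 1] by (simp add: dpsi_cls)
  have d: "dpsi a (psi A b 0) = (if b = opp a then cls 1 else cls 0)" for b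
  proof -
    have "phi (?u * (mon [(b, 0)] * 1)) = const (if b = opp a then \<xi> else 0)"
      using phi_mult_annihilator[of "(a, 1)" "mon [(b, 0)]"]
      by (subst phi_swap) (simp add: bform_1)
    then show ?thesis
      using xi by (auto simp: psi_eq dpsi_cls simp flip: const_mult)
  qed
  show "dpsi a (psi A (opp a) 0) = \<one>\<^bsub>?R\<^esub>" "dpsi a (psi A (opp (opp a)) 0) = \<zero>\<^bsub>?R\<^esub>"
    by (simp_all add: d)
  fix b y assume "y \<in> carrier ?R"
  then obtain x where x: "y = cls x" "x \<in> FR {0}" by (auto simp: SF_sub_carrier)
  let ?v = "mon [(b, 0)]"
  let ?c = "if b = opp a then 1 else 0 :: free_elt"
  have "cls (const (1 / \<xi>) * phi (?u * (?v * x))) = cls (?c * x - ?v * (const (1 / \<xi>) * phi (?u * x)))"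
  proof -
    have vFR: "?v * phi (?u * x) \<in> FR {0}"
      using FR[OF x(2)] by (intro FR_mult) auto
    have "phi (?u * (?v * x)) = const (if b = opp a then \<xi> else 0) * phi x - phi (?v * phi (?u * x))"
      by (subst phi_swap) (simp add: bform_1 phi_mult)
    then have "const (1 / \<xi>) * phi (?u * (?v * x)) = ?c * phi x - const (1 / \<xi>) * phi (?v * phi (?u * x))"
      using xi by (simp add: right_diff_distrib flip: mult.assoc const_mult)
    moreover have "nf (phi x) = nf x" "nf (phi (?v * phi (?u * x))) = nf (?v * phi (?u * x))"
      using cls_phi_0[OF x(2)] cls_phi_0[OF vFR] by (simp_all only: cls_eq_iff)
    ultimately show ?thesis
      by (auto simp: cls_eq_iff mult_const_left[of ?v])
  qed
  moreover have "?c * x \<in> FR {0}" "?v * (const (1 / \<xi>) * phi (?u * x)) \<in> FR {0}"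
    using x FR[OF x(2)] by (auto intro!: FR_mult supp_in_const_times)
  ultimately show "dpsi a (psi A b 0 \<otimes>\<^bsub>?R\<^esub> y)
      = (dpsi a (psi A b 0) \<otimes>\<^bsub>?R\<^esub> y) \<ominus>\<^bsub>?R\<^esub> (psi A b 0 \<otimes>\<^bsub>?R\<^esub> dpsi a y)"
    using d[of b] by (simp add: x(1) psi_eq dpsi_cls SF_sub_minus if_distrib[of cls] split: if_splits)
qed

text \<open>The Fock action of the modes 0 and 1 satisfies the requirements on \<open>V01\<close>,
  so the choice there is made from a nonempty collection.\<close>

lemma is_V01_fock: "is_V01 A \<xi> (fock {0, 1})"
  unfolding is_V01_def Let_def
proof (intro conjI allI ballI lmodule_fock)
  let ?R = "SF_sub A {0}"
  show "carrier (fock {0, 1}) = carrier ?R" by (simp add: fock_def)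
  show "add (fock {0, 1}) = add ?R" by (simp add: fock_def SF_sub_def)
  show "\<zero>\<^bsub>fock {0, 1}\<^esub> = \<zero>\<^bsub>?R\<^esub>" by (simp add: fock_sel)
  show "scal A c \<odot>\<^bsub>fock {0, 1}\<^esub> y = scal A c \<otimes>\<^bsub>?R\<^esub> y" if "y \<in> carrier ?R" for c y
    using that by (auto simp: SF_sub_carrier scal_eq fock_sel(4) cls_phi_0 supp_in_const_times simp del: phi_simps)
  show "psi A a 0 \<odot>\<^bsub>fock {0, 1}\<^esub> y = psi A a 0 \<otimes>\<^bsub>?R\<^esub> y" if "y \<in> carrier ?R" for a y
    using that by (auto simp: SF_sub_carrier psi_eq fock_sel(4) cls_phi_0 FR_mult)
  fix a
  have "psi A a 1 \<odot>\<^bsub>fock {0, 1}\<^esub> y = scal A \<xi> \<otimes>\<^bsub>?R\<^esub> dpsi a y" if "y \<in> carrier ?R" for y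
    using that xi by (auto simp: SF_sub_carrier psi_eq fock_sel(4) scal_eq dpsi_cls simp flip: mult.assoc const_mult)
  then show "\<exists>D. is_dpsi A (opp a) D \<and>
      (\<forall>y\<in>carrier ?R. psi A a 1 \<odot>\<^bsub>fock {0, 1}\<^esub> y = scal A \<xi> \<otimes>\<^bsub>?R\<^esub> D y)"
    using is_dpsi_dpsi by blast
qed

lemma is_V01_V01: "is_V01 A \<xi> (V01 A \<xi>)"
  unfolding V01_def using is_V01_fock by (rule someI)

lemma lmodule_V01: "lmodule (SF_sub A {0, 1}) (V01 A \<xi>)"
  using is_V01_V01 unfolding is_V01_def Let_def by blast

lemma V01_sel:
  "carrier (V01 A \<xi>) = cls ` FR {0}" "\<zero>\<^bsub>V01 A \<xi>\<^esub> = cls 0" "cls x \<oplus>\<^bsub>V01 A \<xi>\<^esub> cls y = cls (x + y)"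
proof -
  note V = is_V01_V01[unfolded is_V01_def Let_def]
  show "carrier (V01 A \<xi>) = cls ` FR {0}" "\<zero>\<^bsub>V01 A \<xi>\<^esub> = cls 0"
    using V by (simp_all add: SF_sub_carrier)
  have "add (V01 A \<xi>) = add (SF_sub A {0})" using V by blast
  then show "cls x \<oplus>\<^bsub>V01 A \<xi>\<^esub> cls y = cls (x + y)" by simp
qed

interpretation V01: sf_module A \<xi> "{0, 1}" "V01 A \<xi>"
  by (intro sf_module.intro sf_module_axioms.intro sl2_conn_axioms lmodule_V01)

text \<open>The predicate \<open>is_V01\<close> prescribes the action of scalars and of single
  modes, so a general element in the modes 0 has to be built up word by word.\<close>

lemma V01_ac_one: "x \<in> FR {0} \<Longrightarrow> V01.act_on x (cls 1) = cls x"
proof (induction x rule: supp_in_induct)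
  note V = is_V01_V01[unfolded is_V01_def Let_def]
  have one: "cls 1 \<in> carrier (V01 A \<xi>)" by (auto simp: V01_sel)
  have R: "carrier (SF_sub A {0}) = cls ` FR {0}" by (rule SF_sub_carrier)
  {
    case zero
    show ?case using V01.ac_0[OF one] by (simp add: V01_sel)
  next
    case (add x y)
    then show ?case
      using V01.ac_add_left[OF _ _ one] FR_0_imp_01 by (simp add: V01_sel)
  next
    case (mon c w)
    have w: "V01.act_on (mon w) (cls 1) = cls (mon w)" using mon
    proof (induction w)
      case Nil
      show ?case using V01.ac_1[OF one] by simp
    next
      case (Cons u w)
      then obtain a where u: "u = (a, 0)" by (cases u) auto
      have FRw: "mon [u] \<in> FR {0, 1}" "mon w \<in> FR {0, 1}" "cls (mon w) \<in> carrier (SF_sub A {0})"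
        using Cons u by (auto simp: R intro!: FR_0_imp_01)
      have "V01.act_on (mon (u # w)) (cls 1) = V01.act_on (mon [u]) (cls (mon w))"
        using V01.ac_mult[OF FRw(1,2) one] Cons by (simp add: mon_Cons[of u w])
      also have "\<dots> = psi A a 0 \<otimes>\<^bsub>SF_sub A {0}\<^esub> cls (mon w)"
        using V FRw(3) by (simp add: V01.act_on_def u flip: psi_eq)
      finally show ?case by (simp add: psi_eq u mon_Cons[of "(a, 0)" w])
    qed
    have FRw: "mon w \<in> FR {0, 1}" "cls (mon w) \<in> carrier (SF_sub A {0})"
      using mon by (auto simp: R intro!: FR_0_imp_01)
    have "V01.act_on (const c * mon w) (cls 1) = V01.act_on (const c) (cls (mon w))"
      using V01.ac_mult[OF _ FRw(1) one] w by simp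
    also have "\<dots> = scal A c \<otimes>\<^bsub>SF_sub A {0}\<^esub> cls (mon w)"
      using V FRw(2) by (simp add: V01.act_on_def flip: scal_eq)
    finally show ?case by (simp add: scal_eq)
  }
qed

lemma cls_1_neq_0: "cls 1 \<noteq> cls 0"
  by (simp add: cls_eq_iff nf_def)

lemma V01_vac: "V01.vacuum (cls 1)"
  unfolding V01.vacuum_def
proof (intro conjI allI impI)
  note V = is_V01_V01[unfolded is_V01_def Let_def]
  show "cls 1 \<in> carrier (V01 A \<xi>)" by (auto simp: V01_sel)
  fix v :: letter assume "snd v \<in> {0, 1}" "0 < snd v"
  then obtain a where v: "v = (a, 1)" by (cases v) auto
  obtain D where D: "is_dpsi A (opp a) D"
    "\<forall>y\<in>carrier (SF_sub A {0}). psi A a 1 \<odot>\<^bsub>V01 A \<xi>\<^esub> y = scal A \<xi> \<otimes>\<^bsub>SF_sub A {0}\<^esub> D y"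
    using V by blast
  have "D (cls 1) = cls 0" using D(1) by (simp add: is_dpsi_def Let_def)
  moreover have "cls 1 \<in> carrier (SF_sub A {0})" by (auto simp: SF_sub_carrier)
  ultimately have "psi A a 1 \<odot>\<^bsub>V01 A \<xi>\<^esub> cls 1 = scal A \<xi> \<otimes>\<^bsub>SF_sub A {0}\<^esub> cls 0"
    using D(2) by metis
  then show "V01.act_on (mon [v]) (cls 1) = \<zero>\<^bsub>V01 A \<xi>\<^esub>"
    by (simp add: V01.act_on_def v psi_eq scal_eq V01_sel)
qed

lemma V01_cyclic: "V01.cyclic (cls 1)"
proof -
  have "cls 1 \<in> carrier (V01 A \<xi>)" using V01_vac by (simp add: V01.vacuum_def)
  then have "V01.act_on x (cls 1) \<in> carrier (V01 A \<xi>)" if "x \<in> FR {0, 1}" for x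
    using that by (intro V01.ac_closed)
  moreover have "y \<in> (\<lambda>x. V01.act_on x (cls 1)) ` FR {0, 1}" if "y \<in> carrier (V01 A \<xi>)" for y
  proof -
    from that obtain x where "y = cls x" "x \<in> FR {0}" by (auto simp: V01_sel)
    then show ?thesis
      by (intro image_eqI[of _ _ x]) (simp_all add: V01_ac_one FR_0_imp_01)
  qed
  ultimately show ?thesis unfolding V01.cyclic_def by blast
qed

lemma V01_one_neq_0: "cls 1 \<noteq> \<zero>\<^bsub>V01 A \<xi>\<^esub>"
  using cls_1_neq_0 by (simp add: V01_sel)

lemma simple_V01: "simple_module (SF_sub A {0, 1}) (V01 A \<xi>)"
  by (rule V01.vac_simple[OF V01_vac V01_one_neq_0 reaches_vacuum_01 V01_cyclic])

text \<open>With only the modes 0 and 1 present, the condition of \<open>obtain_vac\<close> on modes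
  from 2 on is vacuous, so any nonzero vector of W leads to a vacuum. Both modules are then the Fock
  space.\<close>

lemma simple_01_iso_V01:
  fixes W :: "(sf_elt, 'w) module"
  assumes "simple_module (SF_sub A {0, 1}) W"
  shows "isomorphic_modules (SF_sub A {0, 1}) W (V01 A \<xi>)"
proof -
  interpret W: sf_module A \<xi> "{0, 1}" W
    using assms unfolding simple_module_def
    by (intro sf_module.intro sf_module_axioms.intro sl2_conn_axioms) blast
  have "carrier W \<noteq> {\<zero>\<^bsub>W\<^esub>}" using assms by (simp add: simple_module_def)
  then obtain v where "v \<in> carrier W" "v \<noteq> \<zero>\<^bsub>W\<^esub>" using W.M.zero_closed by blast
  then obtain u where "W.vacuum u" "u \<noteq> \<zero>\<^bsub>W\<^esub>" by (rule W.obtain_vac[rotated]) auto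
  then have "isomorphic_modules (SF_sub A {0, 1}) (fock {0, 1}) W"
    by (rule W.simple_iso_fock[OF assms _ _ reaches_vacuum_01])
  moreover have "isomorphic_modules (SF_sub A {0, 1}) (fock {0, 1}) (V01 A \<xi>)"
    by (rule V01.simple_iso_fock[OF simple_V01 V01_vac V01_one_neq_0 reaches_vacuum_01])
  ultimately show ?thesis
    by (meson isomorphic_modules_sym isomorphic_modules_trans lmodule_fock)
qed

section \<open>Induction\<close>

lemma cls_theta_cong:
  assumes "x \<in> FR {0..}" "y \<in> FR {0..}" "nf x = nf y"
  shows "cls (theta x) = cls (theta y)"
  using assms by (simp add: cls_eq_iff nf_theta)

text \<open>The action of V pulled back along \<open>theta\<close>. By \<open>cls_theta_cong\<close>
  any representative in nonnegative modes may replace \<open>rep U\<close>.\<close>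

definition extension :: "(sf_elt, 'v) module \<Rightarrow> (sf_elt, 'v) module" where
  "extension V = V\<lparr>module.smult := (\<lambda>U v. cls (theta (rep U)) \<odot>\<^bsub>V\<^esub> v)\<rparr>"

lemma extension_sel:
  "carrier (extension V) = carrier V" "add (extension V) = add V" "\<zero>\<^bsub>extension V\<^esub> = \<zero>\<^bsub>V\<^esub>"
  by (simp_all add: extension_def)

lemma extension_smult: "x \<in> FR {0..} \<Longrightarrow> cls x \<odot>\<^bsub>extension V\<^esub> v = cls (theta x) \<odot>\<^bsub>V\<^esub> v"
  using cls_theta_cong[of "nf x" x] nf_FR[of x] by (simp add: extension_def)

lemma is_extension_extension:
  assumes V: "lmodule (SF_sub A {0, 1}) V"
  shows "is_extension A V (extension V)"
  unfolding is_extension_def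
proof (intro conjI allI impI ballI extension_sel)
  interpret sf_module A \<xi> "{0, 1}" V
    by (intro sf_module.intro sf_module_axioms.intro sl2_conn_axioms V)
  let ?W = "extension V"
  have frag_smult: "cls x \<odot>\<^bsub>?W\<^esub> v = act_on (theta x) v" if "x \<in> FR {0..}" for x v
    by (simp add: act_on_def extension_smult[OF that])
  have ag: "abelian_group ?W"
    using M.abelian_group_axioms
    by (simp add: abelian_group_def abelian_group_axioms_def abelian_monoid_def extension_sel)
  show "lmodule (SF_sub A {0..}) ?W"
  proof (intro lmodule.intro lmodule_axioms.intro ring_SF_sub ag)
    fix a v assume "a \<in> carrier (SF_sub A {0..})" "v \<in> carrier ?W"
    then obtain x where x: "a = cls x" "x \<in> FR {0..}" and v: "v \<in> carrier V"
      by (auto simp: SF_sub_carrier extension_sel)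
    show "a \<odot>\<^bsub>?W\<^esub> v \<in> carrier ?W"
      using x v by (simp add: frag_smult extension_sel ac_closed theta_supp)
    show "a \<odot>\<^bsub>?W\<^esub> (v \<oplus>\<^bsub>?W\<^esub> w) = a \<odot>\<^bsub>?W\<^esub> v \<oplus>\<^bsub>?W\<^esub> a \<odot>\<^bsub>?W\<^esub> w" if "w \<in> carrier ?W" for w
      using x v that by (simp add: frag_smult extension_sel ac_add_right theta_supp)
    fix b assume "b \<in> carrier (SF_sub A {0..})"
    then obtain y where y: "b = cls y" "y \<in> FR {0..}" by (auto simp: SF_sub_carrier)
    show "(a \<oplus>\<^bsub>SF_sub A {0..}\<^esub> b) \<odot>\<^bsub>?W\<^esub> v = a \<odot>\<^bsub>?W\<^esub> v \<oplus>\<^bsub>?W\<^esub> b \<odot>\<^bsub>?W\<^esub> v"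
      using x v y by (simp add: frag_smult extension_sel supp_in_add ac_add_left theta_supp)
    show "a \<otimes>\<^bsub>SF_sub A {0..}\<^esub> b \<odot>\<^bsub>?W\<^esub> v = a \<odot>\<^bsub>?W\<^esub> (b \<odot>\<^bsub>?W\<^esub> v)"
      using x v y by (simp add: frag_smult FR_mult theta_mult ac_mult theta_supp)
  next
    fix v assume "v \<in> carrier ?W"
    then show "\<one>\<^bsub>SF_sub A {0..}\<^esub> \<odot>\<^bsub>?W\<^esub> v = v"
      by (simp add: frag_smult extension_sel ac_1)
  qed
  show "a \<odot>\<^bsub>?W\<^esub> v = a \<odot>\<^bsub>V\<^esub> v" if "a \<in> carrier (SF_sub A {0, 1})" "v \<in> carrier V" for a v
  proof -
    from that obtain x where x: "a = cls x" "x \<in> FR {0, 1}" by (auto simp: SF_sub_carrier)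
    then have "x \<in> FR {0..}" "x \<in> FR {..1}"
      using FR_mono[of "{0, 1}" "{0..}" x] FR_mono[of "{0, 1}" "{..1}" x] by auto
    then show ?thesis by (simp add: x(1) frag_smult theta_id act_on_def)
  qed
  fix n :: int and a and v
  assume "2 \<le> n" "v \<in> carrier V"
  then show "psi A a n \<odot>\<^bsub>?W\<^esub> v = \<zero>\<^bsub>V\<^esub>"
    by (simp add: psi_eq frag_smult theta_mon ac_0)
qed

lemma is_extension_extend_rep:
  "lmodule (SF_sub A {0, 1}) V \<Longrightarrow> is_extension A V (extend_rep A V)"
  unfolding extend_rep_def by (rule someI) (rule is_extension_extension)

lemma tensor_product_Ind:
  assumes "lmodule (SF_sub A {0, 1}) V"
  shows "tensor_product (SF A) (extend_rep A V) (carrier (SF_sub A {0..}))"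
proof -
  have W: "lmodule (SF_sub A {0..}) (extend_rep A V)"
    using is_extension_extend_rep[OF assms] by (simp add: is_extension_def)
  show ?thesis
    by (intro tensor_product.intro tensor_product_axioms.intro ring_SF lmodule.axioms(2)[OF W]
        lmodule.smult_closed[OF W]) (auto simp: SF_sub_carrier SF_sel)
qed

lemma lmodule_Ind:
  "lmodule (SF_sub A {0, 1}) V \<Longrightarrow> lmodule (SF_sub A UNIV) (Ind A V)"
  unfolding Ind_def SF_sub_UNIV by (rule tensor_product.lmodule_T[OF tensor_product_Ind])

text \<open>For the last claim a mode from 2 on is moved across the tensor sign, where the extended
  representation makes it act by zero.\<close>

lemma Ind_pure:
  assumes V: "lmodule (SF_sub A {0, 1}) V"
  shows "v \<in> carrier V \<Longrightarrow> Ind_tensor A V (cls x) v \<in> carrier (Ind A V)"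
    and "cls x \<odot>\<^bsub>Ind A V\<^esub> Ind_tensor A V (cls y) v = Ind_tensor A V (cls (x * y)) v"
    and "v \<in> carrier V \<Longrightarrow> s \<in> FR {0..} \<Longrightarrow>
      Ind_tensor A V (cls (x * s)) v = Ind_tensor A V (cls x) (cls s \<odot>\<^bsub>extend_rep A V\<^esub> v)"
    and "v \<in> carrier V \<Longrightarrow> 2 \<le> snd l \<Longrightarrow> cls (mon [l]) \<odot>\<^bsub>Ind A V\<^esub> Ind_tensor A V (cls 1) v = \<zero>\<^bsub>Ind A V\<^esub>"
proof -
  interpret T: tensor_product "SF A" "extend_rep A V" "carrier (SF_sub A {0..})"
    by (rule tensor_product_Ind[OF V])
  note E = is_extension_extend_rep[OF V, unfolded is_extension_def]
  have c: "carrier (extend_rep A V) = carrier V" using E by blast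
  have cl: "cls z \<in> carrier (SF A)" for z by (simp add: SF_sel)
  show "Ind_tensor A V (cls x) v \<in> carrier (Ind A V)" if "v \<in> carrier V"
    using T.pt_closed[OF cl] that unfolding Ind_tensor_def Ind_def by (simp add: c)
  show frag_smult: "cls x \<odot>\<^bsub>Ind A V\<^esub> Ind_tensor A V (cls y) v = Ind_tensor A V (cls (x * y)) v" for x y v
    using T.smult_pt[OF cl] unfolding Ind_tensor_def Ind_def by (simp add: SF_sel)
  show bal: "Ind_tensor A V (cls (x * s)) v = Ind_tensor A V (cls x) (cls s \<odot>\<^bsub>extend_rep A V\<^esub> v)"
    if "v \<in> carrier V" "s \<in> FR {0..}" for v s x
    using T.pt_balanced[OF cl, of "cls s" v x] that unfolding Ind_tensor_def
    by (simp add: SF_sel SF_sub_carrier c)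
  show "cls (mon [l]) \<odot>\<^bsub>Ind A V\<^esub> Ind_tensor A V (cls 1) v = \<zero>\<^bsub>Ind A V\<^esub>"
    if "v \<in> carrier V" "2 \<le> snd l"
  proof -
    have "cls (mon [l]) \<odot>\<^bsub>extend_rep A V\<^esub> v = \<zero>\<^bsub>extend_rep A V\<^esub>"
      using E that by (cases l) (auto simp flip: psi_eq)
    moreover have "mon [l] \<in> FR {0..}" using that by simp
    ultimately have "Ind_tensor A V (cls (1 * mon [l])) v = Ind_tensor A V (cls 1) \<zero>\<^bsub>extend_rep A V\<^esub>"
      using bal[OF that(1), of "mon [l]" 1] by simp
    also have "\<dots> = \<zero>\<^bsub>Ind A V\<^esub>"
      using T.pt_zero_right[OF cl] unfolding Ind_tensor_def Ind_def by simp
    finally show ?thesis by (simp add: frag_smult)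
  qed
qed

lemma Ind_span:
  assumes "lmodule (SF_sub A {0, 1}) V" "subgroup H (add_monoid (Ind A V))"
    "\<And>x v. v \<in> carrier V \<Longrightarrow> Ind_tensor A V (cls x) v \<in> H"
  shows "carrier (Ind A V) \<subseteq> H"
proof -
  have "carrier (extend_rep A V) = carrier V"
    using is_extension_extend_rep[OF assms(1)] by (simp add: is_extension_def)
  then show ?thesis
    using tensor_product.T_span[OF tensor_product_Ind[OF assms(1)], of H] assms(2,3)
    unfolding Ind_def Ind_tensor_def by (auto simp: SF_sel)
qed

text \<open>Both \<open>extend_rep\<close> and \<open>V01\<close> are choices, so the formula is
  derived from their properties: the unit is a vacuum for all nonnegative modes, y is y applied to
  the unit, and \<open>ac_phi\<close> evaluates the product.\<close>

lemma Ind_V01_action: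
  assumes "s \<in> FR {0..}" "y \<in> FR {0}"
  shows "cls s \<odot>\<^bsub>extend_rep A (V01 A \<xi>)\<^esub> cls y = cls (phi (s * y))"
proof -
  let ?W = "extend_rep A (V01 A \<xi>)"
  note E = is_extension_extend_rep[OF lmodule_V01, unfolded is_extension_def]
  interpret W: sf_module A \<xi> "{0..}" ?W
    using E by (intro sf_module.intro sf_module_axioms.intro sl2_conn_axioms) blast
  have c: "carrier ?W = carrier (V01 A \<xi>)" and z: "\<zero>\<^bsub>?W\<^esub> = \<zero>\<^bsub>V01 A \<xi>\<^esub>" using E by blast+
  have agree: "W.act_on x v = V01.act_on x v" if "x \<in> FR {0, 1}" "v \<in> carrier (V01 A \<xi>)" for x v
    using E that by (auto simp: W.act_on_def V01.act_on_def SF_sub_carrier)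
  have one: "cls 1 \<in> carrier (V01 A \<xi>)" using V01_vac by (simp add: V01.vacuum_def)
  have vacuum: "W.vacuum (cls 1)"
    unfolding W.vacuum_def
  proof (intro conjI allI impI)
    show "cls 1 \<in> carrier ?W" using one c by simp
    fix v :: letter assume v: "snd v \<in> {0..}" "0 < snd v"
    show "W.act_on (mon [v]) (cls 1) = \<zero>\<^bsub>?W\<^esub>"
    proof (cases "snd v = 1")
      case True
      then show ?thesis
        using V01.vacD[OF V01_vac, of v] agree[OF _ one, of "mon [v]"] by (simp add: z)
    next
      case False
      then have "2 \<le> snd v" using v by simp
      then have "psi A (fst v) (snd v) \<odot>\<^bsub>?W\<^esub> cls 1 = \<zero>\<^bsub>V01 A \<xi>\<^esub>"
        using E one by blast
      then show ?thesis by (simp add: W.act_on_def psi_eq z)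
    qed
  qed
  have ac1: "W.act_on x (cls 1) = cls x" if "x \<in> FR {0}" for x
    using agree[OF FR_0_imp_01[OF that] one] V01_ac_one[OF that] by simp
  have y: "y \<in> FR {0..}" using assms(2) by (rule FR_mono[rotated]) simp
  have "{0..} \<inter> {..0} = {0 :: int}" by auto
  then have phi0: "phi (s * y) \<in> FR {0}"
    using phi_FR[OF FR_mult[OF assms(1) y]] by simp
  have "cls s \<odot>\<^bsub>?W\<^esub> cls y = W.act_on (s * y) (cls 1)"
    using W.ac_mult[OF assms(1) y, of "cls 1"] ac1[OF assms(2)] one c by (simp add: W.act_on_def)
  also have "\<dots> = W.act_on (phi (s * y)) (cls 1)"
    using W.ac_phi[OF vacuum FR_mult[OF assms(1) y]] by simp
  finally show ?thesis using ac1[OF phi0] by simp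
qed

section \<open>The module induced from \<open>V01\<close>\<close>

interpretation IndV: sf_module A \<xi> UNIV "Ind A (V01 A \<xi>)"
  by (intro sf_module.intro sf_module_axioms.intro sl2_conn_axioms lmodule_Ind lmodule_V01)

definition ind_vac :: "((sf_elt \<times> sf_elt) \<Rightarrow>\<^sub>0 int) set" where
  "ind_vac = Ind_tensor A (V01 A \<xi>) (cls 1) (cls 1)"

lemma one_in_V01: "cls 1 \<in> carrier (V01 A \<xi>)"
  using V01_vac by (simp add: V01.vacuum_def)

lemma FR_0_nonneg: "x \<in> FR {0} \<Longrightarrow> x \<in> FR {0..}"
  by (erule FR_mono[rotated]) simp

text \<open>Each y in the modes 0 is y applied to the unit of \<open>V01\<close>, so it can be moved
  to the left factor.\<close>

lemma Ind_tensor_V01: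
  assumes "y \<in> FR {0}"
  shows "Ind_tensor A (V01 A \<xi>) (cls x) (cls y) = IndV.act_on (x * y) ind_vac"
proof -
  have "cls y \<odot>\<^bsub>extend_rep A (V01 A \<xi>)\<^esub> cls 1 = cls y"
    using Ind_V01_action[OF FR_0_nonneg[OF assms], of 1] cls_phi_0[OF assms] by simp
  then have "Ind_tensor A (V01 A \<xi>) (cls x) (cls y) = Ind_tensor A (V01 A \<xi>) (cls (x * y)) (cls 1)"
    using Ind_pure(3)[OF lmodule_V01 one_in_V01 FR_0_nonneg[OF assms], of x] by simp
  then show ?thesis
    by (simp add: IndV.act_on_def ind_vac_def Ind_pure(2)[OF lmodule_V01])
qed

text \<open>A positive mode is moved across the tensor sign; on the unit it acts as its image under
  \<open>phi\<close>, which is zero.\<close>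

lemma ind_vac_vac: "IndV.vacuum ind_vac"
  unfolding IndV.vacuum_def
proof (intro conjI allI impI)
  show c: "ind_vac \<in> carrier (Ind A (V01 A \<xi>))"
    unfolding ind_vac_def by (rule Ind_pure(1)[OF lmodule_V01 one_in_V01])
  fix v :: letter assume v: "0 < snd v"
  have "phi (mon [v] * 1) = 0" using phi_mult_annihilator[OF v, of 1] by simp
  then have "cls (mon [v]) \<odot>\<^bsub>extend_rep A (V01 A \<xi>)\<^esub> cls 1 = cls 0"
    using v Ind_V01_action[of "mon [v]" 1] by simp
  then have "Ind_tensor A (V01 A \<xi>) (cls (1 * mon [v])) (cls 1) = Ind_tensor A (V01 A \<xi>) (cls 1) (cls 0)"
    using v Ind_pure(3)[OF lmodule_V01 one_in_V01, of "mon [v]" 1] by simp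
  also have "\<dots> = IndV.act_on (1 * 0) ind_vac" by (rule Ind_tensor_V01) simp
  also have "\<dots> = \<zero>\<^bsub>Ind A (V01 A \<xi>)\<^esub>" using IndV.ac_0[OF c] by simp
  finally show "IndV.act_on (mon [v]) ind_vac = \<zero>\<^bsub>Ind A (V01 A \<xi>)\<^esub>"
    by (simp add: IndV.act_on_def ind_vac_def Ind_pure(2)[OF lmodule_V01])
qed

lemma ind_vac_closed: "ind_vac \<in> carrier (Ind A (V01 A \<xi>))"
  using ind_vac_vac by (simp add: IndV.vacuum_def)

text \<open>The product followed by \<open>phi\<close> is biadditive in U and v. It is balanced by
  \<open>phi_mult\<close>, since nonnegative modes act on \<open>V01\<close> through
  \<open>phi\<close>, and its value on the two units is 1.\<close>

lemma ind_vac_neq_0: "ind_vac \<noteq> \<zero>\<^bsub>Ind A (V01 A \<xi>)\<^esub>"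
proof -
  let ?W = "extend_rep A (V01 A \<xi>)"
  interpret T: tensor_product "SF A" ?W "carrier (SF_sub A {0..})"
    by (rule tensor_product_Ind[OF lmodule_V01])
  note E = is_extension_extend_rep[OF lmodule_V01, unfolded is_extension_def]
  have c: "carrier ?W = cls ` FR {0}" using E V01_sel(1) by simp
  have "add ?W = add (V01 A \<xi>)" using E by blast
  then have add: "cls x \<oplus>\<^bsub>?W\<^esub> cls y = cls (x + y)" for x y using V01_sel(3) by simp
  have "T.pt (cls 1) (cls 1) \<noteq> \<zero>\<^bsub>T.T\<^esub>"
  proof (rule T.pt_nonzero[where f = "\<lambda>U v. phi (rep U * rep v)"])
    fix a b v w assume "a \<in> carrier (SF A)" "v \<in> carrier ?W"
    then obtain x y where xy: "a = cls x" "v = cls y" "y \<in> FR {0}"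
      by (auto simp: SF_sel c)
    show "phi (rep (a \<oplus>\<^bsub>SF A\<^esub> b) * rep v) = phi (rep a * rep v) + phi (rep b * rep v)"
      if "b \<in> carrier (SF A)"
      using that xy by (auto simp: SF_sel(1,5) phi_mult_nf distrib_right simp del: nf_simps)
    show "phi (rep a * rep (v \<oplus>\<^bsub>?W\<^esub> w)) = phi (rep a * rep v) + phi (rep a * rep w)"
      if "w \<in> carrier ?W"
      using that xy by (auto simp: c add phi_mult_nf distrib_left simp del: nf_simps)
    show "phi (rep (a \<otimes>\<^bsub>SF A\<^esub> s) * rep v) = phi (rep a * rep (s \<odot>\<^bsub>?W\<^esub> v))"
      if s: "s \<in> carrier (SF_sub A {0..})" for s
    proof -
      from s obtain z where z: "s = cls z" "z \<in> FR {0..}" by (auto simp: SF_sub_carrier)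
      then have "s \<odot>\<^bsub>?W\<^esub> v = cls (phi (z * y))"
        using xy Ind_V01_action by simp
      then have "phi (rep a * rep (s \<odot>\<^bsub>?W\<^esub> v)) = phi (x * phi (z * y))"
        using phi_mult_nf[of x "phi (z * y)"] by (simp only: xy(1) rep_cls)
      then show ?thesis
        by (simp add: xy z SF_sel(4) phi_mult_nf phi_mult mult.assoc)
    qed
  next
    show "cls 1 \<in> carrier (SF A)" "cls 1 \<in> carrier ?W" by (auto simp: SF_sel c)
    show "phi (rep (cls 1) * rep (cls 1)) \<noteq> 0" by (simp add: phi_mult_nf)
  qed
  then show ?thesis by (simp add: ind_vac_def Ind_tensor_def Ind_def)
qed

text \<open>Pure tensors generate the module additively, and \<open>Ind_tensor_V01\<close> places
  each of them in the orbit of \<open>ind_vac\<close>.\<close>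

lemma ind_vac_cyclic: "IndV.cyclic ind_vac"
  unfolding IndV.cyclic_def FR_UNIV
proof (rule equalityI)
  show "range (\<lambda>x. IndV.act_on x ind_vac) \<subseteq> carrier (Ind A (V01 A \<xi>))"
    using IndV.ac_closed[OF _ ind_vac_closed] by auto
  show "carrier (Ind A (V01 A \<xi>)) \<subseteq> range (\<lambda>x. IndV.act_on x ind_vac)"
  proof (rule Ind_span[OF lmodule_V01])
    show "subgroup (range (\<lambda>x. IndV.act_on x ind_vac)) (add_monoid (Ind A (V01 A \<xi>)))"
    proof (rule IndV.M.add.subgroupI)
      fix a assume "a \<in> range (\<lambda>x. IndV.act_on x ind_vac)"
      then obtain x where x: "a = IndV.act_on x ind_vac" by auto
      have "\<ominus>\<^bsub>Ind A (V01 A \<xi>)\<^esub> a = IndV.act_on (- x) ind_vac"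
      proof (rule IndV.M.minus_equality)
        have "IndV.act_on (- x) ind_vac \<oplus>\<^bsub>Ind A (V01 A \<xi>)\<^esub> a = IndV.act_on (- x + x) ind_vac"
          unfolding x by (rule IndV.ac_add_left[symmetric]) (simp_all add: ind_vac_closed)
        then show "IndV.act_on (- x) ind_vac \<oplus>\<^bsub>Ind A (V01 A \<xi>)\<^esub> a = \<zero>\<^bsub>Ind A (V01 A \<xi>)\<^esub>"
          using IndV.ac_0[OF ind_vac_closed] by simp
      qed (simp_all add: x IndV.ac_closed ind_vac_closed)
      then show "\<ominus>\<^bsub>Ind A (V01 A \<xi>)\<^esub> a \<in> range (\<lambda>x. IndV.act_on x ind_vac)" by simp
    next
      fix a b assume "a \<in> range (\<lambda>x. IndV.act_on x ind_vac)" "b \<in> range (\<lambda>x. IndV.act_on x ind_vac)"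
      then obtain x y where xy: "a = IndV.act_on x ind_vac" "b = IndV.act_on y ind_vac" by auto
      have "a \<oplus>\<^bsub>Ind A (V01 A \<xi>)\<^esub> b = IndV.act_on (x + y) ind_vac"
        unfolding xy by (rule IndV.ac_add_left[symmetric]) (simp_all add: ind_vac_closed)
      then show "a \<oplus>\<^bsub>Ind A (V01 A \<xi>)\<^esub> b \<in> range (\<lambda>x. IndV.act_on x ind_vac)" by simp
    qed (auto simp: IndV.ac_closed ind_vac_closed)
    show "Ind_tensor A (V01 A \<xi>) (cls x) v \<in> range (\<lambda>x. IndV.act_on x ind_vac)"
      if "v \<in> carrier (V01 A \<xi>)" for x v
      using that by (auto simp: V01_sel Ind_tensor_V01)
  qed
qed

lemma simple_Ind_V01: "simple_module (SF A) (Ind A (V01 A \<xi>))"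
  using IndV.vac_simple[OF ind_vac_vac ind_vac_neq_0 reaches_vacuum_UNIV ind_vac_cyclic]
  by (simp add: SF_sub_UNIV)

section \<open>Simple modules among the induced modules\<close>

lemma Ind_V01_in_C: "in_C TYPE(sf_elt) A (Ind A (V01 A \<xi>))"
  unfolding in_C_def
  using lmodule_Ind[OF lmodule_V01] lmodule_V01 isomorphic_modules_refl by (auto simp: SF_sub_UNIV)

lemma fock_iso_Ind_V01: "isomorphic_modules (SF A) (fock UNIV) (Ind A (V01 A \<xi>))"
  using IndV.simple_iso_fock[OF _ ind_vac_vac ind_vac_neq_0 reaches_vacuum_UNIV] simple_Ind_V01
  by (simp add: SF_sub_UNIV)

text \<open>Some pure tensor of x and v is nonzero, hence so is the tensor of 1 and v, from which x
  produces it. The latter is killed by the modes from 2 on, as \<open>obtain_vac\<close>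
  requires.\<close>

lemma Ind_has_vac:
  fixes V :: "(sf_elt, 'v) module"
  assumes V: "lmodule (SF_sub A {0, 1}) V" and "carrier (Ind A V) \<noteq> {\<zero>\<^bsub>Ind A V\<^esub>}"
  obtains u where "sf_module.vacuum A UNIV (Ind A V) u" "u \<noteq> \<zero>\<^bsub>Ind A V\<^esub>"
proof -
  interpret T: sf_module A \<xi> UNIV "Ind A V"
    by (intro sf_module.intro sf_module_axioms.intro sl2_conn_axioms lmodule_Ind V)
  have "\<exists>x v. v \<in> carrier V \<and> Ind_tensor A V (cls x) v \<noteq> \<zero>\<^bsub>Ind A V\<^esub>"
  proof (rule ccontr)
    assume "\<not> ?thesis"
    then have "carrier (Ind A V) \<subseteq> {\<zero>\<^bsub>Ind A V\<^esub>}"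
      by (intro Ind_span[OF V]) (use T.M.add.triv_subgroup in auto)
    with assms(2) show False using T.M.zero_closed by auto
  qed
  then obtain x v where xv: "v \<in> carrier V" "Ind_tensor A V (cls x) v \<noteq> \<zero>\<^bsub>Ind A V\<^esub>" by blast
  let ?v = "Ind_tensor A V (cls 1) v"
  have "T.act_on x ?v = Ind_tensor A V (cls x) v"
    using Ind_pure(2)[OF V, of x 1 v] by (simp add: T.act_on_def)
  then have "?v \<noteq> \<zero>\<^bsub>Ind A V\<^esub>" using xv(2) T.ac_zero[of x] by auto
  moreover have "T.act_on (mon [l]) ?v = \<zero>\<^bsub>Ind A V\<^esub>" if "2 \<le> snd l" for l
    using Ind_pure(4)[OF V xv(1) that] by (simp add: T.act_on_def)
  ultimately show thesis
    using T.obtain_vac[OF _ Ind_pure(1)[OF V xv(1)], of 1] that by auto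
qed

text \<open>A vacuum of the induced module is carried over to M by the isomorphism, and a simple
  module with a nonzero vacuum is the Fock space.\<close>

lemma simple_in_C_iso_Ind_V01:
  fixes M :: "(sf_elt, 'm) module"
  assumes "in_C TYPE('v) A M" "simple_module (SF A) M"
  shows "isomorphic_modules (SF A) M (Ind A (V01 A \<xi>))"
proof -
  obtain V :: "(sf_elt, 'v) module" where V: "lmodule (SF_sub A {0, 1}) V"
    "isomorphic_modules (SF A) M (Ind A V)" and lM: "lmodule (SF A) M"
    using assms(1) unfolding in_C_def by blast
  interpret M: sf_module A \<xi> UNIV M
    using lM by (intro sf_module.intro sf_module_axioms.intro sl2_conn_axioms) (simp add: SF_sub_UNIV)
  interpret T: sf_module A \<xi> UNIV "Ind A V"
    by (intro sf_module.intro sf_module_axioms.intro sl2_conn_axioms lmodule_Ind V)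
  from isomorphic_modules_sym[OF lM V(2)] obtain g where g: "bij_betw g (carrier (Ind A V)) (carrier M)"
    "\<And>r x. r \<in> carrier (SF A) \<Longrightarrow> x \<in> carrier (Ind A V) \<Longrightarrow> g (r \<odot>\<^bsub>Ind A V\<^esub> x) = r \<odot>\<^bsub>M\<^esub> g x"
    unfolding isomorphic_modules_def module_iso_def by blast
  have gac: "g (T.act_on x v) = M.act_on x (g v)" if "v \<in> carrier (Ind A V)" for x v
    using g(2)[of "cls x" v] that by (simp add: SF_sel T.act_on_def M.act_on_def)
  have gM: "g v \<in> carrier M" if "v \<in> carrier (Ind A V)" for v
    using g(1) that by (auto dest: bij_betwE)
  \<comment> \<open>The zero vector is 0 applied to itself, and g commutes with the action.\<close>
  have g0: "g \<zero>\<^bsub>Ind A V\<^esub> = \<zero>\<^bsub>M\<^esub>"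
    using gac[of "\<zero>\<^bsub>Ind A V\<^esub>" 0] M.ac_0[OF gM] T.ac_0 by simp
  have "carrier (Ind A V) \<noteq> {\<zero>\<^bsub>Ind A V\<^esub>}"
    using assms(2) g(1) g0 by (auto simp: simple_module_def bij_betw_def)
  then obtain u where u: "T.vacuum u" "u \<noteq> \<zero>\<^bsub>Ind A V\<^esub>"
    by (rule Ind_has_vac[OF V(1)])
  have uc: "u \<in> carrier (Ind A V)" using u(1) by (simp add: T.vacuum_def)
  have "M.vacuum (g u)"
    unfolding M.vacuum_def
  proof (intro conjI allI impI)
    show "g u \<in> carrier M" by (rule gM[OF uc])
    show "M.act_on (mon [v]) (g u) = \<zero>\<^bsub>M\<^esub>" if "0 < snd v" for v
      using gac[OF uc, of "mon [v]"] T.vacD[OF u(1) _ that] g0 by simp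
  qed
  moreover have "g u \<noteq> \<zero>\<^bsub>M\<^esub>"
    using inj_onD[OF bij_betw_imp_inj_on[OF g(1)] _ uc T.M.zero_closed] u(2) g0 by auto
  ultimately have "isomorphic_modules (SF A) (fock UNIV) M"
    using M.simple_iso_fock[OF _ _ _ reaches_vacuum_UNIV] assms(2) by (simp add: SF_sub_UNIV)
  moreover have "lmodule (SF A) (fock UNIV)"
    using lmodule_fock[of UNIV] by (simp add: SF_sub_UNIV)
  ultimately show ?thesis
    by (meson isomorphic_modules_sym isomorphic_modules_trans fock_iso_Ind_V01)
qed

text \<open>Bijectivity comes from \<open>vac_iso\<close>, because the carrier of
  \<open>fock UNIV\<close> is the subalgebra of the nonpositive modes. Linearity over that
  subalgebra is read off from the action on \<open>ind_vac\<close>.\<close>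

lemma Ind_V01_iso_regular:
  "(\<lambda>x. Ind_tensor A (V01 A \<xi>) x \<one>\<^bsub>SF A\<^esub>)
     \<in> module_iso (SF_sub A {..0}) (regular_module (SF_sub A {..0})) (Ind A (V01 A \<xi>))"
proof -
  let ?f = "\<lambda>x. Ind_tensor A (V01 A \<xi>) x \<one>\<^bsub>SF A\<^esub>"
  let ?R = "SF_sub A {..0}"
  have f: "?f (cls x) = cls x \<odot>\<^bsub>Ind A (V01 A \<xi>)\<^esub> ind_vac" for x
    using Ind_tensor_V01[of 1 x] by (simp add: SF_sel IndV.act_on_def)
  note iso = IndV.vac_iso[OF ind_vac_vac ind_vac_neq_0 reaches_vacuum_UNIV ind_vac_cyclic]
  have "bij_betw (\<lambda>U. U \<odot>\<^bsub>Ind A (V01 A \<xi>)\<^esub> ind_vac) (carrier ?R) (carrier (Ind A (V01 A \<xi>)))"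
    using iso by (simp add: module_iso_def fock_def)
  then have "bij_betw ?f (carrier ?R) (carrier (Ind A (V01 A \<xi>)))"
    by (rule bij_betw_cong[THEN iffD2, rotated]) (auto simp: SF_sub_carrier f)
  moreover have "?f (x \<oplus>\<^bsub>?R\<^esub> y) = ?f x \<oplus>\<^bsub>Ind A (V01 A \<xi>)\<^esub> ?f y"
    if "x \<in> carrier ?R" "y \<in> carrier ?R" for x y
    using that IndV.ac_add_left[OF _ _ ind_vac_closed]
    by (auto simp: SF_sub_carrier f simp flip: IndV.act_on_def)
  moreover have "?f (r \<otimes>\<^bsub>?R\<^esub> x) = r \<odot>\<^bsub>Ind A (V01 A \<xi>)\<^esub> ?f x"
    if "r \<in> carrier ?R" "x \<in> carrier ?R" for r x
    using that IndV.ac_mult[OF _ _ ind_vac_closed]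
    by (auto simp: SF_sub_carrier f simp flip: IndV.act_on_def)
  ultimately show ?thesis
    by (simp add: module_iso_def regular_module_def)
qed

end

theorem corollary3p4:
  fixes A :: conn and \<xi> :: complex
  assumes sl2: "\<And>k. trace (A k) = 0"
    and A_gt: "\<And>k. k > 1 \<Longrightarrow> A k = 0"
    and A_1: "A 1 = diag_pm \<xi> (- \<xi>)"
    and xi: "\<xi> \<noteq> 0"
  shows
    "simple_algebra (SF_sub A {0, 1}) \<and>
     ring.dimension (SF A) (2 ^ 4) (range (scal A)) (carrier (SF_sub A {0, 1})) \<and>
     is_V01 A \<xi> (V01 A \<xi>) \<and>
     simple_module (SF_sub A {0, 1}) (V01 A \<xi>) \<and>
     ring.dimension (SF A) (2 ^ 2) (range (scal A)) (carrier (V01 A \<xi>)) \<and>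
     (\<forall>W :: (sf_elt, 'w) module. simple_module (SF_sub A {0, 1}) W \<longrightarrow>
        isomorphic_modules (SF_sub A {0, 1}) W (V01 A \<xi>)) \<and>
     in_C TYPE(sf_elt) A (Ind A (V01 A \<xi>)) \<and>
     simple_module (SF A) (Ind A (V01 A \<xi>)) \<and>
     (\<forall>M :: (sf_elt, 'm) module. in_C TYPE('v) A M \<and> simple_module (SF A) M \<longrightarrow>
        isomorphic_modules (SF A) M (Ind A (V01 A \<xi>))) \<and>
     (\<lambda>x. Ind_tensor A (V01 A \<xi>) x \<one>\<^bsub>SF A\<^esub>)
        \<in> module_iso (SF_sub A {..0}) (regular_module (SF_sub A {..0})) (Ind A (V01 A \<xi>))"
proof -
  interpret sl2_conn A \<xi>
    by (rule sl2_conn.intro) fact+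
  have "carrier (V01 A \<xi>) = carrier (SF_sub A {0})"
    by (simp add: V01_sel SF_sub_carrier)
  then show ?thesis
    using simple_algebra_01 dimension_SF_sub[OF card_sw_0_1] is_V01_V01 simple_V01
      dimension_SF_sub[OF card_sw_0] simple_01_iso_V01 Ind_V01_in_C simple_Ind_V01
      simple_in_C_iso_Ind_V01 Ind_V01_iso_regular
    by (intro conjI) auto
qed

end
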